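(* Let $\mathbb F$ be a field of characteristic $p>0$. The functor $\mathsf T^\circ:\Gamma_{\mathrm{alg}}\to\Gamma_{\mathrm{alg}}$, $\mathsf T^\circ(A)=\Gamma^+_A(\Omega^1_A)$, is left adjoint to the functor $\mathsf T:\Gamma_{\mathrm{alg}}\to\Gamma_{\mathrm{alg}}$, $\mathsf T(A)=A\ltimes_pA$.
   Context: Divided power algebras. A divided power algebra over $\mathbb F$ is a commutative associative non-unital $\mathbb F$-algebra $(A,* )$ (product also written by concatenation) with functions $a\mapsto a^{[n]}$, $A\to A$, for all integers $n\ge1$, such that for all $a,b\in A$, $\lambda\in\mathbb F$: $(\lambda a)^{[n]}=\lambda^na^{[n]}$; $a^{[m]}*a^{[n]}=\binom{m+n}{m}a^{[m+n]}$; $(a+b)^{[n]}=a^{[n]}+\sum_{l=1}^{n-1}a^{[l]}*b^{[n-l]}+b^{[n]}$; $a^{[1]}=a$; $(a*b)^{[n]}=n!\,a^{[n]}*b^{[n]}=a^{*n}*b^{[n]}=a^{[n]}*b^{*n}$; $(a^{[n]})^{[m]}=\frac{(mn)!}{m!(n!)^m}a^{[mn]}$. Morphisms are algebra morphisms commuting with all $(-)^{[n]}$; the category is $\Gamma_{\mathrm{alg}}$. $U(A)$ is the underlying commutative (non-unital) algebra of $A$; modules over it are in the non-unital sense. In characteristic $p>0$, a divided power structure is determined by its $p$-th operation. The functor $\mathsf T$. $A\ltimes_pA$ is the divided power algebra on $A\oplus A$ with product $(a,b)*(a',b')=(aa',ab'+a'b)$ and $p$-th divided power $(a,b)^{[p]}=(a^{[p]},-a^{p-1}b)$;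 $\mathsf T(f)=f\times f$. The functor $\mathsf T^\circ$. A divided power $A$-algebra is a morphism $f:A\to B$ of divided power algebras; $B$ is then a $U(A)$-module, and the functor sending $f:A\to B$ to the $U(A)$-module $B$ has a left adjoint, denoted $M\mapsto\Gamma_A^+(M)$. $\Omega_{U(A)}$ is the quotient of the free $U(A)$-module on symbols $\mathsf da$ ($a\in A$) by $\mathsf d(a+\lambda b)=\mathsf da+\lambda\,\mathsf db$, $\mathsf d(ab)=a\,\mathsf db+b\,\mathsf da$; $\Omega_A^1$ is the quotient of $\Omega_{U(A)}$ by the submodule generated by the elements $\mathsf d(a^{[n]})-a^{[n-1]}\mathsf da$, $a\in A$, $n\ge2$. $\mathsf T^\circ A=\Gamma^+_A(\Omega_A^1)$ is generated as a divided power algebra by $a$ and $\mathsf da$, $a\in A$, and for $f:A\to B$, $\mathsf T^\circ(f)(a)=f(a)$, $\mathsf T^\circ(f)(\mathsf da)=\mathsf d(f(a))$. *)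

theory Defs
  imports "HOL-Algebra.Module" "HOL-Algebra.AbelCoset" "HOL-Algebra.Multiplicative_Group"
begin

text \<open>The records of HOL-Algebra carry a field for a multiplicative unit (and modules a field for a
  ring multiplication). For non-unital algebras the unit is never used, and for modules neither
  the unit nor the multiplication is. In particular the library power operation, whose zeroth power
  is the unit, is not available; \<^term>\<open>n\<close>-fold products are only formed for \<^term>\<open>n\<close> at least 1.\<close>

record ('f, 'a) dpalg = "('f, 'a) module" +
  dpow :: "nat \<Rightarrow> 'a \<Rightarrow> 'a"

definition mpow :: "('a, 'r) ring_scheme \<Rightarrow> 'a \<Rightarrow> nat \<Rightarrow> 'a" where
  "mpow A a n = ((\<lambda>x. x \<otimes>\<^bsub>A\<^esub> a) ^^ (n - 1)) a"

locale nonunital_comm_algebra = module R A for R (structure) and A (structure) +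
  assumes mult_closed: "\<lbrakk>a \<in> carrier A; b \<in> carrier A\<rbrakk> \<Longrightarrow> a \<otimes>\<^bsub>A\<^esub> b \<in> carrier A"
    and mult_assoc: "\<lbrakk>a \<in> carrier A; b \<in> carrier A; c \<in> carrier A\<rbrakk> \<Longrightarrow>
      (a \<otimes>\<^bsub>A\<^esub> b) \<otimes>\<^bsub>A\<^esub> c = a \<otimes>\<^bsub>A\<^esub> (b \<otimes>\<^bsub>A\<^esub> c)"
    and mult_comm: "\<lbrakk>a \<in> carrier A; b \<in> carrier A\<rbrakk> \<Longrightarrow> a \<otimes>\<^bsub>A\<^esub> b = b \<otimes>\<^bsub>A\<^esub> a"
    and mult_add: "\<lbrakk>a \<in> carrier A; b \<in> carrier A; c \<in> carrier A\<rbrakk> \<Longrightarrow>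
      a \<otimes>\<^bsub>A\<^esub> (b \<oplus>\<^bsub>A\<^esub> c) = a \<otimes>\<^bsub>A\<^esub> b \<oplus>\<^bsub>A\<^esub> a \<otimes>\<^bsub>A\<^esub> c"
    and mult_smult: "\<lbrakk>k \<in> carrier R; a \<in> carrier A; b \<in> carrier A\<rbrakk> \<Longrightarrow>
      a \<otimes>\<^bsub>A\<^esub> (k \<odot>\<^bsub>A\<^esub> b) = k \<odot>\<^bsub>A\<^esub> (a \<otimes>\<^bsub>A\<^esub> b)"

locale divided_power_algebra =
  field F + nonunital_comm_algebra F A
  for F :: "('f, 'r) ring_scheme" (structure) and A :: "('f, 'a, 'x) dpalg_scheme" (structure) +
  assumes dpow_closed: "\<lbrakk>n \<ge> 1; a \<in> carrier A\<rbrakk> \<Longrightarrow> dpow A n a \<in> carrier A"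
    and dpow_smult: "\<lbrakk>n \<ge> 1; k \<in> carrier F; a \<in> carrier A\<rbrakk> \<Longrightarrow>
      dpow A n (k \<odot>\<^bsub>A\<^esub> a) = (k [^]\<^bsub>F\<^esub> n) \<odot>\<^bsub>A\<^esub> dpow A n a"
    and dpow_times: "\<lbrakk>m \<ge> 1; n \<ge> 1; a \<in> carrier A\<rbrakk> \<Longrightarrow>
      dpow A m a \<otimes>\<^bsub>A\<^esub> dpow A n a = [((m + n) choose m)] \<cdot>\<^bsub>A\<^esub> dpow A (m + n) a"
    and dpow_add: "\<lbrakk>n \<ge> 1; a \<in> carrier A; b \<in> carrier A\<rbrakk> \<Longrightarrow>
      dpow A n (a \<oplus>\<^bsub>A\<^esub> b) =
        dpow A n a \<oplus>\<^bsub>A\<^esub> (\<Oplus>\<^bsub>A\<^esub>l\<in>{1..<n}. dpow A l a \<otimes>\<^bsub>A\<^esub> dpow A (n - l) b) \<oplus>\<^bsub>A\<^esub> dpow A n b"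
    and dpow_one: "a \<in> carrier A \<Longrightarrow> dpow A 1 a = a"
    and dpow_mult: "\<lbrakk>n \<ge> 1; a \<in> carrier A; b \<in> carrier A\<rbrakk> \<Longrightarrow>
      dpow A n (a \<otimes>\<^bsub>A\<^esub> b) = [(fact n :: nat)] \<cdot>\<^bsub>A\<^esub> (dpow A n a \<otimes>\<^bsub>A\<^esub> dpow A n b)"
    and dpow_mult_left: "\<lbrakk>n \<ge> 1; a \<in> carrier A; b \<in> carrier A\<rbrakk> \<Longrightarrow>
      dpow A n (a \<otimes>\<^bsub>A\<^esub> b) = mpow A a n \<otimes>\<^bsub>A\<^esub> dpow A n b"
    and dpow_mult_right: "\<lbrakk>n \<ge> 1; a \<in> carrier A; b \<in> carrier A\<rbrakk> \<Longrightarrow>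
      dpow A n (a \<otimes>\<^bsub>A\<^esub> b) = dpow A n a \<otimes>\<^bsub>A\<^esub> mpow A b n"
    and dpow_dpow: "\<lbrakk>m \<ge> 1; n \<ge> 1; a \<in> carrier A\<rbrakk> \<Longrightarrow>
      dpow A m (dpow A n a) =
        [(fact (m * n) div (fact m * fact n ^ m) :: nat)] \<cdot>\<^bsub>A\<^esub> dpow A (m * n) a"

definition Gamma_alg :: "('f, 'r) ring_scheme \<Rightarrow> ('f, 'a) dpalg set" where
  "Gamma_alg F = {A. divided_power_algebra F A}"

text \<open>Morphisms are extensional functions on the carrier, so that equality of morphisms is equality
  of functions; identities and composites are \<^term>\<open>\<lambda>x\<in>carrier A. x\<close> and
  \<^term>\<open>compose (carrier A) g f\<close>.\<close>

definition Gamma_hom ::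
  "('f, 'r) ring_scheme \<Rightarrow> ('f, 'a) dpalg \<Rightarrow> ('f, 'b) dpalg \<Rightarrow> ('a \<Rightarrow> 'b) set" where
  "Gamma_hom F A B = {f \<in> carrier A \<rightarrow>\<^sub>E carrier B.
    (\<forall>a\<in>carrier A. \<forall>b\<in>carrier A. f (a \<oplus>\<^bsub>A\<^esub> b) = f a \<oplus>\<^bsub>B\<^esub> f b) \<and>
    (\<forall>k\<in>carrier F. \<forall>a\<in>carrier A. f (k \<odot>\<^bsub>A\<^esub> a) = k \<odot>\<^bsub>B\<^esub> f a) \<and>
    (\<forall>a\<in>carrier A. \<forall>b\<in>carrier A. f (a \<otimes>\<^bsub>A\<^esub> b) = f a \<otimes>\<^bsub>B\<^esub> f b) \<and>
    (\<forall>n\<ge>1. \<forall>a\<in>carrier A. f (dpow A n a) = dpow B n (f a))}"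

definition ring_char :: "('f, 'r) ring_scheme \<Rightarrow> nat" where
  "ring_char F = group.ord (add_monoid F) \<one>\<^bsub>F\<^esub>"

record ('f, 'a, 'm) umodule = "('f, 'm) module" +
  act :: "'a \<Rightarrow> 'm \<Rightarrow> 'm"

locale algebra_module = nonunital_comm_algebra F A + M?: module F M
  for F :: "('f, 'r) ring_scheme" (structure) and A :: "('f, 'a, 'x) module_scheme" (structure)
    and M :: "('f, 'a, 'm, 'y) umodule_scheme" (structure) +
  assumes act_closed: "\<lbrakk>a \<in> carrier A; x \<in> carrier M\<rbrakk> \<Longrightarrow> act M a x \<in> carrier M"
    and act_add_left: "\<lbrakk>a \<in> carrier A; b \<in> carrier A; x \<in> carrier M\<rbrakk> \<Longrightarrow>
      act M (a \<oplus>\<^bsub>A\<^esub> b) x = act M a x \<oplus>\<^bsub>M\<^esub> act M b x"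
    and act_smult_left: "\<lbrakk>k \<in> carrier F; a \<in> carrier A; x \<in> carrier M\<rbrakk> \<Longrightarrow>
      act M (k \<odot>\<^bsub>A\<^esub> a) x = k \<odot>\<^bsub>M\<^esub> act M a x"
    and act_add_right: "\<lbrakk>a \<in> carrier A; x \<in> carrier M; y \<in> carrier M\<rbrakk> \<Longrightarrow>
      act M a (x \<oplus>\<^bsub>M\<^esub> y) = act M a x \<oplus>\<^bsub>M\<^esub> act M a y"
    and act_smult_right: "\<lbrakk>k \<in> carrier F; a \<in> carrier A; x \<in> carrier M\<rbrakk> \<Longrightarrow>
      act M a (k \<odot>\<^bsub>M\<^esub> x) = k \<odot>\<^bsub>M\<^esub> act M a x"
    and act_mult: "\<lbrakk>a \<in> carrier A; b \<in> carrier A; x \<in> carrier M\<rbrakk> \<Longrightarrow>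
      act M (a \<otimes>\<^bsub>A\<^esub> b) x = act M a (act M b x)"

definition umodule_hom ::
  "('f, 'r) ring_scheme \<Rightarrow> ('f, 'a) dpalg \<Rightarrow> ('f, 'a, 'm) umodule \<Rightarrow> ('f, 'a, 'n) umodule
    \<Rightarrow> ('m \<Rightarrow> 'n) set" where
  "umodule_hom F A M N = {h \<in> carrier M \<rightarrow>\<^sub>E carrier N.
    (\<forall>x\<in>carrier M. \<forall>y\<in>carrier M. h (x \<oplus>\<^bsub>M\<^esub> y) = h x \<oplus>\<^bsub>N\<^esub> h y) \<and>
    (\<forall>k\<in>carrier F. \<forall>x\<in>carrier M. h (k \<odot>\<^bsub>M\<^esub> x) = k \<odot>\<^bsub>N\<^esub> h x) \<and>
    (\<forall>a\<in>carrier A. \<forall>x\<in>carrier M. h (act M a x) = act N a (h x))}"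

text \<open>The target of \<^term>\<open>f\<close>, a morphism out of \<^term>\<open>A\<close>, as a module over the algebra underlying
  \<^term>\<open>A\<close>.\<close>

definition restrict_umodule :: "('f, 'b) dpalg \<Rightarrow> ('a \<Rightarrow> 'b) \<Rightarrow> ('f, 'a, 'b) umodule" where
  "restrict_umodule B f = \<lparr>carrier = carrier B, mult = undefined, one = undefined,
    zero = \<zero>\<^bsub>B\<^esub>, add = add B, smult = smult B, act = (\<lambda>a b. f a \<otimes>\<^bsub>B\<^esub> b)\<rparr>"

text \<open>As the algebra has no unit, the free module on one generator is the direct sum of the ground
  field and the algebra; the pair \<^term>\<open>(k, a)\<close> is the coefficient of \<^term>\<open>k\<close> times the generator plus
  \<^term>\<open>a\<close> acting on it.\<close>

definition free_umodule ::
  "('f, 'r) ring_scheme \<Rightarrow> ('f, 'a) dpalg \<Rightarrow> 's set \<Rightarrow> ('f, 'a, 's \<Rightarrow> 'f \<times> 'a) umodule" where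
  "free_umodule F A S = \<lparr>
    carrier = {u. (\<forall>s. u s \<in> carrier F \<times> carrier A) \<and>
      finite {s. u s \<noteq> (\<zero>\<^bsub>F\<^esub>, \<zero>\<^bsub>A\<^esub>)} \<and> {s. u s \<noteq> (\<zero>\<^bsub>F\<^esub>, \<zero>\<^bsub>A\<^esub>)} \<subseteq> S},
    mult = undefined, one = undefined,
    zero = (\<lambda>s. (\<zero>\<^bsub>F\<^esub>, \<zero>\<^bsub>A\<^esub>)),
    add = (\<lambda>u v s. (fst (u s) \<oplus>\<^bsub>F\<^esub> fst (v s), snd (u s) \<oplus>\<^bsub>A\<^esub> snd (v s))),
    smult = (\<lambda>k u s. (k \<otimes>\<^bsub>F\<^esub> fst (u s), k \<odot>\<^bsub>A\<^esub> snd (u s))),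
    act = (\<lambda>a u s. (\<zero>\<^bsub>F\<^esub>, fst (u s) \<odot>\<^bsub>A\<^esub> a \<oplus>\<^bsub>A\<^esub> a \<otimes>\<^bsub>A\<^esub> snd (u s)))\<rparr>"

definition free_gen ::
  "('f, 'r) ring_scheme \<Rightarrow> ('f, 'a) dpalg \<Rightarrow> 's \<Rightarrow> ('s \<Rightarrow> 'f \<times> 'a)" where
  "free_gen F A s = (\<lambda>t. if t = s then (\<one>\<^bsub>F\<^esub>, \<zero>\<^bsub>A\<^esub>) else (\<zero>\<^bsub>F\<^esub>, \<zero>\<^bsub>A\<^esub>))"

definition umodule_span ::
  "('f, 'r) ring_scheme \<Rightarrow> ('f, 'a) dpalg \<Rightarrow> ('f, 'a, 'm) umodule \<Rightarrow> 'm set \<Rightarrow> 'm set" where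
  "umodule_span F A M X =
    \<Inter>{N. submodule N F M \<and> (\<forall>a\<in>carrier A. \<forall>x\<in>N. act M a x \<in> N) \<and> X \<subseteq> N}"

definition quot_umodule ::
  "('f, 'a, 'm) umodule \<Rightarrow> 'm set \<Rightarrow> ('f, 'a, 'm set) umodule" where
  "quot_umodule M N = \<lparr>carrier = a_rcosets\<^bsub>M\<^esub> N, mult = undefined, one = undefined,
    zero = N, add = set_add M,
    smult = (\<lambda>k X. \<Union>x\<in>X. N +>\<^bsub>M\<^esub> (k \<odot>\<^bsub>M\<^esub> x)),
    act = (\<lambda>a X. \<Union>x\<in>X. N +>\<^bsub>M\<^esub> act M a x)\<rparr>"

definition Omega_U_rels ::
  "('f, 'r) ring_scheme \<Rightarrow> ('f, 'a) dpalg \<Rightarrow> ('a \<Rightarrow> 'f \<times> 'a) set" where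
  "Omega_U_rels F A = (let M = free_umodule F A (carrier A); \<delta> = free_gen F A in
    {\<delta> (a \<oplus>\<^bsub>A\<^esub> k \<odot>\<^bsub>A\<^esub> b) \<ominus>\<^bsub>M\<^esub> (\<delta> a \<oplus>\<^bsub>M\<^esub> k \<odot>\<^bsub>M\<^esub> \<delta> b) |a k b.
        a \<in> carrier A \<and> k \<in> carrier F \<and> b \<in> carrier A} \<union>
    {\<delta> (a \<otimes>\<^bsub>A\<^esub> b) \<ominus>\<^bsub>M\<^esub> (act M a (\<delta> b) \<oplus>\<^bsub>M\<^esub> act M b (\<delta> a)) |a b.
        a \<in> carrier A \<and> b \<in> carrier A})"

definition Omega_U_submodule ::
  "('f, 'r) ring_scheme \<Rightarrow> ('f, 'a) dpalg \<Rightarrow> ('a \<Rightarrow> 'f \<times> 'a) set" where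
  "Omega_U_submodule F A = umodule_span F A (free_umodule F A (carrier A)) (Omega_U_rels F A)"

definition Omega_U ::
  "('f, 'r) ring_scheme \<Rightarrow> ('f, 'a) dpalg \<Rightarrow> ('f, 'a, ('a \<Rightarrow> 'f \<times> 'a) set) umodule" where
  "Omega_U F A = quot_umodule (free_umodule F A (carrier A)) (Omega_U_submodule F A)"

definition d_U ::
  "('f, 'r) ring_scheme \<Rightarrow> ('f, 'a) dpalg \<Rightarrow> 'a \<Rightarrow> ('a \<Rightarrow> 'f \<times> 'a) set" where
  "d_U F A a = Omega_U_submodule F A +>\<^bsub>free_umodule F A (carrier A)\<^esub> free_gen F A a"

definition Omega1_submodule ::
  "('f, 'r) ring_scheme \<Rightarrow> ('f, 'a) dpalg \<Rightarrow> ('a \<Rightarrow> 'f \<times> 'a) set set" where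
  "Omega1_submodule F A = umodule_span F A (Omega_U F A)
    {d_U F A (dpow A n a) \<ominus>\<^bsub>Omega_U F A\<^esub> act (Omega_U F A) (dpow A (n - 1) a) (d_U F A a) |n a.
      n \<ge> 2 \<and> a \<in> carrier A}"

definition Omega1 ::
  "('f, 'r) ring_scheme \<Rightarrow> ('f, 'a) dpalg \<Rightarrow> ('f, 'a, ('a \<Rightarrow> 'f \<times> 'a) set set) umodule" where
  "Omega1 F A = quot_umodule (Omega_U F A) (Omega1_submodule F A)"

definition d_Omega1 ::
  "('f, 'r) ring_scheme \<Rightarrow> ('f, 'a) dpalg \<Rightarrow> 'a \<Rightarrow> ('a \<Rightarrow> 'f \<times> 'a) set set" where
  "d_Omega1 F A a = Omega1_submodule F A +>\<^bsub>Omega_U F A\<^esub> d_U F A a"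

text \<open>The left adjoint is constructed as an algebra of terms in the elements of \<^term>\<open>A\<close> and of the
  module \<^term>\<open>M\<close>, modulo the smallest congruence that makes it a divided power algebra, makes the
  inclusion of \<^term>\<open>A\<close> a morphism, and makes the inclusion of \<^term>\<open>M\<close> linear over \<^term>\<open>A\<close>. Its
  universal property, against algebras on an arbitrary type, is proved at the end of this theory.\<close>

datatype ('f, 'a, 'm) dpterm =
    TAlg 'a | TGen 'm | TZero
  | TAdd "('f, 'a, 'm) dpterm" "('f, 'a, 'm) dpterm"
  | TScal 'f "('f, 'a, 'm) dpterm"
  | TMul "('f, 'a, 'm) dpterm" "('f, 'a, 'm) dpterm"
  | TDpow nat "('f, 'a, 'm) dpterm"

inductive_set dpterms ::
  "('f, 'r) ring_scheme \<Rightarrow> ('f, 'a) dpalg \<Rightarrow> ('f, 'a, 'm) umodule \<Rightarrow> ('f, 'a, 'm) dpterm set"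
  for F :: "('f, 'r) ring_scheme" and A :: "('f, 'a) dpalg" and M :: "('f, 'a, 'm) umodule" where
  tAlg: "a \<in> carrier A \<Longrightarrow> TAlg a \<in> dpterms F A M"
| tGen: "x \<in> carrier M \<Longrightarrow> TGen x \<in> dpterms F A M"
| tZero: "TZero \<in> dpterms F A M"
| tAdd: "\<lbrakk>s \<in> dpterms F A M; t \<in> dpterms F A M\<rbrakk> \<Longrightarrow> TAdd s t \<in> dpterms F A M"
| tScal: "\<lbrakk>k \<in> carrier F; t \<in> dpterms F A M\<rbrakk> \<Longrightarrow> TScal k t \<in> dpterms F A M"
| tMul: "\<lbrakk>s \<in> dpterms F A M; t \<in> dpterms F A M\<rbrakk> \<Longrightarrow> TMul s t \<in> dpterms F A M"
| tDpow: "\<lbrakk>n \<ge> 1; t \<in> dpterms F A M\<rbrakk> \<Longrightarrow> TDpow n t \<in> dpterms F A M"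

definition TNat ::
  "('f, 'r) ring_scheme \<Rightarrow> nat \<Rightarrow> ('f, 'a, 'm) dpterm \<Rightarrow> ('f, 'a, 'm) dpterm" where
  "TNat F n t = TScal ([n] \<cdot>\<^bsub>F\<^esub> \<one>\<^bsub>F\<^esub>) t"

definition TSum :: "('f, 'a, 'm) dpterm list \<Rightarrow> ('f, 'a, 'm) dpterm" where
  "TSum ts = foldr TAdd ts TZero"

definition TPow :: "('f, 'a, 'm) dpterm \<Rightarrow> nat \<Rightarrow> ('f, 'a, 'm) dpterm" where
  "TPow t n = ((\<lambda>s. TMul s t) ^^ (n - 1)) t"

inductive dpeq ::
  "('f, 'r) ring_scheme \<Rightarrow> ('f, 'a) dpalg \<Rightarrow> ('f, 'a, 'm) umodule
    \<Rightarrow> ('f, 'a, 'm) dpterm \<Rightarrow> ('f, 'a, 'm) dpterm \<Rightarrow> bool"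
  for F :: "('f, 'r) ring_scheme" and A :: "('f, 'a) dpalg" and M :: "('f, 'a, 'm) umodule" where
  refl: "t \<in> dpterms F A M \<Longrightarrow> dpeq F A M t t"
| sym: "dpeq F A M s t \<Longrightarrow> dpeq F A M t s"
| trans: "\<lbrakk>dpeq F A M s t; dpeq F A M t u\<rbrakk> \<Longrightarrow> dpeq F A M s u"
| cong_add: "\<lbrakk>dpeq F A M s s'; dpeq F A M t t'\<rbrakk> \<Longrightarrow> dpeq F A M (TAdd s t) (TAdd s' t')"
| cong_scal: "\<lbrakk>k \<in> carrier F; dpeq F A M t t'\<rbrakk> \<Longrightarrow> dpeq F A M (TScal k t) (TScal k t')"
| cong_mul: "\<lbrakk>dpeq F A M s s'; dpeq F A M t t'\<rbrakk> \<Longrightarrow> dpeq F A M (TMul s t) (TMul s' t')"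
| cong_dpow: "\<lbrakk>n \<ge> 1; dpeq F A M t t'\<rbrakk> \<Longrightarrow> dpeq F A M (TDpow n t) (TDpow n t')"

| add_assoc: "\<lbrakk>s \<in> dpterms F A M; t \<in> dpterms F A M; u \<in> dpterms F A M\<rbrakk> \<Longrightarrow>
    dpeq F A M (TAdd (TAdd s t) u) (TAdd s (TAdd t u))"
| add_comm: "\<lbrakk>s \<in> dpterms F A M; t \<in> dpterms F A M\<rbrakk> \<Longrightarrow> dpeq F A M (TAdd s t) (TAdd t s)"
| add_zero: "t \<in> dpterms F A M \<Longrightarrow> dpeq F A M (TAdd TZero t) t"
| add_neg: "t \<in> dpterms F A M \<Longrightarrow> dpeq F A M (TAdd (TScal (\<ominus>\<^bsub>F\<^esub> \<one>\<^bsub>F\<^esub>) t) t) TZero"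
| scal_add: "\<lbrakk>k \<in> carrier F; s \<in> dpterms F A M; t \<in> dpterms F A M\<rbrakk> \<Longrightarrow>
    dpeq F A M (TScal k (TAdd s t)) (TAdd (TScal k s) (TScal k t))"
| add_scal: "\<lbrakk>k \<in> carrier F; l \<in> carrier F; t \<in> dpterms F A M\<rbrakk> \<Longrightarrow>
    dpeq F A M (TScal (k \<oplus>\<^bsub>F\<^esub> l) t) (TAdd (TScal k t) (TScal l t))"
| scal_scal: "\<lbrakk>k \<in> carrier F; l \<in> carrier F; t \<in> dpterms F A M\<rbrakk> \<Longrightarrow>
    dpeq F A M (TScal (k \<otimes>\<^bsub>F\<^esub> l) t) (TScal k (TScal l t))"
| scal_one: "t \<in> dpterms F A M \<Longrightarrow> dpeq F A M (TScal \<one>\<^bsub>F\<^esub> t) t"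
| mul_assoc: "\<lbrakk>s \<in> dpterms F A M; t \<in> dpterms F A M; u \<in> dpterms F A M\<rbrakk> \<Longrightarrow>
    dpeq F A M (TMul (TMul s t) u) (TMul s (TMul t u))"
| mul_comm: "\<lbrakk>s \<in> dpterms F A M; t \<in> dpterms F A M\<rbrakk> \<Longrightarrow> dpeq F A M (TMul s t) (TMul t s)"
| mul_add: "\<lbrakk>s \<in> dpterms F A M; t \<in> dpterms F A M; u \<in> dpterms F A M\<rbrakk> \<Longrightarrow>
    dpeq F A M (TMul s (TAdd t u)) (TAdd (TMul s t) (TMul s u))"
| mul_scal: "\<lbrakk>k \<in> carrier F; s \<in> dpterms F A M; t \<in> dpterms F A M\<rbrakk> \<Longrightarrow>
    dpeq F A M (TMul s (TScal k t)) (TScal k (TMul s t))"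

| dp_smult: "\<lbrakk>n \<ge> 1; k \<in> carrier F; t \<in> dpterms F A M\<rbrakk> \<Longrightarrow>
    dpeq F A M (TDpow n (TScal k t)) (TScal (k [^]\<^bsub>F\<^esub> n) (TDpow n t))"
| dp_times: "\<lbrakk>m \<ge> 1; n \<ge> 1; t \<in> dpterms F A M\<rbrakk> \<Longrightarrow>
    dpeq F A M (TMul (TDpow m t) (TDpow n t)) (TNat F ((m + n) choose m) (TDpow (m + n) t))"
| dp_add: "\<lbrakk>n \<ge> 1; s \<in> dpterms F A M; t \<in> dpterms F A M\<rbrakk> \<Longrightarrow>
    dpeq F A M (TDpow n (TAdd s t))
      (TAdd (TAdd (TDpow n s) (TSum (map (\<lambda>l. TMul (TDpow l s) (TDpow (n - l) t)) [1..<n])))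
        (TDpow n t))"
| dp_one: "t \<in> dpterms F A M \<Longrightarrow> dpeq F A M (TDpow 1 t) t"
| dp_mult: "\<lbrakk>n \<ge> 1; s \<in> dpterms F A M; t \<in> dpterms F A M\<rbrakk> \<Longrightarrow>
    dpeq F A M (TDpow n (TMul s t)) (TNat F (fact n) (TMul (TDpow n s) (TDpow n t)))"
| dp_mult_left: "\<lbrakk>n \<ge> 1; s \<in> dpterms F A M; t \<in> dpterms F A M\<rbrakk> \<Longrightarrow>
    dpeq F A M (TDpow n (TMul s t)) (TMul (TPow s n) (TDpow n t))"
| dp_mult_right: "\<lbrakk>n \<ge> 1; s \<in> dpterms F A M; t \<in> dpterms F A M\<rbrakk> \<Longrightarrow>
    dpeq F A M (TDpow n (TMul s t)) (TMul (TDpow n s) (TPow t n))"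
| dp_dpow: "\<lbrakk>m \<ge> 1; n \<ge> 1; t \<in> dpterms F A M\<rbrakk> \<Longrightarrow>
    dpeq F A M (TDpow m (TDpow n t))
      (TNat F (fact (m * n) div (fact m * fact n ^ m)) (TDpow (m * n) t))"

| alg_add: "\<lbrakk>a \<in> carrier A; b \<in> carrier A\<rbrakk> \<Longrightarrow>
    dpeq F A M (TAlg (a \<oplus>\<^bsub>A\<^esub> b)) (TAdd (TAlg a) (TAlg b))"
| alg_smult: "\<lbrakk>k \<in> carrier F; a \<in> carrier A\<rbrakk> \<Longrightarrow>
    dpeq F A M (TAlg (k \<odot>\<^bsub>A\<^esub> a)) (TScal k (TAlg a))"
| alg_mult: "\<lbrakk>a \<in> carrier A; b \<in> carrier A\<rbrakk> \<Longrightarrow>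
    dpeq F A M (TAlg (a \<otimes>\<^bsub>A\<^esub> b)) (TMul (TAlg a) (TAlg b))"
| alg_dpow: "\<lbrakk>n \<ge> 1; a \<in> carrier A\<rbrakk> \<Longrightarrow>
    dpeq F A M (TAlg (dpow A n a)) (TDpow n (TAlg a))"

| gen_add: "\<lbrakk>x \<in> carrier M; y \<in> carrier M\<rbrakk> \<Longrightarrow>
    dpeq F A M (TGen (x \<oplus>\<^bsub>M\<^esub> y)) (TAdd (TGen x) (TGen y))"
| gen_smult: "\<lbrakk>k \<in> carrier F; x \<in> carrier M\<rbrakk> \<Longrightarrow>
    dpeq F A M (TGen (k \<odot>\<^bsub>M\<^esub> x)) (TScal k (TGen x))"
| gen_act: "\<lbrakk>a \<in> carrier A; x \<in> carrier M\<rbrakk> \<Longrightarrow>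
    dpeq F A M (TGen (act M a x)) (TMul (TAlg a) (TGen x))"

definition dprel ::
  "('f, 'r) ring_scheme \<Rightarrow> ('f, 'a) dpalg \<Rightarrow> ('f, 'a, 'm) umodule
    \<Rightarrow> (('f, 'a, 'm) dpterm \<times> ('f, 'a, 'm) dpterm) set" where
  "dprel F A M = {(s, t). dpeq F A M s t}"

definition Gamma_plus ::
  "('f, 'r) ring_scheme \<Rightarrow> ('f, 'a) dpalg \<Rightarrow> ('f, 'a, 'm) umodule
    \<Rightarrow> ('f, ('f, 'a, 'm) dpterm set) dpalg" where
  "Gamma_plus F A M = (let R = dprel F A M in \<lparr>
    carrier = dpterms F A M // R,
    mult = (\<lambda>X Y. \<Union>s\<in>X. \<Union>t\<in>Y. R `` {TMul s t}),
    one = undefined,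
    zero = R `` {TZero},
    add = (\<lambda>X Y. \<Union>s\<in>X. \<Union>t\<in>Y. R `` {TAdd s t}),
    smult = (\<lambda>k X. \<Union>t\<in>X. R `` {TScal k t}),
    dpow = (\<lambda>n X. \<Union>t\<in>X. R `` {TDpow n t})\<rparr>)"

definition Gamma_plus_alg ::
  "('f, 'r) ring_scheme \<Rightarrow> ('f, 'a) dpalg \<Rightarrow> ('f, 'a, 'm) umodule
    \<Rightarrow> 'a \<Rightarrow> ('f, 'a, 'm) dpterm set" where
  "Gamma_plus_alg F A M = (\<lambda>a\<in>carrier A. dprel F A M `` {TAlg a})"

definition Gamma_plus_gen ::
  "('f, 'r) ring_scheme \<Rightarrow> ('f, 'a) dpalg \<Rightarrow> ('f, 'a, 'm) umodule
    \<Rightarrow> 'm \<Rightarrow> ('f, 'a, 'm) dpterm set" where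
  "Gamma_plus_gen F A M = (\<lambda>x\<in>carrier M. dprel F A M `` {TGen x})"

type_synonym ('f, 'a) T_circ_carrier = "('f, 'a, ('a \<Rightarrow> 'f \<times> 'a) set set) dpterm set"

definition T_circ ::
  "('f, 'r) ring_scheme \<Rightarrow> ('f, 'a) dpalg \<Rightarrow> ('f, ('f, 'a) T_circ_carrier) dpalg" where
  "T_circ F A = Gamma_plus F A (Omega1 F A)"

definition T_circ_alg :: "('f, 'r) ring_scheme \<Rightarrow> ('f, 'a) dpalg \<Rightarrow> 'a \<Rightarrow> ('f, 'a) T_circ_carrier" where
  "T_circ_alg F A = Gamma_plus_alg F A (Omega1 F A)"

definition T_circ_d :: "('f, 'r) ring_scheme \<Rightarrow> ('f, 'a) dpalg \<Rightarrow> 'a \<Rightarrow> ('f, 'a) T_circ_carrier" where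
  "T_circ_d F A a = Gamma_plus_gen F A (Omega1 F A) (d_Omega1 F A a)"

definition T_circ_map ::
  "('f, 'r) ring_scheme \<Rightarrow> ('f, 'a) dpalg \<Rightarrow> ('f, 'b) dpalg \<Rightarrow> ('a \<Rightarrow> 'b)
    \<Rightarrow> ('f, 'a) T_circ_carrier \<Rightarrow> ('f, 'b) T_circ_carrier" where
  "T_circ_map F A B f = (THE g. g \<in> Gamma_hom F (T_circ F A) (T_circ F B) \<and>
    (\<forall>a\<in>carrier A. g (T_circ_alg F A a) = T_circ_alg F B (f a) \<and>
      g (T_circ_d F A a) = T_circ_d F B (f a)))"

definition T_module :: "('f, 'a) dpalg \<Rightarrow> ('f, 'a \<times> 'a) module" where
  "T_module A = \<lparr>carrier = carrier A \<times> carrier A,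
    mult = (\<lambda>(a, b) (a', b'). (a \<otimes>\<^bsub>A\<^esub> a', a \<otimes>\<^bsub>A\<^esub> b' \<oplus>\<^bsub>A\<^esub> a' \<otimes>\<^bsub>A\<^esub> b)),
    one = undefined,
    zero = (\<zero>\<^bsub>A\<^esub>, \<zero>\<^bsub>A\<^esub>),
    add = (\<lambda>(a, b) (a', b'). (a \<oplus>\<^bsub>A\<^esub> a', b \<oplus>\<^bsub>A\<^esub> b')),
    smult = (\<lambda>k (a, b). (k \<odot>\<^bsub>A\<^esub> a, k \<odot>\<^bsub>A\<^esub> b))\<rparr>"

definition with_dpow :: "('f, 'a) module \<Rightarrow> (nat \<Rightarrow> 'a \<Rightarrow> 'a) \<Rightarrow> ('f, 'a) dpalg" where
  "with_dpow A \<gamma> = module.extend A (dpalg.fields \<gamma>)"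

lemma with_dpow_simps [simp]:
  "carrier (with_dpow A \<gamma>) = carrier A" "monoid.mult (with_dpow A \<gamma>) = monoid.mult A"
  "zero (with_dpow A \<gamma>) = zero A" "add (with_dpow A \<gamma>) = add A"
  "smult (with_dpow A \<gamma>) = smult A" "dpow (with_dpow A \<gamma>) = \<gamma>"
  by (simp_all add: with_dpow_def module.defs dpalg.defs)

text \<open>In characteristic \<^term>\<open>p\<close> a divided power structure is determined by its \<^term>\<open>p\<close>-th operation,
  so this is the only one with the prescribed \<^term>\<open>p\<close>-th power; extensionality only normalises the
  values of the operations outside their domain. The other operations are
  (a, b) \<mapsto> (a[n], a[n-1] b) for \<^term>\<open>n \<ge> 2\<close>, where a[n] is the \<^term>\<open>n\<close>-th divided power.\<close>

definition T_dpow ::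
  "('f, 'r) ring_scheme \<Rightarrow> nat \<Rightarrow> ('f, 'a) dpalg \<Rightarrow> nat \<Rightarrow> 'a \<times> 'a \<Rightarrow> 'a \<times> 'a" where
  "T_dpow F p A = (THE \<gamma>.
    \<gamma> \<in> {1..} \<rightarrow>\<^sub>E (carrier (T_module A) \<rightarrow>\<^sub>E carrier (T_module A)) \<and>
    divided_power_algebra F (with_dpow (T_module A) \<gamma>) \<and>
    (\<forall>a\<in>carrier A. \<forall>b\<in>carrier A.
      \<gamma> p (a, b) = (dpow A p a, \<ominus>\<^bsub>A\<^esub> (mpow A a (p - 1) \<otimes>\<^bsub>A\<^esub> b))))"

definition T_obj ::
  "('f, 'r) ring_scheme \<Rightarrow> nat \<Rightarrow> ('f, 'a) dpalg \<Rightarrow> ('f, 'a \<times> 'a) dpalg" where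
  "T_obj F p A = with_dpow (T_module A) (T_dpow F p A)"

definition T_map :: "('f, 'a) dpalg \<Rightarrow> ('a \<Rightarrow> 'b) \<Rightarrow> 'a \<times> 'a \<Rightarrow> 'b \<times> 'b" where
  "T_map A f = (\<lambda>(a, b)\<in>carrier A \<times> carrier A. (f a, f b))"

text \<open>The adjunction bijection from morphisms \<^term>\<open>h\<close> out of \<^term>\<open>T_circ F A\<close> to morphisms out of
  \<^term>\<open>A\<close>. It is a polymorphic constant, because a family of bijections natural over algebras
  carried by different types cannot be bound by an existential quantifier.\<close>

definition T_transpose ::
  "('f, 'r) ring_scheme \<Rightarrow> ('f, 'a) dpalg \<Rightarrow> (('f, 'a) T_circ_carrier \<Rightarrow> 'b) \<Rightarrow> 'a \<Rightarrow> 'b \<times> 'b" where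
  "T_transpose F A h = (\<lambda>a\<in>carrier A. (h (T_circ_alg F A a), h (T_circ_d F A a)))"

lemma TPow_in: "t \<in> dpterms F A M \<Longrightarrow> TPow t n \<in> dpterms F A M"
proof -
  assume t: "t \<in> dpterms F A M"
  have "((\<lambda>s. TMul s t) ^^ k) t \<in> dpterms F A M" for k
    by (induction k) (auto intro: t tMul)
  then show ?thesis by (simp add: TPow_def)
qed

lemma TSum_in: "set ts \<subseteq> dpterms F A M \<Longrightarrow> TSum ts \<in> dpterms F A M"
  unfolding TSum_def by (induction ts) (auto intro: tZero tAdd)

locale Gamma_plus_setup = A: divided_power_algebra F A + AM: algebra_module F A M
  for F :: "('f, 'r) ring_scheme" (structure) and A :: "('f, 'a) dpalg" (structure)
    and M :: "('f, 'a, 'm) umodule" (structure)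
begin

abbreviation "D \<equiv> dpterms F A M"
abbreviation "G \<equiv> Gamma_plus F A M"
definition cls where "cls t = dprel F A M `` {t}"

lemma nat_in_F: "[(n::nat)] \<cdot>\<^bsub>F\<^esub> \<one>\<^bsub>F\<^esub> \<in> carrier F"
  by simp

lemma TNat_in: "t \<in> D \<Longrightarrow> TNat F n t \<in> D"
  unfolding TNat_def by (intro tScal nat_in_F)

lemma dpeq_in: "dpeq F A M s t \<Longrightarrow> s \<in> D \<and> t \<in> D"
proof (induction rule: dpeq.induct)
  case (dp_add n s t)
  have "TSum (map (\<lambda>l. TMul (TDpow l s) (TDpow (n - l) t)) [1..<n]) \<in> D"
    using dp_add by (auto intro!: TSum_in simp: dpterms.intros)
  with dp_add show ?case by (simp add: dpterms.intros)
next
  case (dp_dpow m n t)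
  then have "m * n \<ge> 1" by simp
  with dp_dpow show ?case by (auto intro!: dpterms.intros TNat_in)
qed (auto intro!: dpterms.intros TNat_in TPow_in A.mult_closed A.dpow_closed AM.act_closed)

lemma equiv_dprel: "equiv D (dprel F A M)"
  using dpeq_in unfolding dprel_def
  by (auto intro!: equivI refl_onI symI transI intro: dpeq.intros)

lemma cls_eq_iff: "\<lbrakk>s \<in> D; t \<in> D\<rbrakk> \<Longrightarrow> cls s = cls t \<longleftrightarrow> dpeq F A M s t"
  using eq_equiv_class_iff[OF equiv_dprel] by (simp add: dprel_def cls_def)

lemma cls_eqI: "dpeq F A M s t \<Longrightarrow> cls s = cls t"
  using cls_eq_iff dpeq_in by blast

lemma carrier_G: "carrier G = cls ` D"
  by (auto simp: Gamma_plus_def Let_def quotient_def cls_def)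

lemma G_zero: "\<zero>\<^bsub>G\<^esub> = cls TZero"
  by (simp add: Gamma_plus_def Let_def cls_def)

lemma G_add: "\<lbrakk>s \<in> D; t \<in> D\<rbrakk> \<Longrightarrow> cls s \<oplus>\<^bsub>G\<^esub> cls t = cls (TAdd s t)"
proof -
  assume st: "s \<in> D" "t \<in> D"
  have "congruent2 (dprel F A M) (dprel F A M) (\<lambda>s t. cls (TAdd s t))"
    unfolding congruent2_def using cls_eqI[OF cong_add] by (simp add: dprel_def)
  from UN_equiv_class2[OF equiv_dprel equiv_dprel this st]
  show ?thesis by (simp add: Gamma_plus_def Let_def cls_def)
qed

lemma G_mult: "\<lbrakk>s \<in> D; t \<in> D\<rbrakk> \<Longrightarrow> cls s \<otimes>\<^bsub>G\<^esub> cls t = cls (TMul s t)"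
proof -
  assume st: "s \<in> D" "t \<in> D"
  have "congruent2 (dprel F A M) (dprel F A M) (\<lambda>s t. cls (TMul s t))"
    unfolding congruent2_def using cls_eqI[OF cong_mul] by (simp add: dprel_def)
  from UN_equiv_class2[OF equiv_dprel equiv_dprel this st]
  show ?thesis by (simp add: Gamma_plus_def Let_def cls_def)
qed

lemma G_smult: "\<lbrakk>k \<in> carrier F; t \<in> D\<rbrakk> \<Longrightarrow> k \<odot>\<^bsub>G\<^esub> cls t = cls (TScal k t)"
proof -
  assume k: "k \<in> carrier F" and t: "t \<in> D"
  have "congruent (dprel F A M) (\<lambda>t. cls (TScal k t))"
    unfolding congruent_def using cls_eqI[OF cong_scal[OF k]] by (simp add: dprel_def)
  from UN_equiv_class[OF equiv_dprel this t]
  show ?thesis by (simp add: Gamma_plus_def Let_def cls_def)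
qed

lemma G_dpow: "\<lbrakk>n \<ge> 1; t \<in> D\<rbrakk> \<Longrightarrow> dpow G n (cls t) = cls (TDpow n t)"
proof -
  assume n: "n \<ge> 1" and t: "t \<in> D"
  have "congruent (dprel F A M) (\<lambda>t. cls (TDpow n t))"
    unfolding congruent_def using cls_eqI[OF cong_dpow[OF n]] by (simp add: dprel_def)
  from UN_equiv_class[OF equiv_dprel this t]
  show ?thesis by (simp add: Gamma_plus_def Let_def cls_def)
qed

lemmas G_ops = G_zero G_add G_mult G_smult G_dpow

lemma abelian_group_G: "abelian_group G"
proof (rule abelian_groupI)
  fix x assume "x \<in> carrier G"
  then obtain t where t: "t \<in> D" "x = cls t" by (auto simp: carrier_G)
  have "TScal (\<ominus>\<^bsub>F\<^esub> \<one>\<^bsub>F\<^esub>) t \<in> D" using t by (auto intro: tScal)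
  moreover have "cls (TScal (\<ominus>\<^bsub>F\<^esub> \<one>\<^bsub>F\<^esub>) t) \<oplus>\<^bsub>G\<^esub> x = \<zero>\<^bsub>G\<^esub>"
    using t calculation by (auto simp: G_ops cls_eq_iff dpterms.intros del: equalityI intro: add_neg)
  ultimately show "\<exists>y\<in>carrier G. y \<oplus>\<^bsub>G\<^esub> x = \<zero>\<^bsub>G\<^esub>"
    by (auto simp: carrier_G)
next
  fix x y z assume "x \<in> carrier G" "y \<in> carrier G" "z \<in> carrier G"
  then show "x \<oplus>\<^bsub>G\<^esub> y \<oplus>\<^bsub>G\<^esub> z = x \<oplus>\<^bsub>G\<^esub> (y \<oplus>\<^bsub>G\<^esub> z)"
    by (auto simp: carrier_G G_ops tAdd cls_eq_iff dpterms.intros del: equalityI intro: dpeq.add_assoc)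
next
  fix x y assume "x \<in> carrier G" "y \<in> carrier G"
  then show "x \<oplus>\<^bsub>G\<^esub> y = y \<oplus>\<^bsub>G\<^esub> x"
    by (auto simp: carrier_G G_ops tAdd cls_eq_iff dpterms.intros del: equalityI intro: dpeq.add_comm)
qed (auto simp: carrier_G G_ops tZero tAdd cls_eq_iff dpterms.intros del: equalityI intro: dpeq.add_zero)

lemma module_G: "module F G"
  by (rule moduleI[OF A.is_cring abelian_group_G])
    (auto simp: carrier_G G_ops tAdd tScal cls_eq_iff dpterms.intros del: equalityI intro: dpeq.scal_add dpeq.add_scal dpeq.scal_scal
      dpeq.scal_one)

lemma algebra_G: "nonunital_comm_algebra F G"
  by (intro nonunital_comm_algebra.intro[OF module_G] nonunital_comm_algebra_axioms.intro)
    (auto simp: carrier_G G_ops tAdd tMul tScal cls_eq_iff dpterms.intros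
      del: equalityI intro: dpeq.mul_assoc dpeq.mul_comm dpeq.mul_add dpeq.mul_scal)

lemma TNat_smult:
  fixes n :: nat
  assumes "module F B" and x: "x \<in> carrier B"
  shows "([n] \<cdot>\<^bsub>F\<^esub> \<one>\<^bsub>F\<^esub>) \<odot>\<^bsub>B\<^esub> x = [n] \<cdot>\<^bsub>B\<^esub> x"
proof -
  interpret B: module F B by fact
  show ?thesis
    by (induction n) (use x in \<open>simp_all add: B.smult_l_distr \<close>)
qed

lemma G_TNat: "t \<in> D \<Longrightarrow> cls (TNat F n t) = [n] \<cdot>\<^bsub>G\<^esub> cls t"
  using TNat_smult[OF module_G, of "cls t" n] G_smult[OF nat_in_F, of t n]
  by (simp add: TNat_def carrier_G)

lemma G_TPow: "t \<in> D \<Longrightarrow> cls (TPow t n) = mpow G (cls t) n"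
proof -
  assume t: "t \<in> D"
  have "((\<lambda>s. TMul s t) ^^ k) t \<in> D \<and>
    cls (((\<lambda>s. TMul s t) ^^ k) t) = ((\<lambda>x. x \<otimes>\<^bsub>G\<^esub> cls t) ^^ k) (cls t)" for k
    by (induction k) (use t in \<open>auto intro: tMul simp: G_mult[symmetric]\<close>)
  then show ?thesis by (simp add: TPow_def mpow_def)
qed

lemma G_TSum:
  assumes "\<And>l. l \<in> {a..<b} \<Longrightarrow> u l \<in> D"
  shows "cls (TSum (map u [a..<b])) = (\<Oplus>\<^bsub>G\<^esub>l\<in>{a..<b}. cls (u l))"
proof -
  interpret G: abelian_group G by (rule abelian_group_G)
  have "cls (TSum (map u ls)) = (\<Oplus>\<^bsub>G\<^esub>l\<in>set ls. cls (u l))"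
    if "distinct ls" "set ls \<subseteq> {a..<b}" for ls
    using that
  proof (induction ls)
    case Nil
    then show ?case by (simp add: TSum_def G_zero)
  next
    case (Cons l ls)
    have "\<And>i. i \<in> insert l (set ls) \<Longrightarrow> u i \<in> D" using Cons.prems assms by auto
    moreover have "TSum (map u ls) \<in> D" using calculation by (auto intro!: TSum_in)
    moreover have "(\<lambda>l. cls (u l)) \<in> set ls \<rightarrow> carrier G"
      using Cons.prems assms by (auto simp: carrier_G)
    ultimately show ?case using Cons assms
      by (subst set_simps, subst G.finsum_insert) (auto simp: TSum_def G_add[symmetric] carrier_G)
  qed
  from this[of "[a..<b]"] show ?thesis by simp
qed

theorem Gamma_plus_divided_power_algebra: "divided_power_algebra F G"
proof (intro divided_power_algebra.intro A.field_axioms algebra_G divided_power_algebra_axioms.intro)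
  fix n and x y assume n: "1 \<le> (n::nat)" and "x \<in> carrier G" "y \<in> carrier G"
  then obtain s t where st: "s \<in> D" "t \<in> D" "x = cls s" "y = cls t" by (auto simp: carrier_G)
  have sum: "(\<Oplus>\<^bsub>G\<^esub>l\<in>{1..<n}. dpow G l x \<otimes>\<^bsub>G\<^esub> dpow G (n - l) y) =
      cls (TSum (map (\<lambda>l. TMul (TDpow l s) (TDpow (n - l) t)) [1..<n]))"
  proof (subst G_TSum)
    interpret G: abelian_group G by (rule abelian_group_G)
    show "(\<Oplus>\<^bsub>G\<^esub>l\<in>{1..<n}. dpow G l x \<otimes>\<^bsub>G\<^esub> dpow G (n - l) y) =
      (\<Oplus>\<^bsub>G\<^esub>l\<in>{1..<n}. cls (TMul (TDpow l s) (TDpow (n - l) t)))"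
      by (rule G.finsum_cong') (use st in \<open>auto simp: G_ops tDpow tMul carrier_G\<close>)
  qed (use st in \<open>auto simp: dpterms.intros\<close>)
  have in_D: "TSum (map (\<lambda>l. TMul (TDpow l s) (TDpow (n - l) t)) [1..<n]) \<in> D"
    using st by (auto intro!: TSum_in simp: dpterms.intros)
  show "dpow G n (x \<oplus>\<^bsub>G\<^esub> y) = dpow G n x \<oplus>\<^bsub>G\<^esub>
      (\<Oplus>\<^bsub>G\<^esub>l\<in>{1..<n}. dpow G l x \<otimes>\<^bsub>G\<^esub> dpow G (n - l) y) \<oplus>\<^bsub>G\<^esub> dpow G n y"
    using dpeq.dp_add[OF n st(1,2)] in_D st n
    by (simp add: sum[unfolded st(3,4)] G_ops tAdd tDpow cls_eqI del: One_nat_def)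
  show "dpow G n (x \<otimes>\<^bsub>G\<^esub> y) = [(fact n :: nat)] \<cdot>\<^bsub>G\<^esub> (dpow G n x \<otimes>\<^bsub>G\<^esub> dpow G n y)"
    using cls_eqI[OF dpeq.dp_mult[OF n st(1,2)]] st n
    by (simp add: G_ops tMul tDpow G_TNat)
  show "dpow G n (x \<otimes>\<^bsub>G\<^esub> y) = mpow G x n \<otimes>\<^bsub>G\<^esub> dpow G n y"
    using cls_eqI[OF dpeq.dp_mult_left[OF n st(1,2)]] st n
    by (simp add: G_ops tMul tDpow G_TPow[symmetric] TPow_in)
  show "dpow G n (x \<otimes>\<^bsub>G\<^esub> y) = dpow G n x \<otimes>\<^bsub>G\<^esub> mpow G y n"
    using cls_eqI[OF dpeq.dp_mult_right[OF n st(1,2)]] st n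
    by (simp add: G_ops tMul tDpow G_TPow[symmetric] TPow_in)
next
  fix m n :: nat and x assume mn: "1 \<le> m" "1 \<le> n" and "x \<in> carrier G"
  then obtain t where t: "t \<in> D" "x = cls t" by (auto simp: carrier_G)
  show "dpow G m x \<otimes>\<^bsub>G\<^esub> dpow G n x = [((m + n) choose m)] \<cdot>\<^bsub>G\<^esub> dpow G (m + n) x"
    using cls_eqI[OF dpeq.dp_times[OF mn t(1)]] t mn by (simp add: G_ops tDpow G_TNat)
  have "m * n \<ge> 1" using mn by simp
  then show "dpow G m (dpow G n x) =
      [(fact (m * n) div (fact m * fact n ^ m) :: nat)] \<cdot>\<^bsub>G\<^esub> dpow G (m * n) x"
    using cls_eqI[OF dpeq.dp_dpow[OF mn t(1)]] t mn by (simp add: G_ops tDpow G_TNat)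
next
  fix x assume "x \<in> carrier G"
  then obtain t where t: "t \<in> D" "x = cls t" by (auto simp: carrier_G)
  show "dpow G 1 x = x"
    using cls_eqI[OF dpeq.dp_one[OF t(1)]] G_dpow[of 1 t] t by simp
qed (auto simp: carrier_G G_ops tScal tDpow cls_eq_iff dpterms.intros del: equalityI intro: dpeq.dp_smult[unfolded One_nat_def])

theorem Gamma_plus_alg_hom: "Gamma_plus_alg F A M \<in> Gamma_hom F A G"
  unfolding Gamma_hom_def Gamma_plus_alg_def
  by (auto simp: cls_def[symmetric] carrier_G G_ops tAlg A.mult_closed A.dpow_closed cls_eq_iff dpterms.intros
      del: equalityI intro: dpeq.alg_add dpeq.alg_smult dpeq.alg_mult dpeq.alg_dpow[unfolded One_nat_def])

theorem Gamma_plus_gen_hom: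
  "Gamma_plus_gen F A M \<in> umodule_hom F A M (restrict_umodule G (Gamma_plus_alg F A M))"
  unfolding umodule_hom_def Gamma_plus_gen_def restrict_umodule_def Gamma_plus_alg_def
  by (auto simp: cls_def[symmetric] carrier_G G_ops tAlg tGen AM.act_closed cls_eq_iff dpterms.intros
      del: equalityI intro: dpeq.gen_add dpeq.gen_smult dpeq.gen_act)

end

primrec dp_eval ::
  "('f, 'b) dpalg \<Rightarrow> ('a \<Rightarrow> 'b) \<Rightarrow> ('m \<Rightarrow> 'b) \<Rightarrow> ('f, 'a, 'm) dpterm \<Rightarrow> 'b" where
  "dp_eval B f h (TAlg a) = f a"
| "dp_eval B f h (TGen x) = h x"
| "dp_eval B f h TZero = \<zero>\<^bsub>B\<^esub>"
| "dp_eval B f h (TAdd s t) = dp_eval B f h s \<oplus>\<^bsub>B\<^esub> dp_eval B f h t"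
| "dp_eval B f h (TScal k t) = k \<odot>\<^bsub>B\<^esub> dp_eval B f h t"
| "dp_eval B f h (TMul s t) = dp_eval B f h s \<otimes>\<^bsub>B\<^esub> dp_eval B f h t"
| "dp_eval B f h (TDpow n t) = dpow B n (dp_eval B f h t)"

lemma (in Gamma_plus_setup) Gamma_plus_universal:
  fixes B :: "('f, 'b) dpalg"
  assumes "divided_power_algebra F B"
    and f: "f \<in> Gamma_hom F A B"
    and h: "h \<in> umodule_hom F A M (restrict_umodule B f)"
  shows "\<exists>!\<phi>. \<phi> \<in> Gamma_hom F G B \<and>
    (\<forall>a\<in>carrier A. \<phi> (Gamma_plus_alg F A M a) = f a) \<and>
    (\<forall>x\<in>carrier M. \<phi> (Gamma_plus_gen F A M x) = h x)"
proof -
  interpret B: divided_power_algebra F B by fact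
  let ?e = "dp_eval B f h"
  note f' = f[unfolded Gamma_hom_def] and h' = h[unfolded umodule_hom_def restrict_umodule_def]
  have e_in: "?e t \<in> carrier B" if "t \<in> D" for t
    using that
    by induction (use f' h' in \<open>auto intro: B.mult_closed B.dpow_closed\<close>)
  have e_TNat: "?e (TNat F n t) = [n] \<cdot>\<^bsub>B\<^esub> ?e t" if "t \<in> D" for n t
    using TNat_smult[OF B.module_axioms e_in[OF that]] by (simp add: TNat_def)
  have e_TPow: "?e (TPow t n) = mpow B (?e t) n" for n t
  proof -
    have "?e (((\<lambda>s. TMul s t) ^^ k) t) = ((\<lambda>x. x \<otimes>\<^bsub>B\<^esub> ?e t) ^^ k) (?e t)" for k
      by (induction k) auto
    then show ?thesis by (simp add: TPow_def mpow_def)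
  qed
  have e_TSum: "?e (TSum (map u ls)) = (\<Oplus>\<^bsub>B\<^esub>l\<in>set ls. ?e (u l))"
    if "distinct ls" "\<forall>l\<in>set ls. u l \<in> D" for u and ls :: "nat list"
    using that by (induction ls) (auto simp: TSum_def e_in)
  have sound: "?e s = ?e t" if "dpeq F A M s t" for s t
    using that
  proof induction
    case (add_neg t)
    then show ?case using e_in by (simp add: B.smult_l_minus B.M.l_neg)
  next
    case (add_assoc s t u)
    then show ?case using e_in by (simp add: B.M.a_assoc)
  next
    case (add_comm s t)
    then show ?case using e_in by (simp add: B.M.a_comm)
  next
    case (dp_add n s t)
    have "?e (TSum (map (\<lambda>l. TMul (TDpow l s) (TDpow (n - l) t)) [1..<n])) =
      (\<Oplus>\<^bsub>B\<^esub>l\<in>{1..<n}. dpow B l (?e s) \<otimes>\<^bsub>B\<^esub> dpow B (n - l) (?e t))"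
      using dp_add by (subst e_TSum) (auto simp: dpterms.intros)
    then show ?case using dp_add B.dpow_add e_in by simp
  next
    case (dp_times m n t)
    then show ?case using e_in by (simp add: e_TNat tDpow B.dpow_times)
  next
    case (dp_mult n s t)
    then show ?case using e_in by (simp add: e_TNat tDpow tMul B.dpow_mult)
  next
    case (dp_dpow m n t)
    then have "m * n \<ge> 1" by simp
    with dp_dpow show ?case using e_in by (simp add: e_TNat tDpow B.dpow_dpow)
  next
    case (dp_mult_left n s t)
    then show ?case using e_in by (simp add: e_TPow B.dpow_mult_left)
  next
    case (dp_mult_right n s t)
    then show ?case using e_in by (simp add: e_TPow B.dpow_mult_right)
  next
    case (dp_one t)
    then show ?case using e_in B.dpow_one by simp
  next
    case (dp_smult n k t)
    then show ?case using e_in by (simp add: B.dpow_smult)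
  next
    case (mul_comm s t)
    then show ?case using e_in by (simp add: B.mult_comm)
  next
    case (mul_assoc s t u)
    then show ?case using e_in by (simp add: B.mult_assoc)
  next
    case (mul_add s t u)
    then show ?case using e_in by (simp add: B.mult_add)
  next
    case (mul_scal k s t)
    then show ?case using e_in by (simp add: B.mult_smult)
  next
    case (scal_add k s t)
    then show ?case using e_in by (simp add: B.smult_r_distr)
  next
    case (add_scal k l t)
    then show ?case using e_in by (simp add: B.smult_l_distr)
  next
    case (scal_scal k l t)
    then show ?case using e_in by (simp add: B.smult_assoc1)
  qed (use f' h' e_in in simp_all)
  define \<phi> where "\<phi> = (\<lambda>X\<in>carrier G. ?e (SOME t. t \<in> X))"
  have \<phi>_cls: "\<phi> (cls t) = ?e t" if t: "t \<in> D" for t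
  proof -
    have "t \<in> cls t" using t by (auto simp: cls_def dprel_def intro: dpeq.refl)
    then have "(SOME s. s \<in> cls t) \<in> cls t" by (rule someI)
    then have "dpeq F A M t (SOME s. s \<in> cls t)" by (simp add: cls_def dprel_def)
    with sound t show ?thesis by (simp add: \<phi>_def carrier_G)
  qed
  have "\<phi> \<in> extensional (carrier G)" by (simp add: \<phi>_def)
  then have \<phi>_hom: "\<phi> \<in> Gamma_hom F G B"
    unfolding Gamma_hom_def PiE_def
    by (auto simp: carrier_G G_ops \<phi>_cls e_in tAdd tMul tScal tDpow)
  show ?thesis
  proof (rule ex1I)
    show "\<phi> \<in> Gamma_hom F G B \<and> (\<forall>a\<in>carrier A. \<phi> (Gamma_plus_alg F A M a) = f a) \<and>
      (\<forall>x\<in>carrier M. \<phi> (Gamma_plus_gen F A M x) = h x)"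
      using \<phi>_hom by (simp add: Gamma_plus_alg_def Gamma_plus_gen_def cls_def[symmetric] \<phi>_cls tAlg tGen)
  next
    fix \<psi> assume \<psi>: "\<psi> \<in> Gamma_hom F G B \<and>
      (\<forall>a\<in>carrier A. \<psi> (Gamma_plus_alg F A M a) = f a) \<and>
      (\<forall>x\<in>carrier M. \<psi> (Gamma_plus_gen F A M x) = h x)"
    then have \<psi>_hom: "\<psi> \<in> Gamma_hom F G B" by blast
    interpret G: abelian_group G by (rule abelian_group_G)
    have \<psi>_add: "\<psi> (x \<oplus>\<^bsub>G\<^esub> y) = \<psi> x \<oplus>\<^bsub>B\<^esub> \<psi> y" if "x \<in> carrier G" "y \<in> carrier G" for x y
      using \<psi>_hom that by (simp add: Gamma_hom_def)
    have \<psi>_in: "\<psi> x \<in> carrier B" if "x \<in> carrier G" for x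
      using \<psi>_hom that by (auto simp: Gamma_hom_def)
    have \<psi>_zero: "\<psi> \<zero>\<^bsub>G\<^esub> = \<zero>\<^bsub>B\<^esub>"
      using \<psi>_add[of "\<zero>\<^bsub>G\<^esub>" "\<zero>\<^bsub>G\<^esub>"] \<psi>_in[of "\<zero>\<^bsub>G\<^esub>"] by (simp add: B.M.add.l_cancel_one)
    have "\<psi> (cls t) = ?e t" if "t \<in> D" for t
      using that
    proof induction
      case (tAlg a)
      then show ?case using \<psi> by (simp add: Gamma_plus_alg_def cls_def)
    next
      case (tGen x)
      then show ?case using \<psi> by (simp add: Gamma_plus_gen_def cls_def)
    next
      case tZero
      then show ?case using \<psi>_zero by (simp add: G_zero)
    next
      case (tAdd s t)
      then show ?case using \<psi>_add[of "cls s" "cls t"] by (simp add: G_add carrier_G)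
    next
      case (tScal k t)
      then show ?case using \<psi>_hom by (simp add: Gamma_hom_def G_smult[symmetric] carrier_G)
    next
      case (tMul s t)
      then show ?case using \<psi>_hom by (simp add: Gamma_hom_def G_mult[symmetric] carrier_G)
    next
      case (tDpow n t)
      then show ?case using \<psi>_hom by (simp add: Gamma_hom_def G_dpow[symmetric] carrier_G)
    qed
    then show "\<psi> = \<phi>"
      using \<psi>_hom \<phi>_hom
      by (intro extensionalityI[of _ "carrier G"]) (auto simp: Gamma_hom_def PiE_def carrier_G \<phi>_cls)
  qed
qed

end

theory Submission
  imports Defs "HOL-Number_Theory.Residues"
begin

text \<open>Write \<open>a[n]\<close> for the \<open>n\<close>-th divided power of \<open>a\<close>. The operations \<open>(a, b) \<mapsto> (a[n], a[n-1] b)\<close>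
  are divided powers on T(B) in every characteristic. The \<open>p\<close>-th of them is the prescribed one because
  \<open>(p - 1)! = -1\<close> modulo \<open>p\<close> by Wilson's theorem, and the \<open>p\<close>-th one determines all others:
  \<open>x[n-1] x = n x[n]\<close> gives \<open>x[n]\<close> if \<open>p\<close> does not divide \<open>n\<close>, and \<open>x[p][m]\<close> is a multiple
  of \<open>x[mp]\<close> by a product of binomial coefficients prime to \<open>p\<close>. Hence a morphism from \<open>A\<close> to T(B) is
  a morphism \<open>f\<close> from \<open>A\<close> to \<open>B\<close> together with a derivation \<open>\<delta>\<close> along \<open>f\<close> with
  \<open>\<delta>(a[n]) = f(a)[n-1] \<delta>(a)\<close>, and the universal properties of the module of differentials and of
  the divided power algebra generated by it identify such pairs with the morphisms from
  \<open>T\<^sup>\<circ> A\<close> to \<open>B\<close>.\<close>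

text \<open>The operations on T(B) come from expanding the \<open>n\<close>-th divided power of
  \<open>a + e b\<close> with \<open>e^2 = 0\<close>, where all divided powers of \<open>e b\<close>
  beyond the first are set to zero. Since \<open>T_dpow\<close> is a definite description,
  prescribing the \<open>p\<close>-th power is not enough: a complete family has to be exhibited and
  every competitor compared with it. After that identification the characteristic disappears from
  the argument, and the adjunction is proved for the explicit family. The missing unit is the
  recurring obstacle. The exponent \<open>n - 1\<close> reaches 0 at \<open>n = 1\<close>, so zeroth
  powers are realised as operators on elements rather than as elements; and a module over an algebra
  without unit is generated by scalar multiples together with the action, which doubles the
  coefficients of the free module. The coefficient of an iterated power enters twice through the
  same product formula: once for its divisibility, and once because its last factor is the binomial
  coefficient that the second coordinate of an iterated power in T(B) requires.\<close>

section \<open>The coefficients of iterated divided powers\<close>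

text \<open>Count the partitions of \<open>m * Suc n\<close> points into \<open>m\<close> blocks of
  size \<open>Suc n\<close>: the block of the largest point takes \<open>n\<close> companions among
  the others, and the remaining points are partitioned in turn. So the division in the axiom for
  iterated powers is exact, with one new binomial factor for each step in \<open>m\<close>.\<close>

lemma fact_mult_Suc_eq_prod:
  "fact (m * Suc n) = (\<Prod>i<m. (i * Suc n + n) choose n) * (fact m * fact (Suc n) ^ m)"
    (is "_ = _ * ?r m")
proof (induction m)
  case (Suc m)
  have "fact (Suc m * Suc n) = (Suc (m * Suc n + n) :: nat) * fact (m * Suc n + n)"
    using fact_Suc[of "m * Suc n + n", where 'a = nat] by (simp add: ac_simps)
  also have "fact (m * Suc n + n) = fact n * fact (m * Suc n) * ((m * Suc n + n) choose n)"
    using binomial_fact_lemma[of n "m * Suc n + n"] by simp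
  also have "Suc (m * Suc n + n) = Suc m * Suc n" by simp
  finally have "fact (Suc m * Suc n) =
    Suc m * Suc n * (fact n * fact (m * Suc n) * ((m * Suc n + n) choose n))" .
  also have "\<dots> = (\<Prod>i<Suc m. (i * Suc n + n) choose n) * ?r (Suc m)"
    unfolding Suc.IH by (simp add: algebra_simps del: mult_Suc mult_Suc_right)
  finally show ?case .
qed simp

lemma fact_div_eq_prod:
  "fact (m * Suc n) div (fact m * fact (Suc n) ^ m) = (\<Prod>i<m. (i * Suc n + n) choose n)"
  unfolding fact_mult_Suc_eq_prod by simp

text \<open>Induction along \<open>(j+1) C(ip+j+1, j+1) = (ip+j+1) C(ip+j, j)\<close>, where
  \<open>ip+j+1\<close> is prime to \<open>p\<close> as long as \<open>j+1 < p\<close>.\<close>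

lemma prime_not_dvd_binomial:
  fixes p :: nat
  assumes "prime p" "j < p"
  shows "\<not> p dvd ((i * p + j) choose j)"
  using \<open>j < p\<close>
proof (induction j)
  case 0
  then show ?case using assms(1) by (simp add: prime_nat_iff)
next
  case (Suc j)
  have "\<not> p dvd Suc (i * p + j)"
    using Suc.prems by (metis add_Suc_right dvd_add_right_iff dvd_triv_right nat_dvd_not_less zero_less_Suc)
  with Suc have "\<not> p dvd Suc (i * p + j) * ((i * p + j) choose j)"
    using assms(1) by (simp add: prime_dvd_mult_iff del: mult_Suc)
  then have "\<not> p dvd Suc j * ((i * p + Suc j) choose Suc j)"
    using Suc_times_binomial[of j "i * p + j"] by (metis add_Suc_right)
  then show ?case by (metis dvd_mult)
qed

text \<open>For blocks of size \<open>p\<close> the factors of the product formula are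
  \<open>C(ip+p-1, p-1)\<close>, the extreme case \<open>j = p-1\<close> of the preceding
  lemma.\<close>

lemma prime_not_dvd_fact_div:
  fixes p :: nat
  assumes "prime p"
  shows "\<not> p dvd fact (m * p) div (fact m * fact p ^ m)"
proof -
  obtain n where "p = Suc n" using prime_gt_0_nat[OF assms] gr0_implies_Suc by blast
  then show ?thesis
    using prime_not_dvd_binomial[OF assms, of n] assms
    by (simp add: fact_div_eq_prod prime_dvd_prod_iff del: mult_Suc_right fact_Suc)
qed

section \<open>Algebras without unit\<close>

context nonunital_comm_algebra
begin

lemma mult_left_comm:
  "\<lbrakk>a \<in> carrier A; b \<in> carrier A; c \<in> carrier A\<rbrakk> \<Longrightarrow>
    a \<otimes>\<^bsub>A\<^esub> (b \<otimes>\<^bsub>A\<^esub> c) = b \<otimes>\<^bsub>A\<^esub> (a \<otimes>\<^bsub>A\<^esub> c)"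
  by (metis mult_assoc mult_comm)

lemma add_mult:
  "\<lbrakk>a \<in> carrier A; b \<in> carrier A; c \<in> carrier A\<rbrakk> \<Longrightarrow>
    (a \<oplus>\<^bsub>A\<^esub> b) \<otimes>\<^bsub>A\<^esub> c = a \<otimes>\<^bsub>A\<^esub> c \<oplus>\<^bsub>A\<^esub> b \<otimes>\<^bsub>A\<^esub> c"
  by (metis mult_add mult_comm M.a_closed)

lemma smult_mult:
  "\<lbrakk>k \<in> carrier R; a \<in> carrier A; b \<in> carrier A\<rbrakk> \<Longrightarrow>
    (k \<odot>\<^bsub>A\<^esub> a) \<otimes>\<^bsub>A\<^esub> b = k \<odot>\<^bsub>A\<^esub> (a \<otimes>\<^bsub>A\<^esub> b)"
  by (metis mult_smult mult_comm smult_closed)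

lemma mult_zero [simp]: "a \<in> carrier A \<Longrightarrow> a \<otimes>\<^bsub>A\<^esub> \<zero>\<^bsub>A\<^esub> = \<zero>\<^bsub>A\<^esub>"
  by (metis mult_smult smult_l_null M.zero_closed R.zero_closed mult_closed)

lemma zero_mult [simp]: "a \<in> carrier A \<Longrightarrow> \<zero>\<^bsub>A\<^esub> \<otimes>\<^bsub>A\<^esub> a = \<zero>\<^bsub>A\<^esub>"
  by (metis mult_zero mult_comm M.zero_closed)

lemma mult_finsum:
  "\<lbrakk>finite S; a \<in> carrier A; f \<in> S \<rightarrow> carrier A\<rbrakk> \<Longrightarrow>
    a \<otimes>\<^bsub>A\<^esub> (\<Oplus>\<^bsub>A\<^esub>i\<in>S. f i) = (\<Oplus>\<^bsub>A\<^esub>i\<in>S. a \<otimes>\<^bsub>A\<^esub> f i)"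
proof (induction set: finite)
  case (insert x S)
  then show ?case by (simp add: Pi_def mult_add mult_closed)
qed simp

lemma mult_add_pow:
  fixes n :: nat
  shows "\<lbrakk>a \<in> carrier A; b \<in> carrier A\<rbrakk> \<Longrightarrow> a \<otimes>\<^bsub>A\<^esub> ([n] \<cdot>\<^bsub>A\<^esub> b) = [n] \<cdot>\<^bsub>A\<^esub> (a \<otimes>\<^bsub>A\<^esub> b)"
  by (induction n) (simp_all add: mult_add)

lemma add_pow_mult:
  fixes n :: nat
  shows "\<lbrakk>a \<in> carrier A; b \<in> carrier A\<rbrakk> \<Longrightarrow> ([n] \<cdot>\<^bsub>A\<^esub> a) \<otimes>\<^bsub>A\<^esub> b = [n] \<cdot>\<^bsub>A\<^esub> (a \<otimes>\<^bsub>A\<^esub> b)"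
  by (induction n) (simp_all add: add_mult)

lemma mpow_Suc_Suc: "mpow A a (Suc (Suc n)) = mpow A a (Suc n) \<otimes>\<^bsub>A\<^esub> a"
  by (simp add: mpow_def)

end

lemma (in module) add_pow_smult_one:
  fixes n :: nat
  assumes "x \<in> carrier M"
  shows "([n] \<cdot>\<^bsub>R\<^esub> \<one>) \<odot>\<^bsub>M\<^esub> x = [n] \<cdot>\<^bsub>M\<^esub> x"
  by (induction n) (simp_all add: assms smult_l_distr)

text \<open>Multiplying by \<open>a = a[1]\<close> turns \<open>a[n]\<close> into
  \<open>(n+1) a[n+1]\<close>, which accumulates the factorial. The operations are a separate
  function \<open>\<gamma>\<close> subject to three axioms only, so that the result can serve in
  \<open>divided_power_algebraI\<close> before the other axioms are established.\<close>

lemma (in nonunital_comm_algebra) mpow_eq_fact_dpow: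
  fixes \<gamma> :: "nat \<Rightarrow> 'c \<Rightarrow> 'c"
  assumes closed: "\<And>n a. \<lbrakk>n \<ge> 1; a \<in> carrier A\<rbrakk> \<Longrightarrow> \<gamma> n a \<in> carrier A"
    and one: "\<And>a. a \<in> carrier A \<Longrightarrow> \<gamma> 1 a = a"
    and times: "\<And>m n a. \<lbrakk>m \<ge> 1; n \<ge> 1; a \<in> carrier A\<rbrakk> \<Longrightarrow>
      \<gamma> m a \<otimes>\<^bsub>A\<^esub> \<gamma> n a = [((m + n) choose m)] \<cdot>\<^bsub>A\<^esub> \<gamma> (m + n) a"
    and a: "a \<in> carrier A"
  shows "mpow A a (Suc n) = [(fact (Suc n) :: nat)] \<cdot>\<^bsub>A\<^esub> \<gamma> (Suc n) a"
proof (induction n)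
  case 0
  then show ?case using one[OF a] a by (simp add: mpow_def)
next
  case (Suc n)
  have "\<gamma> (Suc n) a \<otimes>\<^bsub>A\<^esub> a = \<gamma> (Suc n) a \<otimes>\<^bsub>A\<^esub> \<gamma> 1 a" using one[OF a] by simp
  also have "\<dots> = [Suc (Suc n)] \<cdot>\<^bsub>A\<^esub> \<gamma> (Suc (Suc n)) a"
    by (subst times) (auto simp: a)
  finally have step: "\<gamma> (Suc n) a \<otimes>\<^bsub>A\<^esub> a = [Suc (Suc n)] \<cdot>\<^bsub>A\<^esub> \<gamma> (Suc (Suc n)) a" .
  have "mpow A a (Suc (Suc n)) = [(fact (Suc n) :: nat)] \<cdot>\<^bsub>A\<^esub> ([Suc (Suc n)] \<cdot>\<^bsub>A\<^esub> \<gamma> (Suc (Suc n)) a)"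
    using Suc closed[of "Suc n" a] a by (simp add: mpow_Suc_Suc add_pow_mult step del: fact_Suc M.add.nat_pow_Suc)
  also have "\<dots> = [(fact (Suc (Suc n)) :: nat)] \<cdot>\<^bsub>A\<^esub> \<gamma> (Suc (Suc n)) a"
    using closed[of "Suc (Suc n)" a] a
    by (subst M.add.nat_pow_pow) (simp_all add: mult.commute del: M.add.nat_pow_Suc)
  finally show ?case .
qed

text \<open>Since \<open>mpow A a n\<close> is \<open>n!\<close> times the \<open>n\<close>-th divided power, two of the three product axioms
  are redundant.\<close>

lemma divided_power_algebraI:
  fixes A :: "('f, 'a) dpalg" and F :: "('f, 'r) ring_scheme"
  assumes "field F" "nonunital_comm_algebra F A"
    and closed: "\<And>n a. \<lbrakk>n \<ge> 1; a \<in> carrier A\<rbrakk> \<Longrightarrow> dpow A n a \<in> carrier A"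
    and "\<And>n k a. \<lbrakk>n \<ge> 1; k \<in> carrier F; a \<in> carrier A\<rbrakk> \<Longrightarrow>
      dpow A n (k \<odot>\<^bsub>A\<^esub> a) = (k [^]\<^bsub>F\<^esub> n) \<odot>\<^bsub>A\<^esub> dpow A n a"
    and times: "\<And>m n a. \<lbrakk>m \<ge> 1; n \<ge> 1; a \<in> carrier A\<rbrakk> \<Longrightarrow>
      dpow A m a \<otimes>\<^bsub>A\<^esub> dpow A n a = [((m + n) choose m)] \<cdot>\<^bsub>A\<^esub> dpow A (m + n) a"
    and "\<And>n a b. \<lbrakk>n \<ge> 1; a \<in> carrier A; b \<in> carrier A\<rbrakk> \<Longrightarrow>
      dpow A n (a \<oplus>\<^bsub>A\<^esub> b) =
        dpow A n a \<oplus>\<^bsub>A\<^esub> (\<Oplus>\<^bsub>A\<^esub>l\<in>{1..<n}. dpow A l a \<otimes>\<^bsub>A\<^esub> dpow A (n - l) b) \<oplus>\<^bsub>A\<^esub> dpow A n b"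
    and one: "\<And>a. a \<in> carrier A \<Longrightarrow> dpow A 1 a = a"
    and mult: "\<And>n a b. \<lbrakk>n \<ge> 1; a \<in> carrier A; b \<in> carrier A\<rbrakk> \<Longrightarrow>
      dpow A n (a \<otimes>\<^bsub>A\<^esub> b) = [(fact n :: nat)] \<cdot>\<^bsub>A\<^esub> (dpow A n a \<otimes>\<^bsub>A\<^esub> dpow A n b)"
    and "\<And>m n a. \<lbrakk>m \<ge> 1; n \<ge> 1; a \<in> carrier A\<rbrakk> \<Longrightarrow>
      dpow A m (dpow A n a) =
        [(fact (m * n) div (fact m * fact n ^ m) :: nat)] \<cdot>\<^bsub>A\<^esub> dpow A (m * n) a"
  shows "divided_power_algebra F A"
proof -
  interpret nonunital_comm_algebra F A by fact
  have mpow: "mpow A a n = [(fact n :: nat)] \<cdot>\<^bsub>A\<^esub> dpow A n a" if "n \<ge> 1" "a \<in> carrier A" for n a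
    using mpow_eq_fact_dpow[of "dpow A", OF closed one times that(2), of "n - 1"] that(1) by simp
  show ?thesis
  proof (intro divided_power_algebra.intro divided_power_algebra_axioms.intro)
    fix n :: nat and a b assume *: "n \<ge> 1" "a \<in> carrier A" "b \<in> carrier A"
    show "dpow A n (a \<otimes>\<^bsub>A\<^esub> b) = mpow A a n \<otimes>\<^bsub>A\<^esub> dpow A n b"
      using * closed by (simp add: mult mpow add_pow_mult)
    show "dpow A n (a \<otimes>\<^bsub>A\<^esub> b) = dpow A n a \<otimes>\<^bsub>A\<^esub> mpow A b n"
      using * closed by (simp add: mult mpow mult_add_pow)
  qed fact+
qed

section \<open>Divided powers acting on elements\<close>

text \<open>The zeroth divided power acts as the unit that the algebra lacks.\<close>

definition dact :: "('f, 'a, 'x) dpalg_scheme \<Rightarrow> nat \<Rightarrow> 'a \<Rightarrow> 'a \<Rightarrow> 'a" where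
  "dact A n a b = (if n = 0 then b else dpow A n a \<otimes>\<^bsub>A\<^esub> b)"

context divided_power_algebra
begin

lemma dact_0 [simp]: "dact A 0 a b = b"
  by (simp add: dact_def)

lemma dact_pos: "n \<ge> 1 \<Longrightarrow> dact A n a b = dpow A n a \<otimes>\<^bsub>A\<^esub> b"
  by (simp add: dact_def)

lemma dact_closed [simp, intro]:
  "\<lbrakk>a \<in> carrier A; b \<in> carrier A\<rbrakk> \<Longrightarrow> dact A n a b \<in> carrier A"
  by (simp add: dact_def mult_closed dpow_closed)

lemma dact_add_right:
  "\<lbrakk>a \<in> carrier A; b \<in> carrier A; c \<in> carrier A\<rbrakk> \<Longrightarrow>
    dact A n a (b \<oplus>\<^bsub>A\<^esub> c) = dact A n a b \<oplus>\<^bsub>A\<^esub> dact A n a c"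
  by (simp add: dact_def mult_add dpow_closed)

lemma dact_smult_right:
  "\<lbrakk>k \<in> carrier F; a \<in> carrier A; b \<in> carrier A\<rbrakk> \<Longrightarrow>
    dact A n a (k \<odot>\<^bsub>A\<^esub> b) = k \<odot>\<^bsub>A\<^esub> dact A n a b"
  by (simp add: dact_def mult_smult dpow_closed)

lemma mult_dact:
  "\<lbrakk>a \<in> carrier A; b \<in> carrier A; c \<in> carrier A\<rbrakk> \<Longrightarrow>
    c \<otimes>\<^bsub>A\<^esub> dact A n a b = dact A n a (c \<otimes>\<^bsub>A\<^esub> b)"
  by (simp add: dact_def mult_left_comm dpow_closed)

text \<open>The product rule extends down to exponent 0, where the binomial coefficient is 1; this
  spares the later computations in T(A) their boundary cases.\<close>

lemma dact_dact:
  assumes "a \<in> carrier A" "b \<in> carrier A"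
  shows "dact A m a (dact A n a b) = [((m + n) choose m)] \<cdot>\<^bsub>A\<^esub> dact A (m + n) a b"
proof (cases "m = 0 \<or> n = 0")
  case False
  then have "dact A m a (dact A n a b) = (dpow A m a \<otimes>\<^bsub>A\<^esub> dpow A n a) \<otimes>\<^bsub>A\<^esub> b"
    using assms by (simp add: dact_pos mult_assoc dpow_closed)
  also have "\<dots> = [((m + n) choose m)] \<cdot>\<^bsub>A\<^esub> dact A (m + n) a b"
    using False assms by (simp add: dpow_times dact_pos add_pow_mult dpow_closed)
  finally show ?thesis .
qed (use assms in auto)

lemma dact_smult:
  "\<lbrakk>k \<in> carrier F; a \<in> carrier A; b \<in> carrier A\<rbrakk> \<Longrightarrow>
    dact A n (k \<odot>\<^bsub>A\<^esub> a) b = (k [^]\<^bsub>F\<^esub> n) \<odot>\<^bsub>A\<^esub> dact A n a b"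
  by (simp add: dact_def smult_mult dpow_smult dpow_closed)

lemma dact_self: "a \<in> carrier A \<Longrightarrow> dact A n a a = [Suc n] \<cdot>\<^bsub>A\<^esub> dpow A (Suc n) a"
  using dpow_times[of n 1 a] dpow_one[of a]
  by (cases "n = 0") (simp_all add: dact_def)

text \<open>Once zeroth powers act as the identity, the two outer summands of the addition axiom are
  the terms \<open>l = n\<close> and \<open>l = 0\<close> of one uniform sum.\<close>

lemma dact_add:
  assumes "a \<in> carrier A" "b \<in> carrier A" "c \<in> carrier A"
  shows "dact A n (a \<oplus>\<^bsub>A\<^esub> b) c = (\<Oplus>\<^bsub>A\<^esub>l\<in>{0..n}. dact A l a (dact A (n - l) b c))"
proof (cases "n = 0")
  case False
  have [simp]: "dpow A k a \<in> carrier A" "dpow A k b \<in> carrier A" if "k \<ge> 1" for k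
    using that assms by (auto intro: dpow_closed)
  have split: "{0..n} = insert 0 (insert n {1..<n})" using False by auto
  let ?t = "\<lambda>l. dact A l a (dact A (n - l) b c)"
  let ?S = "\<Oplus>\<^bsub>A\<^esub>l\<in>{1..<n}. dpow A l a \<otimes>\<^bsub>A\<^esub> dpow A (n - l) b"
  have S: "?S \<in> carrier A"
    using assms by (intro M.finsum_closed) (auto simp: mult_closed)
  have "dact A n (a \<oplus>\<^bsub>A\<^esub> b) c = (dpow A n a \<oplus>\<^bsub>A\<^esub> ?S \<oplus>\<^bsub>A\<^esub> dpow A n b) \<otimes>\<^bsub>A\<^esub> c"
    using False assms by (simp add: dact_pos dpow_add)
  also have "\<dots> = dpow A n a \<otimes>\<^bsub>A\<^esub> c \<oplus>\<^bsub>A\<^esub> ?S \<otimes>\<^bsub>A\<^esub> c \<oplus>\<^bsub>A\<^esub> dpow A n b \<otimes>\<^bsub>A\<^esub> c"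
    using False assms S by (simp add: add_mult)
  also have "?S \<otimes>\<^bsub>A\<^esub> c = (\<Oplus>\<^bsub>A\<^esub>l\<in>{1..<n}. c \<otimes>\<^bsub>A\<^esub> (dpow A l a \<otimes>\<^bsub>A\<^esub> dpow A (n - l) b))"
    unfolding mult_comm[OF S assms(3)]
    by (rule mult_finsum) (use assms in \<open>auto intro!: mult_closed\<close>)
  also have "\<dots> = finsum A ?t {1..<n}"
    using assms by (intro M.finsum_cong') (auto simp: dact_def mult_closed mult_left_comm mult_comm)
  finally have *: "dact A n (a \<oplus>\<^bsub>A\<^esub> b) c = dpow A n a \<otimes>\<^bsub>A\<^esub> c \<oplus>\<^bsub>A\<^esub> finsum A ?t {1..<n} \<oplus>\<^bsub>A\<^esub>
    dpow A n b \<otimes>\<^bsub>A\<^esub> c" .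
  have t: "?t \<in> S \<rightarrow> carrier A" for S using assms by auto
  have "finsum A ?t {0..n} = ?t 0 \<oplus>\<^bsub>A\<^esub> (?t n \<oplus>\<^bsub>A\<^esub> finsum A ?t {1..<n})"
    unfolding split using False assms t by (simp add: M.finsum_insert del: One_nat_def)
  then show ?thesis
    unfolding * using False assms M.finsum_closed[OF t, of "{1..<n}"]
    by (simp add: dact_pos M.a_ac mult_closed del: One_nat_def)
qed (use assms in simp)

text \<open>One of the two summands in the second coordinate of a divided power of a product in
  T(A): the \<open>n!\<close> of the product axiom meets \<open>a[n] a = (n+1) a[n+1]\<close>. The
  other summand arises by exchanging the factors.\<close>

lemma dact_mult:
  assumes "a \<in> carrier A" "b \<in> carrier A" "c \<in> carrier A"
  shows "dact A n (a \<otimes>\<^bsub>A\<^esub> b) (a \<otimes>\<^bsub>A\<^esub> c) =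
    [(fact (Suc n) :: nat)] \<cdot>\<^bsub>A\<^esub> (dpow A (Suc n) a \<otimes>\<^bsub>A\<^esub> dact A n b c)"
proof (cases "n = 0")
  case True
  then show ?thesis using assms dpow_one[of a] by (simp add: mult_closed)
next
  case False
  have [simp]: "dpow A k a \<in> carrier A" "dpow A k b \<in> carrier A" if "k \<ge> 1" for k
    using that assms by (auto intro: dpow_closed)
  have "dact A n (a \<otimes>\<^bsub>A\<^esub> b) (a \<otimes>\<^bsub>A\<^esub> c) =
      [(fact n :: nat)] \<cdot>\<^bsub>A\<^esub> ((dpow A n a \<otimes>\<^bsub>A\<^esub> dpow A n b) \<otimes>\<^bsub>A\<^esub> (a \<otimes>\<^bsub>A\<^esub> c))"
    using False assms by (simp add: dact_pos dpow_mult add_pow_mult mult_closed)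
  also have "(dpow A n a \<otimes>\<^bsub>A\<^esub> dpow A n b) \<otimes>\<^bsub>A\<^esub> (a \<otimes>\<^bsub>A\<^esub> c) = dact A n a a \<otimes>\<^bsub>A\<^esub> dact A n b c"
    using False assms by (simp add: dact_pos mult_closed mult_assoc mult_left_comm)
  also have "\<dots> = [Suc n] \<cdot>\<^bsub>A\<^esub> (dpow A (Suc n) a \<otimes>\<^bsub>A\<^esub> dact A n b c)"
    using False assms by (simp add: dact_self add_pow_mult del: M.add.nat_pow_Suc)
  also have "[(fact n :: nat)] \<cdot>\<^bsub>A\<^esub> ([Suc n] \<cdot>\<^bsub>A\<^esub> (dpow A (Suc n) a \<otimes>\<^bsub>A\<^esub> dact A n b c)) =
      [(fact (Suc n) :: nat)] \<cdot>\<^bsub>A\<^esub> (dpow A (Suc n) a \<otimes>\<^bsub>A\<^esub> dact A n b c)"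
    using assms by (subst M.add.nat_pow_pow) (simp_all add: mult_closed mult.commute del: M.add.nat_pow_Suc)
  finally show ?thesis .
qed

text \<open>The second coordinate of an iterated power in T(A). Raising \<open>m\<close> by one in
  the product formula contributes exactly the binomial coefficient of \<open>a[m(n+1)] a[n]\<close>,
  and \<open>m(n+1)+n\<close> is one less than \<open>(m+1)(n+1)\<close>.\<close>

lemma dact_dpow:
  assumes a: "a \<in> carrier A" "b \<in> carrier A"
  shows "dact A m (dpow A (Suc n) a) (dact A n a b) =
    [(fact (Suc m * Suc n) div (fact (Suc m) * fact (Suc n) ^ Suc m) :: nat)] \<cdot>\<^bsub>A\<^esub>
      dact A (m * Suc n + n) a b"
proof (cases "m = 0")
  case True
  then show ?thesis using assms by simp
next
  case False
  have [simp]: "dpow A k a \<in> carrier A" if "k \<ge> 1" for k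
    using that assms by (auto intro: dpow_closed)
  let ?c = "fact (m * Suc n) div (fact m * fact (Suc n) ^ m) :: nat"
  have "m * Suc n \<ge> 1" using False by simp
  then have "dact A m (dpow A (Suc n) a) (dact A n a b) =
      [?c] \<cdot>\<^bsub>A\<^esub> dact A (m * Suc n) a (dact A n a b)"
    using False assms dpow_dpow[of m "Suc n" a]
    by (simp add: dact_pos add_pow_mult del: mult_Suc_right M.add.nat_pow_Suc)
  also have "\<dots> = [(?c * ((m * Suc n + n) choose n))] \<cdot>\<^bsub>A\<^esub> dact A (m * Suc n + n) a b"
    using assms binomial_symmetric[of n "m * Suc n + n"]
    by (simp add: dact_dact M.add.nat_pow_pow mult.commute
      del: mult_Suc_right M.add.nat_pow_Suc)
  also have "?c * ((m * Suc n + n) choose n) =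
      fact (Suc m * Suc n) div (fact (Suc m) * fact (Suc n) ^ Suc m)"
    unfolding fact_div_eq_prod by simp
  finally show ?thesis .
qed

end

section \<open>Positive characteristic\<close>

lemma (in "domain") ring_char_dvd_iff:
  "[(n::nat)] \<cdot>\<^bsub>R\<^esub> \<one>\<^bsub>R\<^esub> = \<zero>\<^bsub>R\<^esub> \<longleftrightarrow> ring_char R dvd n"
  unfolding ring_char_def by (rule add.pow_eq_id) simp

lemma (in "domain") prime_ring_char:
  assumes "ring_char R > 0"
  shows "prime (ring_char R)"
  unfolding prime_def
proof (intro conjI prime_elemI)
  have "\<one>\<^bsub>R\<^esub> = [(1::nat)] \<cdot>\<^bsub>R\<^esub> \<one>\<^bsub>R\<^esub>" by simp
  then have "\<not> ring_char R dvd 1"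
    unfolding ring_char_dvd_iff[symmetric] using one_not_zero by metis
  then show "\<not> is_unit (ring_char R)" .
next
  fix m n :: nat
  have "[(m * n)] \<cdot>\<^bsub>R\<^esub> \<one>\<^bsub>R\<^esub> = [m] \<cdot>\<^bsub>R\<^esub> \<one>\<^bsub>R\<^esub> \<otimes>\<^bsub>R\<^esub> [n] \<cdot>\<^bsub>R\<^esub> \<one>\<^bsub>R\<^esub>"
    by (simp add: add_pow_ldistr add.nat_pow_pow mult.commute)
  moreover assume "ring_char R dvd m * n"
  ultimately show "ring_char R dvd m \<or> ring_char R dvd n"
    unfolding ring_char_dvd_iff[symmetric] using integral by simp
qed (use assms in auto)

text \<open>An integer not divisible by the characteristic becomes a unit of the field, and its
  inverse cancels it.\<close>

lemma add_pow_cancel: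
  fixes n :: nat
  assumes "field F" "module F M" and n: "\<not> ring_char F dvd n"
    and xy: "x \<in> carrier M" "y \<in> carrier M" and eq: "[n] \<cdot>\<^bsub>M\<^esub> x = [n] \<cdot>\<^bsub>M\<^esub> y"
  shows "x = y"
proof -
  interpret F: field F by fact
  interpret M: module F M by fact
  let ?c = "[n] \<cdot>\<^bsub>F\<^esub> \<one>\<^bsub>F\<^esub>"
  have c: "?c \<in> Units F"
    using n by (simp add: F.field_Units F.ring_char_dvd_iff)
  have "inv\<^bsub>F\<^esub> ?c \<odot>\<^bsub>M\<^esub> (?c \<odot>\<^bsub>M\<^esub> x) = inv\<^bsub>F\<^esub> ?c \<odot>\<^bsub>M\<^esub> (?c \<odot>\<^bsub>M\<^esub> y)"
    using eq xy by (simp add: M.add_pow_smult_one)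
  then show ?thesis
    using c xy by (simp add: M.smult_assoc1[symmetric])
qed

lemma (in divided_power_algebra) mpow_eq:
  "a \<in> carrier A \<Longrightarrow> n \<ge> 1 \<Longrightarrow> mpow A a n = [(fact n :: nat)] \<cdot>\<^bsub>A\<^esub> dpow A n a"
  using mpow_eq_fact_dpow[of "dpow A" a "n - 1", OF dpow_closed dpow_one dpow_times] by simp

text \<open>Strong induction with \<open>x\<close> arbitrary, because for \<open>n = m p\<close> the
  hypothesis at \<open>m\<close> is applied to the \<open>p\<close>-th power of \<open>x\<close>.
  Apart from \<open>n = 1\<close> and \<open>n = p\<close>, each case gives equality only up to an
  integer factor prime to \<open>p\<close>, which \<open>add_pow_cancel\<close> removes.\<close>

lemma divided_powers_determined:
  fixes M :: "('f, 'a) module" and F :: "('f, 'r) ring_scheme"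
  assumes "divided_power_algebra F (with_dpow M \<gamma>)" "divided_power_algebra F (with_dpow M \<delta>)"
    and "ring_char F > 0"
    and eq: "\<And>x. x \<in> carrier M \<Longrightarrow> \<gamma> (ring_char F) x = \<delta> (ring_char F) x"
    and "n \<ge> 1" "x \<in> carrier M"
  shows "\<gamma> n x = \<delta> n x"
  using \<open>n \<ge> 1\<close> \<open>x \<in> carrier M\<close>
proof (induction n arbitrary: x rule: less_induct)
  case (less n)
  interpret A: divided_power_algebra F "with_dpow M \<gamma>" by fact
  interpret B: divided_power_algebra F "with_dpow M \<delta>" by fact
  let ?p = "ring_char F"
  have p: "prime ?p" using A.prime_ring_char assms(3) .
  \<comment> \<open>Natural multiples depend only on the addition and zero, which the two algebras
    share.\<close>
  have [simp]: "[(k::nat)] \<cdot>\<^bsub>with_dpow M \<epsilon>\<^esub> z = [k] \<cdot>\<^bsub>M\<^esub> z" for k \<epsilon> z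
    by (simp add: add_pow_def nat_pow_def)
  have cancel: "\<gamma> n x = \<delta> n x"
    if "\<not> ?p dvd k" "[k] \<cdot>\<^bsub>M\<^esub> \<gamma> n x = [k] \<cdot>\<^bsub>M\<^esub> \<delta> n x" for k
    using add_pow_cancel[OF A.field_axioms A.module_axioms that(1)] that(2)
      A.dpow_closed[of n x] B.dpow_closed[of n x] less.prems by simp
  consider "n = 1" | "n > 1" "\<not> ?p dvd n" | "n = ?p" | m where "n = m * ?p" "m > 1"
    using less.prems(1)
    by (metis One_nat_def Suc_lessI dvd_def le_eq_less_or_eq mult.commute mult_eq_0_iff nat_mult_1
      not_gr0 not_one_le_zero)
  then show ?case
  proof cases
    case 1
    then show ?thesis using A.dpow_one[of x] B.dpow_one[of x] less.prems by simp
  next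
    case 2
    \<comment> \<open>Preparation for \<open>x[n-1] x[1] = n x[n]\<close>, where both exponents on
      the left are below \<open>n\<close>.\<close>
    have n: "n - 1 \<ge> 1" "n - 1 < n" "n - 1 + 1 = n" "n choose (n - 1) = n"
      using 2 binomial_symmetric[of 1 n] by auto
    have "\<gamma> (n - 1) x = \<delta> (n - 1) x" "\<gamma> 1 x = \<delta> 1 x"
      using less n by (auto simp: 2)
    then have "[n] \<cdot>\<^bsub>M\<^esub> \<gamma> n x = [n] \<cdot>\<^bsub>M\<^esub> \<delta> n x"
      using A.dpow_times[OF n(1) order.refl, of x] B.dpow_times[OF n(1) order.refl, of x]
        less.prems n(3,4) by simp
    with 2 show ?thesis using cancel by blast
  next
    case 3
    then show ?thesis using eq less.prems by simp
  next
    case 4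
    have p1: "?p \<ge> 1" "m < n" using p 4 prime_gt_1_nat[OF p] by auto
    let ?c = "fact (m * ?p) div (fact m * fact ?p ^ m) :: nat"
    have "\<gamma> m (\<gamma> ?p x) = \<delta> m (\<delta> ?p x)"
      using less 4 p1 A.dpow_closed[OF p1(1), of x] by (simp add: eq)
    then have "[?c] \<cdot>\<^bsub>M\<^esub> \<gamma> n x = [?c] \<cdot>\<^bsub>M\<^esub> \<delta> n x"
      using A.dpow_dpow[of m ?p x] B.dpow_dpow[of m ?p x] p1 4 less.prems by simp
    moreover have "\<not> ?p dvd ?c" using prime_not_dvd_fact_div[OF p] .
    ultimately show ?thesis using cancel by blast
  qed
qed

section \<open>The functor T\<close>

lemma T_module_simps:
  "carrier (T_module A) = carrier A \<times> carrier A"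
  "(a, b) \<otimes>\<^bsub>T_module A\<^esub> (a', b') = (a \<otimes>\<^bsub>A\<^esub> a', a \<otimes>\<^bsub>A\<^esub> b' \<oplus>\<^bsub>A\<^esub> a' \<otimes>\<^bsub>A\<^esub> b)"
  "\<zero>\<^bsub>T_module A\<^esub> = (\<zero>\<^bsub>A\<^esub>, \<zero>\<^bsub>A\<^esub>)"
  "(a, b) \<oplus>\<^bsub>T_module A\<^esub> (a', b') = (a \<oplus>\<^bsub>A\<^esub> a', b \<oplus>\<^bsub>A\<^esub> b')"
  "k \<odot>\<^bsub>T_module A\<^esub> (a, b) = (k \<odot>\<^bsub>A\<^esub> a, k \<odot>\<^bsub>A\<^esub> b)"
  by (simp_all add: T_module_def)

lemma nonunital_comm_algebra_T_module:
  fixes A :: "('f, 'a) dpalg"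
  assumes "nonunital_comm_algebra F A"
  shows "nonunital_comm_algebra F (with_dpow (T_module A) \<gamma>)"
proof -
  interpret A: nonunital_comm_algebra F A by fact
  have "abelian_group (with_dpow (T_module A) \<gamma>)"
  proof (rule abelian_groupI)
    fix x assume "x \<in> carrier (with_dpow (T_module A) \<gamma>)"
    then obtain a b where "x = (a, b)" "a \<in> carrier A" "b \<in> carrier A"
      by (auto simp: T_module_simps)
    then show "\<exists>y\<in>carrier (with_dpow (T_module A) \<gamma>).
        y \<oplus>\<^bsub>with_dpow (T_module A) \<gamma>\<^esub> x = \<zero>\<^bsub>with_dpow (T_module A) \<gamma>\<^esub>"
      by (intro bexI[of _ "(\<ominus>\<^bsub>A\<^esub> a, \<ominus>\<^bsub>A\<^esub> b)"]) (auto simp: T_module_simps A.M.l_neg)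
  qed (auto simp: T_module_simps A.M.a_ac)
  then have "module F (with_dpow (T_module A) \<gamma>)"
    by (intro moduleI A.R.is_cring)
      (auto simp: T_module_simps A.smult_l_distr A.smult_r_distr A.smult_assoc1)
  then show ?thesis
    by (rule nonunital_comm_algebra.intro, unfold_locales)
      (auto simp: T_module_simps A.mult_closed A.mult_assoc A.mult_add A.add_mult A.mult_smult
        A.smult_r_distr A.mult_comm A.mult_left_comm A.M.a_ac)
qed

context
  fixes F :: "('f, 'r) ring_scheme" and A :: "('f, 'a) dpalg" and \<gamma> :: "nat \<Rightarrow> 'a \<times> 'a \<Rightarrow> 'a \<times> 'a"
  assumes algebra: "nonunital_comm_algebra F A"
begin

interpretation A: nonunital_comm_algebra F A by (rule algebra)
interpretation T: nonunital_comm_algebra F "with_dpow (T_module A) \<gamma>"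
  by (rule nonunital_comm_algebra_T_module[OF algebra])

lemma T_module_add_pow:
  fixes n :: nat
  assumes "a \<in> carrier A" "b \<in> carrier A"
  shows "[n] \<cdot>\<^bsub>with_dpow (T_module A) \<gamma>\<^esub> (a, b) = ([n] \<cdot>\<^bsub>A\<^esub> a, [n] \<cdot>\<^bsub>A\<^esub> b)"
proof (induction n)
  case 0
  show ?case using T.M.add.nat_pow_0 by (simp add: T_module_simps)
next
  case (Suc n)
  then show ?case using T.M.add.nat_pow_Suc[of n "(a, b)"] by (simp add: T_module_simps)
qed

lemma T_module_finsum:
  assumes "finite S" "\<And>i. i \<in> S \<Longrightarrow> f i \<in> carrier A" "\<And>i. i \<in> S \<Longrightarrow> g i \<in> carrier A"
  shows "(\<Oplus>\<^bsub>with_dpow (T_module A) \<gamma>\<^esub>i\<in>S. (f i, g i)) = (\<Oplus>\<^bsub>A\<^esub>i\<in>S. f i, \<Oplus>\<^bsub>A\<^esub>i\<in>S. g i)"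
  using assms
proof (induction set: finite)
  case empty
  show ?case using T.M.finsum_empty by (simp add: T_module_simps)
next
  case (insert x S)
  then show ?case
    using T.M.finsum_insert[of S x "\<lambda>i. (f i, g i)"] by (simp add: T_module_simps Pi_def)
qed

end

text \<open>At \<open>n = 1\<close> the zeroth power acts as the identity and returns
  \<open>(a, b)\<close>. The two restrictions match the extensionality demanded in
  \<open>T_dpow\<close>, so that both families can be compared as functions.\<close>

definition T_powers :: "('f, 'a) dpalg \<Rightarrow> nat \<Rightarrow> 'a \<times> 'a \<Rightarrow> 'a \<times> 'a" where
  "T_powers A = (\<lambda>n\<in>{1..}. \<lambda>(a, b)\<in>carrier A \<times> carrier A. (dpow A n a, dact A (n - 1) a b))"

lemma T_powers_apply:
  "\<lbrakk>n \<ge> 1; a \<in> carrier A; b \<in> carrier A\<rbrakk> \<Longrightarrow>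
    T_powers A n (a, b) = (dpow A n a, dact A (n - 1) a b)"
  by (simp add: T_powers_def)

text \<open>The second coordinate of the addition rule in T(A). Expand the action on
  \<open>b'\<close> and on \<open>b\<close> separately: the term free of \<open>a\<close>,
  respectively of \<open>a'\<close>, becomes an outer summand, and the remaining terms pair up under
  a common index \<open>l\<close>.\<close>

lemma T_powers_add:
  fixes A :: "('f, 'a) dpalg"
  assumes "divided_power_algebra F A" and n: "n \<ge> 1"
    and ab: "a \<in> carrier A" "b \<in> carrier A" "a' \<in> carrier A" "b' \<in> carrier A"
  shows "dact A (n - 1) (a \<oplus>\<^bsub>A\<^esub> a') (b \<oplus>\<^bsub>A\<^esub> b') =
    dact A (n - 1) a b \<oplus>\<^bsub>A\<^esub>
    (\<Oplus>\<^bsub>A\<^esub>l\<in>{1..<n}. dpow A l a \<otimes>\<^bsub>A\<^esub> dact A (n - l - 1) a' b' \<oplus>\<^bsub>A\<^esub>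
      dpow A (n - l) a' \<otimes>\<^bsub>A\<^esub> dact A (l - 1) a b) \<oplus>\<^bsub>A\<^esub>
    dact A (n - 1) a' b'"
proof -
  interpret A: divided_power_algebra F A by fact
  let ?f = "\<lambda>l. dpow A l a \<otimes>\<^bsub>A\<^esub> dact A (n - l - 1) a' b'"
  let ?g = "\<lambda>l. dpow A (n - l) a' \<otimes>\<^bsub>A\<^esub> dact A (l - 1) a b"
  have f: "?f \<in> {1..<n} \<rightarrow> carrier A" and g: "?g \<in> {1..<n} \<rightarrow> carrier A"
    using ab by (auto intro!: A.mult_closed A.dpow_closed A.dact_closed)
  have "dact A (n - 1) (a \<oplus>\<^bsub>A\<^esub> a') b' =
      (\<Oplus>\<^bsub>A\<^esub>l\<in>insert 0 {1..<n}. dact A l a (dact A (n - 1 - l) a' b'))"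
  proof -
    have "{0..n - 1} = insert 0 {1..<n}" using n by auto
    then show ?thesis using ab by (simp add: A.dact_add del: One_nat_def)
  qed
  also have "\<dots> = dact A (n - 1) a' b' \<oplus>\<^bsub>A\<^esub>
      (\<Oplus>\<^bsub>A\<^esub>l\<in>{1..<n}. dact A l a (dact A (n - 1 - l) a' b'))"
    using ab by (subst A.M.finsum_insert) auto
  also have "(\<Oplus>\<^bsub>A\<^esub>l\<in>{1..<n}. dact A l a (dact A (n - 1 - l) a' b')) = finsum A ?f {1..<n}"
    by (rule A.M.finsum_cong'[OF HOL.refl f]) (simp add: A.dact_pos)
  finally have 1: "dact A (n - 1) (a \<oplus>\<^bsub>A\<^esub> a') b' = dact A (n - 1) a' b' \<oplus>\<^bsub>A\<^esub> finsum A ?f {1..<n}" .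
  have "dact A (n - 1) (a \<oplus>\<^bsub>A\<^esub> a') b =
      (\<Oplus>\<^bsub>A\<^esub>l\<in>{0..n - 1}. dact A l a (dact A (n - 1 - l) a' b))"
    using ab by (simp add: A.dact_add)
  \<comment> \<open>Shifting the index by one aligns \<open>a[l-1] a'[n-l] b\<close> with the
    \<open>l\<close>-th term of the first expansion; the new top index \<open>l = n\<close> carries
    the outer summand.\<close>
  also have "\<dots> = (\<Oplus>\<^bsub>A\<^esub>l\<in>(\<lambda>l. l - 1) ` {1..n}. dact A l a (dact A (n - 1 - l) a' b))"
  proof -
    have "{0..n - 1} = (\<lambda>l. l - 1) ` {1..n}"
      using n by (auto simp: image_iff intro!: bexI[of _ "Suc _"])
    then show ?thesis by simp
  qed
  also have "\<dots> = (\<Oplus>\<^bsub>A\<^esub>l\<in>{1..n}. dact A (l - 1) a (dact A (n - 1 - (l - 1)) a' b))"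
    using ab by (intro A.M.add.finprod_reindex) (auto simp: inj_on_def)
  also have "\<dots> = (\<Oplus>\<^bsub>A\<^esub>l\<in>insert n {1..<n}. dact A (l - 1) a (dact A (n - 1 - (l - 1)) a' b))"
    using n by (intro arg_cong[of _ _ "finsum A _"]) auto
  also have "\<dots> = dact A (n - 1) a b \<oplus>\<^bsub>A\<^esub>
      (\<Oplus>\<^bsub>A\<^esub>l\<in>{1..<n}. dact A (l - 1) a (dact A (n - 1 - (l - 1)) a' b))"
    using ab by (subst A.M.finsum_insert) auto
  also have "(\<Oplus>\<^bsub>A\<^esub>l\<in>{1..<n}. dact A (l - 1) a (dact A (n - 1 - (l - 1)) a' b)) = finsum A ?g {1..<n}"
  proof (rule A.M.finsum_cong'[OF HOL.refl g])
    fix l assume "l \<in> {1..<n}"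
    then have "n - 1 - (l - 1) = n - l" "n - l \<ge> 1" by auto
    then show "dact A (l - 1) a (dact A (n - 1 - (l - 1)) a' b) = ?g l"
      using ab by (simp add: A.dact_pos A.mult_dact A.dpow_closed)
  qed
  finally have 2: "dact A (n - 1) (a \<oplus>\<^bsub>A\<^esub> a') b = dact A (n - 1) a b \<oplus>\<^bsub>A\<^esub> finsum A ?g {1..<n}" .
  have "finsum A ?f {1..<n} \<in> carrier A" "finsum A ?g {1..<n} \<in> carrier A"
    using f g by (auto intro: A.M.finsum_closed)
  then show ?thesis
    using ab f g by (simp add: A.dact_add_right 1 2 A.M.a_ac A.M.finsum_addf del: One_nat_def)
qed

text \<open>The first coordinate of each axiom is the same axiom in \<open>A\<close>; the second
  coordinates are the rules for \<open>dact\<close>, with \<open>T_powers_add\<close> for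
  sums.\<close>

lemma divided_power_algebra_T_powers:
  fixes A :: "('f, 'a) dpalg"
  assumes "divided_power_algebra F A"
  shows "divided_power_algebra F (with_dpow (T_module A) (T_powers A))"
    (is "divided_power_algebra F ?T")
proof -
  interpret A: divided_power_algebra F A by fact
  have alg: "nonunital_comm_algebra F A" by unfold_locales
  note add_pow = T_module_add_pow[OF alg] and finsum = T_module_finsum[OF alg]
  have [simp]: "dpow A k a \<in> carrier A" if "k \<ge> 1" "a \<in> carrier A" for k a
    using that by (rule A.dpow_closed)
  show ?thesis
  proof (rule divided_power_algebraI[OF A.field_axioms nonunital_comm_algebra_T_module[OF alg]])
    fix n :: nat and x assume n: "n \<ge> 1" and "x \<in> carrier ?T"
    then obtain a b where ab: "x = (a, b)" "a \<in> carrier A" "b \<in> carrier A"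
      by (auto simp: T_module_simps)
    show "dpow ?T n x \<in> carrier ?T"
      using n ab by (simp add: T_powers_apply T_module_simps)
    show "dpow ?T n (k \<odot>\<^bsub>?T\<^esub> x) = (k [^]\<^bsub>F\<^esub> n) \<odot>\<^bsub>?T\<^esub> dpow ?T n x" if k: "k \<in> carrier F" for k
    proof -
      obtain n' where n': "n = Suc n'" using n by (cases n) auto
      then show ?thesis
        using n ab k by (simp add: T_powers_apply T_module_simps A.dpow_smult A.dact_smult
            A.dact_smult_right A.smult_assoc1[symmetric] A.m_comm)
    qed
    fix y assume "y \<in> carrier ?T"
    then obtain a' b' where ab': "y = (a', b')" "a' \<in> carrier A" "b' \<in> carrier A"
      by (auto simp: T_module_simps)
    have "(\<Oplus>\<^bsub>?T\<^esub>l\<in>{1..<n}. dpow ?T l x \<otimes>\<^bsub>?T\<^esub> dpow ?T (n - l) y) =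
        (\<Oplus>\<^bsub>?T\<^esub>l\<in>{1..<n}. (dpow A l a \<otimes>\<^bsub>A\<^esub> dpow A (n - l) a',
          dpow A l a \<otimes>\<^bsub>A\<^esub> dact A (n - l - 1) a' b' \<oplus>\<^bsub>A\<^esub> dpow A (n - l) a' \<otimes>\<^bsub>A\<^esub> dact A (l - 1) a b))"
    proof -
      interpret T: nonunital_comm_algebra F ?T by (rule nonunital_comm_algebra_T_module[OF alg])
      show ?thesis
        using ab ab' by (intro T.M.finsum_cong')
          (auto simp: T_powers_apply T_module_simps A.mult_closed)
    qed
    then show "dpow ?T n (x \<oplus>\<^bsub>?T\<^esub> y) = dpow ?T n x \<oplus>\<^bsub>?T\<^esub>
        (\<Oplus>\<^bsub>?T\<^esub>l\<in>{1..<n}. dpow ?T l x \<otimes>\<^bsub>?T\<^esub> dpow ?T (n - l) y) \<oplus>\<^bsub>?T\<^esub> dpow ?T n y"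
      using n ab ab' T_powers_add[OF A.divided_power_algebra_axioms n ab(2,3) ab'(2,3)]
      by (subst (asm) finsum)
        (auto simp: A.mult_closed T_powers_apply T_module_simps A.dpow_add simp del: One_nat_def)
    obtain n' where n': "n = Suc n'" using n by (cases n) auto
    \<comment> \<open>Writing the product as \<open>a' a\<close> in the second half makes both
      halves instances of \<open>dact_mult\<close>, with the factors exchanged.\<close>
    have "dact A n' (a \<otimes>\<^bsub>A\<^esub> a') (a \<otimes>\<^bsub>A\<^esub> b' \<oplus>\<^bsub>A\<^esub> a' \<otimes>\<^bsub>A\<^esub> b) =
        dact A n' (a \<otimes>\<^bsub>A\<^esub> a') (a \<otimes>\<^bsub>A\<^esub> b') \<oplus>\<^bsub>A\<^esub> dact A n' (a' \<otimes>\<^bsub>A\<^esub> a) (a' \<otimes>\<^bsub>A\<^esub> b)"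
      using ab ab' by (simp add: A.dact_add_right A.mult_closed A.mult_comm)
    also have "\<dots> = [(fact n :: nat)] \<cdot>\<^bsub>A\<^esub>
        (dpow A n a \<otimes>\<^bsub>A\<^esub> dact A n' a' b' \<oplus>\<^bsub>A\<^esub> dpow A n a' \<otimes>\<^bsub>A\<^esub> dact A n' a b)"
      using ab ab' n'
      by (simp add: A.dact_mult A.mult_closed A.M.add.nat_pow_distrib del: fact_Suc)
    finally show "dpow ?T n (x \<otimes>\<^bsub>?T\<^esub> y) = [(fact n :: nat)] \<cdot>\<^bsub>?T\<^esub> (dpow ?T n x \<otimes>\<^bsub>?T\<^esub> dpow ?T n y)"
      using n ab ab' n'
      by (simp add: T_powers_apply T_module_simps A.mult_closed add_pow A.dpow_mult del: fact_Suc)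
  next
    fix x assume "x \<in> carrier ?T"
    then show "dpow ?T 1 x = x"
      using A.dpow_one by (auto simp: T_module_simps T_powers_apply)
  next
    fix m n :: nat and x assume mn: "m \<ge> 1" "n \<ge> 1" and "x \<in> carrier ?T"
    then obtain a b where ab: "x = (a, b)" "a \<in> carrier A" "b \<in> carrier A"
      by (auto simp: T_module_simps)
    obtain m' n' where m': "m = Suc m'" "n = Suc n'" using mn by (cases m; cases n) auto
    have "dpow A m a \<otimes>\<^bsub>A\<^esub> dact A n' a b \<oplus>\<^bsub>A\<^esub> dpow A n a \<otimes>\<^bsub>A\<^esub> dact A m' a b =
        dact A m a (dact A n' a b) \<oplus>\<^bsub>A\<^esub> dact A n a (dact A m' a b)"
      using mn by (simp add: A.dact_pos)
    also have "\<dots> = [(((m + n') choose m) + ((n + m') choose n))] \<cdot>\<^bsub>A\<^esub> dact A (m' + n) a b"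
      using ab m' by (simp add: A.dact_dact A.M.add.nat_pow_mult add.commute)
    \<comment> \<open>Pascal's rule, after replacing \<open>C(n+m', n)\<close> by
      \<open>C(n+m', m')\<close>.\<close>
    also have "((m + n') choose m) + ((n + m') choose n) = (m + n) choose m"
      using binomial_symmetric[of n "n + m'"] by (simp add: m' add.commute)
    finally show "dpow ?T m x \<otimes>\<^bsub>?T\<^esub> dpow ?T n x = [((m + n) choose m)] \<cdot>\<^bsub>?T\<^esub> dpow ?T (m + n) x"
      using mn ab m'
      by (simp add: T_powers_apply T_module_simps A.mult_closed add_pow A.dpow_times del: binomial_Suc_Suc)
    let ?c = "fact (m * n) div (fact m * fact n ^ m) :: nat"
    have "dact A m' (dpow A n a) (dact A n' a b) = [?c] \<cdot>\<^bsub>A\<^esub> dact A (m * n - 1) a b"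
      using ab by (simp add: m' A.dact_dpow ac_simps del: fact_Suc)
    moreover have "m * n \<ge> 1" using mn by simp
    ultimately show "dpow ?T m (dpow ?T n x) = [?c] \<cdot>\<^bsub>?T\<^esub> dpow ?T (m * n) x"
      using mn ab m'
      by (simp add: T_powers_apply add_pow A.dpow_dpow del: fact_Suc mult_Suc mult_Suc_right)
  qed
qed

lemma T_powers_ring_char:
  fixes A :: "('f, 'a) dpalg"
  assumes "divided_power_algebra F A" "ring_char F = p" "p > 0" "a \<in> carrier A" "b \<in> carrier A"
  shows "T_powers A p (a, b) = (dpow A p a, \<ominus>\<^bsub>A\<^esub> (mpow A a (p - 1) \<otimes>\<^bsub>A\<^esub> b))"
proof -
  interpret A: divided_power_algebra F A by fact
  have p: "prime p" using A.prime_ring_char assms(2,3) by simp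
  then have p1: "p - 1 \<ge> 1" using prime_gt_1_nat[OF p] by simp
  have "[fact (p - 1) = - 1] (mod (int p))" using wilson_theorem[OF p] .
  then have "int p dvd int (fact (p - 1) + 1)"
    by (simp add: cong_iff_dvd_diff add.commute)
  then have dvd: "p dvd fact (p - 1) + 1" by (simp only: int_dvd_int_iff)
  let ?x = "dact A (p - 1) a b" and ?y = "mpow A a (p - 1) \<otimes>\<^bsub>A\<^esub> b"
  have x: "?x \<in> carrier A" using assms by simp
  \<comment> \<open>The ordinary power is \<open>(p-1)!\<close> times \<open>a[p-1]\<close>, so
    \<open>?y\<close> is \<open>(p-1)!\<close> times \<open>?x\<close> and the sum is a multiple of
    \<open>p\<close>.\<close>
  have "?y \<oplus>\<^bsub>A\<^esub> ?x = [(fact (p - 1) + 1 :: nat)] \<cdot>\<^bsub>A\<^esub> ?x"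
    using p1 assms by (simp add: A.mpow_eq A.add_pow_mult A.dpow_closed A.dact_pos A.mult_closed)
  also have "\<dots> = ([(fact (p - 1) + 1 :: nat)] \<cdot>\<^bsub>F\<^esub> \<one>\<^bsub>F\<^esub>) \<odot>\<^bsub>A\<^esub> ?x"
    using x by (rule A.add_pow_smult_one[symmetric])
  also have "[(fact (p - 1) + 1 :: nat)] \<cdot>\<^bsub>F\<^esub> \<one>\<^bsub>F\<^esub> = \<zero>\<^bsub>F\<^esub>"
    unfolding A.ring_char_dvd_iff using dvd assms(2) by simp
  also have "\<zero>\<^bsub>F\<^esub> \<odot>\<^bsub>A\<^esub> ?x = \<zero>\<^bsub>A\<^esub>" using x by simp
  finally have sum: "?y \<oplus>\<^bsub>A\<^esub> ?x = \<zero>\<^bsub>A\<^esub>" .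
  have y: "?y \<in> carrier A"
    using p1 assms by (simp add: A.mpow_eq A.dpow_closed A.mult_closed)
  have "?x = \<ominus>\<^bsub>A\<^esub> ?y"
    by (rule A.M.minus_equality[OF _ y x, symmetric]) (unfold A.M.a_comm[OF x y], rule sum)
  then show ?thesis using assms by (simp add: T_powers_apply)
qed

lemma T_dpow_eq_T_powers:
  fixes A :: "('f, 'a) dpalg"
  assumes "divided_power_algebra F A" "ring_char F = p" "p > 0"
  shows "T_dpow F p A = T_powers A"
  unfolding T_dpow_def
proof (rule the_equality)
  note T = divided_power_algebra_T_powers[OF assms(1)]
  interpret T: divided_power_algebra F "with_dpow (T_module A) (T_powers A)" by (rule T)
  have ext: "T_powers A \<in> {1..} \<rightarrow>\<^sub>E (carrier (T_module A) \<rightarrow>\<^sub>E carrier (T_module A))"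
    using T.dpow_closed by (auto simp: T_powers_def PiE_def extensional_def T_module_simps Pi_def)
  with T show "T_powers A \<in> {1..} \<rightarrow>\<^sub>E (carrier (T_module A) \<rightarrow>\<^sub>E carrier (T_module A)) \<and>
      divided_power_algebra F (with_dpow (T_module A) (T_powers A)) \<and>
      (\<forall>a\<in>carrier A. \<forall>b\<in>carrier A.
        T_powers A p (a, b) = (dpow A p a, \<ominus>\<^bsub>A\<^esub> (mpow A a (p - 1) \<otimes>\<^bsub>A\<^esub> b)))"
    using T_powers_ring_char[OF assms] by simp
  fix \<gamma> assume \<gamma>: "\<gamma> \<in> {1..} \<rightarrow>\<^sub>E (carrier (T_module A) \<rightarrow>\<^sub>E carrier (T_module A)) \<and>
      divided_power_algebra F (with_dpow (T_module A) \<gamma>) \<and>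
      (\<forall>a\<in>carrier A. \<forall>b\<in>carrier A.
        \<gamma> p (a, b) = (dpow A p a, \<ominus>\<^bsub>A\<^esub> (mpow A a (p - 1) \<otimes>\<^bsub>A\<^esub> b)))"
  then have "\<gamma> n x = T_powers A n x" if "n \<ge> 1" "x \<in> carrier (T_module A)" for n x
    using divided_powers_determined[of F "T_module A" \<gamma> "T_powers A"] T that assms(2,3)
      T_powers_ring_char[OF assms] by (auto simp: T_module_simps)
  note eq = this
  \<comment> \<open>Both families are extensional in the exponent and in the argument, so agreement
    for \<open>n >= 1\<close> on the carrier is equality.\<close>
  show "\<gamma> = T_powers A"
  proof (rule PiE_ext)
    show "\<gamma> \<in> {1..} \<rightarrow>\<^sub>E (carrier (T_module A) \<rightarrow>\<^sub>E carrier (T_module A))"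
      using \<gamma> by blast
    show "T_powers A \<in> {1..} \<rightarrow>\<^sub>E (carrier (T_module A) \<rightarrow>\<^sub>E carrier (T_module A))"
      by (rule ext)
  next
    fix n :: nat assume n: "n \<in> {1..}"
    show "\<gamma> n = T_powers A n"
    proof (rule extensionalityI)
      show "\<gamma> n \<in> extensional (carrier (T_module A))"
        using PiE_mem[OF conjunct1[OF \<gamma>] n] by (simp add: PiE_def)
      show "T_powers A n \<in> extensional (carrier (T_module A))"
        using PiE_mem[OF ext n] by (simp add: PiE_def)
    qed (use eq n in simp)
  qed
qed

section \<open>Submodules and quotients of modules over an algebra without unit\<close>

lemma (in module) smult_left_comm:
  "\<lbrakk>k \<in> carrier R; l \<in> carrier R; x \<in> carrier M\<rbrakk> \<Longrightarrow>
    k \<odot>\<^bsub>M\<^esub> (l \<odot>\<^bsub>M\<^esub> x) = l \<odot>\<^bsub>M\<^esub> (k \<odot>\<^bsub>M\<^esub> x)"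
  by (metis smult_assoc1 m_comm)

lemma (in algebra_module) act_zero_right [simp]:
  "a \<in> carrier A \<Longrightarrow> act M a \<zero>\<^bsub>M\<^esub> = \<zero>\<^bsub>M\<^esub>"
  using act_smult_right[of "\<zero>\<^bsub>F\<^esub>" a "\<zero>\<^bsub>M\<^esub>"] act_closed[of a "\<zero>\<^bsub>M\<^esub>"] by simp

lemma (in algebra_module) act_zero_left [simp]:
  "x \<in> carrier M \<Longrightarrow> act M \<zero>\<^bsub>A\<^esub> x = \<zero>\<^bsub>M\<^esub>"
  using act_smult_left[of "\<zero>\<^bsub>F\<^esub>" "\<zero>\<^bsub>A\<^esub>" x] act_closed[of "\<zero>\<^bsub>A\<^esub>" x] by simp

lemma (in algebra_module) act_finsum:
  "\<lbrakk>finite S; a \<in> carrier A; f \<in> S \<rightarrow> carrier M\<rbrakk> \<Longrightarrow>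
    act M a (\<Oplus>\<^bsub>M\<^esub>i\<in>S. f i) = (\<Oplus>\<^bsub>M\<^esub>i\<in>S. act M a (f i))"
proof (induction set: finite)
  case (insert x S)
  then show ?case by (simp add: Pi_def act_add_right act_closed)
qed simp

text \<open>The condition on the members of the intersection \<open>umodule_span\<close>, named so
  that spans, kernels and quotients can share it.\<close>

definition usubmodule ::
  "('f, 'r) ring_scheme \<Rightarrow> ('f, 'a) dpalg \<Rightarrow> ('f, 'a, 'm) umodule \<Rightarrow> 'm set \<Rightarrow> bool" where
  "usubmodule F A M N \<longleftrightarrow> submodule N F M \<and> (\<forall>a\<in>carrier A. \<forall>x\<in>N. act M a x \<in> N)"

context
  fixes F :: "('f, 'r) ring_scheme" and A :: "('f, 'a) dpalg" and M :: "('f, 'a, 'm) umodule"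
  assumes algebra_module_M: "algebra_module F A M"
begin

interpretation M: algebra_module F A M by (rule algebra_module_M)

lemma usubmoduleI:
  assumes "N \<subseteq> carrier M" "\<zero>\<^bsub>M\<^esub> \<in> N" "\<And>x y. \<lbrakk>x \<in> N; y \<in> N\<rbrakk> \<Longrightarrow> x \<oplus>\<^bsub>M\<^esub> y \<in> N"
    and smult: "\<And>k x. \<lbrakk>k \<in> carrier F; x \<in> N\<rbrakk> \<Longrightarrow> k \<odot>\<^bsub>M\<^esub> x \<in> N"
    and "\<And>a x. \<lbrakk>a \<in> carrier A; x \<in> N\<rbrakk> \<Longrightarrow> act M a x \<in> N"
  shows "usubmodule F A M N"
proof -
  \<comment> \<open>Negation is multiplication by the scalar \<open>-1\<close>.\<close>
  have "\<ominus>\<^bsub>M\<^esub> x \<in> N" if "x \<in> N" for x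
  proof -
    have "x \<in> carrier M" using that assms(1) by blast
    then show ?thesis
      using smult[of "\<ominus>\<^bsub>F\<^esub> \<one>\<^bsub>F\<^esub>" x] that by (simp add: M.smult_l_minus)
  qed
  then have "submodule N F M" by (intro M.submoduleI assms)
  then show ?thesis using assms(5) by (simp add: usubmodule_def)
qed

lemma usubmodule_span:
  assumes "X \<subseteq> carrier M"
  shows "usubmodule F A M (umodule_span F A M X)"
proof (rule usubmoduleI)
  \<comment> \<open>The whole module belongs to the family, which keeps the intersection inside the
    carrier.\<close>
  have "carrier M \<in> {N. submodule N F M \<and> (\<forall>a\<in>carrier A. \<forall>x\<in>N. act M a x \<in> N) \<and> X \<subseteq> N}"
    using assms M.carrier_is_submodule M.act_closed by blast
  then show "umodule_span F A M X \<subseteq> carrier M"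
    unfolding umodule_span_def by (rule Inter_lower)
next
  have "\<zero>\<^bsub>M\<^esub> \<in> N" if "submodule N F M" for N
    using subgroup.one_closed[OF submodule.axioms(1)[OF that]] by simp
  then show "\<zero>\<^bsub>M\<^esub> \<in> umodule_span F A M X"
    unfolding umodule_span_def by blast
qed (auto simp: umodule_span_def M.submoduleE(4,5))

lemma umodule_span_superset: "X \<subseteq> umodule_span F A M X"
  by (auto simp: umodule_span_def)

lemma umodule_span_least: "\<lbrakk>usubmodule F A M N; X \<subseteq> N\<rbrakk> \<Longrightarrow> umodule_span F A M X \<subseteq> N"
  by (auto simp: umodule_span_def usubmodule_def)

context
  fixes N
  assumes N: "usubmodule F A M N"
begin

lemma abelian_subgroup_usubmodule: "abelian_subgroup N M"
  using N M.abelian_group_axioms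
  by (auto simp: usubmodule_def submodule_def intro: abelian_subgroupI3 additive_subgroup.intro)

interpretation N: abelian_subgroup N M by (rule abelian_subgroup_usubmodule)

lemma coset_eq_iff:
  assumes "x \<in> carrier M" "y \<in> carrier M"
  shows "N +>\<^bsub>M\<^esub> x = N +>\<^bsub>M\<^esub> y \<longleftrightarrow> x \<ominus>\<^bsub>M\<^esub> y \<in> N"
  unfolding a_minus_def N.a_rcos_module[OF assms(2,1), symmetric]
  using N.a_repr_independence'[OF _ assms(2)] N.a_rcos_self[OF assms(1)] by metis

text \<open>Scalar multiplication and action on \<open>quot_umodule\<close> are unions over all
  representatives. An additive map preserving \<open>N\<close> sends representatives of one coset
  into one coset, so the union collapses; this handles both operations.\<close>

lemma coset_UN_eq:
  assumes x: "x \<in> carrier M"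
    and closed: "\<And>y. y \<in> carrier M \<Longrightarrow> f y \<in> carrier M"
    and add: "\<And>y z. \<lbrakk>y \<in> carrier M; z \<in> carrier M\<rbrakk> \<Longrightarrow> f (y \<oplus>\<^bsub>M\<^esub> z) = f y \<oplus>\<^bsub>M\<^esub> f z"
    and sub: "\<And>y. y \<in> N \<Longrightarrow> f y \<in> N"
  shows "(\<Union>y\<in>N +>\<^bsub>M\<^esub> x. N +>\<^bsub>M\<^esub> f y) = N +>\<^bsub>M\<^esub> f x"
proof -
  have "N +>\<^bsub>M\<^esub> f y = N +>\<^bsub>M\<^esub> f x" if y: "y \<in> N +>\<^bsub>M\<^esub> x" for y
  proof -
    obtain n where n: "n \<in> N" "y = n \<oplus>\<^bsub>M\<^esub> x"
      using y by (auto simp: a_r_coset_def')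
    then have "f y = f n \<oplus>\<^bsub>M\<^esub> f x" using x add by simp
    then have "f y \<ominus>\<^bsub>M\<^esub> f x = f n"
      using n x closed by (simp add: a_minus_def M.a_assoc M.r_neg)
    then show ?thesis
      using n x closed sub by (subst coset_eq_iff) auto
  qed
  moreover have "x \<in> N +>\<^bsub>M\<^esub> x" using x by (rule N.a_rcos_self)
  ultimately show ?thesis by blast
qed

lemma quot_umodule_simps:
  "carrier (quot_umodule M N) = (\<lambda>x. N +>\<^bsub>M\<^esub> x) ` carrier M"
  "\<zero>\<^bsub>quot_umodule M N\<^esub> = N +>\<^bsub>M\<^esub> \<zero>\<^bsub>M\<^esub>"
  "\<lbrakk>x \<in> carrier M; y \<in> carrier M\<rbrakk> \<Longrightarrow>
    (N +>\<^bsub>M\<^esub> x) \<oplus>\<^bsub>quot_umodule M N\<^esub> (N +>\<^bsub>M\<^esub> y) = N +>\<^bsub>M\<^esub> (x \<oplus>\<^bsub>M\<^esub> y)"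
  "\<lbrakk>k \<in> carrier F; x \<in> carrier M\<rbrakk> \<Longrightarrow> k \<odot>\<^bsub>quot_umodule M N\<^esub> (N +>\<^bsub>M\<^esub> x) = N +>\<^bsub>M\<^esub> (k \<odot>\<^bsub>M\<^esub> x)"
  "\<lbrakk>a \<in> carrier A; x \<in> carrier M\<rbrakk> \<Longrightarrow> act (quot_umodule M N) a (N +>\<^bsub>M\<^esub> x) = N +>\<^bsub>M\<^esub> act M a x"
proof -
  show "carrier (quot_umodule M N) = (\<lambda>x. N +>\<^bsub>M\<^esub> x) ` carrier M"
    by (auto simp: quot_umodule_def A_RCOSETS_def')
  show "\<zero>\<^bsub>quot_umodule M N\<^esub> = N +>\<^bsub>M\<^esub> \<zero>\<^bsub>M\<^esub>"
    using N.a_rcos_const[OF N.zero_closed] by (simp add: quot_umodule_def)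
  show "\<lbrakk>x \<in> carrier M; y \<in> carrier M\<rbrakk> \<Longrightarrow>
    (N +>\<^bsub>M\<^esub> x) \<oplus>\<^bsub>quot_umodule M N\<^esub> (N +>\<^bsub>M\<^esub> y) = N +>\<^bsub>M\<^esub> (x \<oplus>\<^bsub>M\<^esub> y)"
    by (simp add: quot_umodule_def N.a_rcos_sum)
  show "\<lbrakk>k \<in> carrier F; x \<in> carrier M\<rbrakk> \<Longrightarrow> k \<odot>\<^bsub>quot_umodule M N\<^esub> (N +>\<^bsub>M\<^esub> x) = N +>\<^bsub>M\<^esub> (k \<odot>\<^bsub>M\<^esub> x)"
    using N by (simp add: quot_umodule_def) (rule coset_UN_eq; simp add: M.smult_r_distr usubmodule_def M.submoduleE(4))
  show "\<lbrakk>a \<in> carrier A; x \<in> carrier M\<rbrakk> \<Longrightarrow> act (quot_umodule M N) a (N +>\<^bsub>M\<^esub> x) = N +>\<^bsub>M\<^esub> act M a x"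
    using N by (simp add: quot_umodule_def) (rule coset_UN_eq; simp add: M.act_closed M.act_add_right usubmodule_def)
qed

lemma algebra_module_quot_umodule: "algebra_module F A (quot_umodule M N)"
proof -
  let ?Q = "quot_umodule M N"
  have "abelian_group ?Q"
  proof (rule abelian_groupI)
    fix X assume "X \<in> carrier ?Q"
    then obtain x where x: "x \<in> carrier M" "X = N +>\<^bsub>M\<^esub> x" by (auto simp: quot_umodule_simps)
    then show "\<exists>Y\<in>carrier ?Q. Y \<oplus>\<^bsub>?Q\<^esub> X = \<zero>\<^bsub>?Q\<^esub>"
      by (intro bexI[of _ "N +>\<^bsub>M\<^esub> \<ominus>\<^bsub>M\<^esub> x"]) (auto simp: quot_umodule_simps M.l_neg)
  qed (auto simp: quot_umodule_simps M.a_ac)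
  then have "module F ?Q"
    by (intro moduleI M.R.is_cring)
      (auto simp: quot_umodule_simps M.smult_l_distr M.smult_r_distr M.smult_assoc1)
  then show ?thesis
    by (intro algebra_module.intro algebra_module_axioms.intro M.nonunital_comm_algebra_axioms)
      (auto simp: quot_umodule_simps M.act_closed M.act_add_left M.act_smult_left M.act_add_right
        M.act_smult_right M.act_mult M.mult_closed)
qed

end

context
  fixes M' :: "('f, 'a, 'n) umodule" and h
  assumes algebra_module_M': "algebra_module F A M'" and h: "h \<in> umodule_hom F A M M'"
begin

interpretation M': algebra_module F A M' by (rule algebra_module_M')

lemma umodule_homD:
  "x \<in> carrier M \<Longrightarrow> h x \<in> carrier M'"
  "\<lbrakk>x \<in> carrier M; y \<in> carrier M\<rbrakk> \<Longrightarrow> h (x \<oplus>\<^bsub>M\<^esub> y) = h x \<oplus>\<^bsub>M'\<^esub> h y"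
  "\<lbrakk>k \<in> carrier F; x \<in> carrier M\<rbrakk> \<Longrightarrow> h (k \<odot>\<^bsub>M\<^esub> x) = k \<odot>\<^bsub>M'\<^esub> h x"
  "\<lbrakk>a \<in> carrier A; x \<in> carrier M\<rbrakk> \<Longrightarrow> h (act M a x) = act M' a (h x)"
  "h \<zero>\<^bsub>M\<^esub> = \<zero>\<^bsub>M'\<^esub>"
  "\<lbrakk>x \<in> carrier M; y \<in> carrier M\<rbrakk> \<Longrightarrow> h (x \<ominus>\<^bsub>M\<^esub> y) = h x \<ominus>\<^bsub>M'\<^esub> h y"
proof -
  show closed: "h x \<in> carrier M'" if "x \<in> carrier M" for x
    using h that by (auto simp: umodule_hom_def)
  show add: "h (x \<oplus>\<^bsub>M\<^esub> y) = h x \<oplus>\<^bsub>M'\<^esub> h y" if "x \<in> carrier M" "y \<in> carrier M" for x y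
    using h that by (simp add: umodule_hom_def)
  show smult: "h (k \<odot>\<^bsub>M\<^esub> x) = k \<odot>\<^bsub>M'\<^esub> h x" if "k \<in> carrier F" "x \<in> carrier M" for k x
    using h that by (simp add: umodule_hom_def)
  show "\<lbrakk>a \<in> carrier A; x \<in> carrier M\<rbrakk> \<Longrightarrow> h (act M a x) = act M' a (h x)"
    using h by (simp add: umodule_hom_def)
  show "h \<zero>\<^bsub>M\<^esub> = \<zero>\<^bsub>M'\<^esub>"
    using smult[of "\<zero>\<^bsub>F\<^esub>" "\<zero>\<^bsub>M\<^esub>"] closed[of "\<zero>\<^bsub>M\<^esub>"] by simp
  have "h (\<ominus>\<^bsub>M\<^esub> y) = \<ominus>\<^bsub>M'\<^esub> h y" if "y \<in> carrier M" for y
    using smult[of "\<ominus>\<^bsub>F\<^esub> \<one>\<^bsub>F\<^esub>" y] closed[OF that] that by (simp add: M.smult_l_minus M'.smult_l_minus)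
  then show "\<lbrakk>x \<in> carrier M; y \<in> carrier M\<rbrakk> \<Longrightarrow> h (x \<ominus>\<^bsub>M\<^esub> y) = h x \<ominus>\<^bsub>M'\<^esub> h y"
    by (simp add: a_minus_def add)
qed

text \<open>The kernel of \<open>h\<close> is itself closed under all module operations, so it
  contains the span as soon as it contains the generators.\<close>

lemma umodule_span_subset_kernel:
  assumes "X \<subseteq> carrier M" "\<And>x. x \<in> X \<Longrightarrow> h x = \<zero>\<^bsub>M'\<^esub>" "x \<in> umodule_span F A M X"
  shows "h x = \<zero>\<^bsub>M'\<^esub>"
proof -
  have "usubmodule F A M {x \<in> carrier M. h x = \<zero>\<^bsub>M'\<^esub>}"
    by (rule usubmoduleI) (auto simp: umodule_homD M.act_closed)
  from umodule_span_least[OF this, of X] show ?thesis using assms by blast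
qed

lemma quot_umodule_lift:
  assumes N: "usubmodule F A M N" and ker: "\<And>x. x \<in> N \<Longrightarrow> h x = \<zero>\<^bsub>M'\<^esub>"
  shows "\<exists>g\<in>umodule_hom F A (quot_umodule M N) M'. \<forall>x\<in>carrier M. g (N +>\<^bsub>M\<^esub> x) = h x"
proof -
  interpret N: abelian_subgroup N M by (rule abelian_subgroup_usubmodule[OF N])
  let ?Q = "quot_umodule M N"
  note Q = quot_umodule_simps[OF N]
  \<comment> \<open>The value is read off from an arbitrary representative; two representatives
    differ by an element of \<open>N\<close>, which \<open>h\<close> kills.\<close>
  define g where "g = (\<lambda>X\<in>carrier ?Q. h (SOME x. x \<in> X))"
  have g: "g (N +>\<^bsub>M\<^esub> x) = h x" if x: "x \<in> carrier M" for x
  proof -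
    let ?y = "SOME y. y \<in> N +>\<^bsub>M\<^esub> x"
    have y: "?y \<in> N +>\<^bsub>M\<^esub> x" using someI[of "\<lambda>y. y \<in> N +>\<^bsub>M\<^esub> x" x] N.a_rcos_self[OF x] by blast
    then have "?y \<in> carrier M" "?y \<ominus>\<^bsub>M\<^esub> x \<in> N"
      using x N.a_elemrcos_carrier N.a_rcos_module_imp by (auto simp: a_minus_def)
    then have "h ?y \<ominus>\<^bsub>M'\<^esub> h x = \<zero>\<^bsub>M'\<^esub>" using ker x umodule_homD(6)[of ?y x] by simp
    moreover have "h ?y = (h ?y \<ominus>\<^bsub>M'\<^esub> h x) \<oplus>\<^bsub>M'\<^esub> h x"
      using x \<open>?y \<in> carrier M\<close> umodule_homD(1) by (simp add: a_minus_def M'.M.a_assoc M'.M.l_neg)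
    ultimately have "h ?y = h x" using umodule_homD(1)[OF x] by simp
    then show ?thesis using x by (simp add: g_def Q)
  qed
  have "g \<in> extensional (carrier ?Q)" by (simp add: g_def)
  then have "g \<in> umodule_hom F A ?Q M'"
    unfolding umodule_hom_def PiE_def by (auto simp: Q g umodule_homD M.act_closed)
  with g show ?thesis by blast
qed

end

end

section \<open>Free modules over an algebra without unit\<close>

context
  fixes F :: "('f, 'r) ring_scheme" and A :: "('f, 'a) dpalg"
  assumes field_F: "field F" and algebra_A: "nonunital_comm_algebra F A"
begin

interpretation F: field F by (rule field_F)
interpretation A: nonunital_comm_algebra F A by (rule algebra_A)

lemma free_umodule_simps:
  "carrier (free_umodule F A S) = {u. (\<forall>s. u s \<in> carrier F \<times> carrier A) \<and>
    finite {s. u s \<noteq> (\<zero>\<^bsub>F\<^esub>, \<zero>\<^bsub>A\<^esub>)} \<and> {s. u s \<noteq> (\<zero>\<^bsub>F\<^esub>, \<zero>\<^bsub>A\<^esub>)} \<subseteq> S}"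
  "\<zero>\<^bsub>free_umodule F A S\<^esub> = (\<lambda>s. (\<zero>\<^bsub>F\<^esub>, \<zero>\<^bsub>A\<^esub>))"
  "u \<oplus>\<^bsub>free_umodule F A S\<^esub> v = (\<lambda>s. (fst (u s) \<oplus>\<^bsub>F\<^esub> fst (v s), snd (u s) \<oplus>\<^bsub>A\<^esub> snd (v s)))"
  "k \<odot>\<^bsub>free_umodule F A S\<^esub> u = (\<lambda>s. (k \<otimes>\<^bsub>F\<^esub> fst (u s), k \<odot>\<^bsub>A\<^esub> snd (u s)))"
  "act (free_umodule F A S) a u =
    (\<lambda>s. (\<zero>\<^bsub>F\<^esub>, fst (u s) \<odot>\<^bsub>A\<^esub> a \<oplus>\<^bsub>A\<^esub> a \<otimes>\<^bsub>A\<^esub> snd (u s)))"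
  by (simp_all add: free_umodule_def)

lemma free_umodule_carrierI:
  assumes "\<And>s. u s \<in> carrier F \<times> carrier A" "finite T" "T \<subseteq> S"
    and "\<And>s. s \<notin> T \<Longrightarrow> u s = (\<zero>\<^bsub>F\<^esub>, \<zero>\<^bsub>A\<^esub>)"
  shows "u \<in> carrier (free_umodule F A S)"
proof -
  have "{s. u s \<noteq> (\<zero>\<^bsub>F\<^esub>, \<zero>\<^bsub>A\<^esub>)} \<subseteq> T" using assms(4) by blast
  with assms show ?thesis by (auto simp: free_umodule_simps intro: finite_subset)
qed

lemma free_umodule_carrierE:
  assumes "u \<in> carrier (free_umodule F A S)"
  obtains T where "finite T" "T \<subseteq> S" "\<And>s. s \<notin> T \<Longrightarrow> u s = (\<zero>\<^bsub>F\<^esub>, \<zero>\<^bsub>A\<^esub>)"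
    "\<And>s. fst (u s) \<in> carrier F" "\<And>s. snd (u s) \<in> carrier A"
proof (rule that[of "{s. u s \<noteq> (\<zero>\<^bsub>F\<^esub>, \<zero>\<^bsub>A\<^esub>)}"])
  have "u s \<in> carrier F \<times> carrier A" for s using assms by (simp add: free_umodule_simps)
  then show "fst (u s) \<in> carrier F" "snd (u s) \<in> carrier A" for s by (simp_all add: mem_Times_iff)
qed (use assms in \<open>auto simp: free_umodule_simps\<close>)

lemma free_umodule_closed:
  assumes u: "u \<in> carrier (free_umodule F A S)"
  shows "v \<in> carrier (free_umodule F A S) \<Longrightarrow> u \<oplus>\<^bsub>free_umodule F A S\<^esub> v \<in> carrier (free_umodule F A S)"
    and "k \<in> carrier F \<Longrightarrow> k \<odot>\<^bsub>free_umodule F A S\<^esub> u \<in> carrier (free_umodule F A S)"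
    and "a \<in> carrier A \<Longrightarrow> act (free_umodule F A S) a u \<in> carrier (free_umodule F A S)"
proof -
  obtain T where T: "finite T" "T \<subseteq> S" "\<And>s. s \<notin> T \<Longrightarrow> u s = (\<zero>\<^bsub>F\<^esub>, \<zero>\<^bsub>A\<^esub>)"
    "\<And>s. fst (u s) \<in> carrier F" "\<And>s. snd (u s) \<in> carrier A"
    using free_umodule_carrierE[OF u] by metis
  show "k \<odot>\<^bsub>free_umodule F A S\<^esub> u \<in> carrier (free_umodule F A S)" if "k \<in> carrier F"
    using T that by (intro free_umodule_carrierI[of _ T]) (auto simp: free_umodule_simps)
  show "act (free_umodule F A S) a u \<in> carrier (free_umodule F A S)" if "a \<in> carrier A"
    using T that by (intro free_umodule_carrierI[of _ T]) (auto simp: free_umodule_simps A.mult_closed)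
  show "u \<oplus>\<^bsub>free_umodule F A S\<^esub> v \<in> carrier (free_umodule F A S)" if v: "v \<in> carrier (free_umodule F A S)"
  proof -
    obtain T' where "finite T'" "T' \<subseteq> S" "\<And>s. s \<notin> T' \<Longrightarrow> v s = (\<zero>\<^bsub>F\<^esub>, \<zero>\<^bsub>A\<^esub>)"
      "\<And>s. fst (v s) \<in> carrier F" "\<And>s. snd (v s) \<in> carrier A"
      using free_umodule_carrierE[OF v] by metis
    with T show ?thesis
      by (intro free_umodule_carrierI[of _ "T \<union> T'"]) (auto simp: free_umodule_simps)
  qed
qed

lemma algebra_module_free_umodule: "algebra_module F A (free_umodule F A S)" (is "algebra_module F A ?M")
proof -
  have in_FA: "fst (u s) \<in> carrier F" "snd (u s) \<in> carrier A" if "u \<in> carrier ?M" for u s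
    using that by (auto elim: free_umodule_carrierE)
  note ops = free_umodule_simps(2-5)
  have zero: "\<zero>\<^bsub>?M\<^esub> \<in> carrier ?M" by (simp add: free_umodule_simps)
  have "abelian_group ?M"
  proof (rule abelian_groupI)
    fix u assume u: "u \<in> carrier ?M"
    have "(\<ominus>\<^bsub>F\<^esub> \<one>\<^bsub>F\<^esub>) \<odot>\<^bsub>?M\<^esub> u \<oplus>\<^bsub>?M\<^esub> u = \<zero>\<^bsub>?M\<^esub>"
      using in_FA[OF u] by (simp add: ops A.smult_l_minus A.M.l_neg F.l_minus F.l_neg)
    then show "\<exists>v\<in>carrier ?M. v \<oplus>\<^bsub>?M\<^esub> u = \<zero>\<^bsub>?M\<^esub>"
      using free_umodule_closed(2)[OF u] by (intro bexI[of _ "(\<ominus>\<^bsub>F\<^esub> \<one>\<^bsub>F\<^esub>) \<odot>\<^bsub>?M\<^esub> u"]) auto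
  qed (simp_all add: free_umodule_closed zero, simp_all add: ops in_FA F.a_ac A.M.a_ac)
  then have "module F ?M"
    by (intro moduleI F.is_cring)
      (simp_all add: free_umodule_closed, simp_all add: ops in_FA F.l_distr F.r_distr F.m_assoc
        A.smult_l_distr A.smult_r_distr A.smult_assoc1)
  then show ?thesis
    by (intro algebra_module.intro algebra_module_axioms.intro algebra_A)
      (simp_all add: free_umodule_closed, simp_all add: ops in_FA A.mult_closed A.smult_l_distr
        A.smult_r_distr A.smult_assoc1 A.smult_left_comm A.mult_add A.add_mult A.mult_smult
        A.smult_mult A.mult_assoc A.M.a_ac)
qed

lemma free_gen_closed: "s \<in> S \<Longrightarrow> free_gen F A s \<in> carrier (free_umodule F A S)"
  by (rule free_umodule_carrierI[of _ "{s}"]) (auto simp: free_gen_def)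

text \<open>Induction over a finite set containing the support, with \<open>u\<close> arbitrary:
  erasing one coordinate removes a point from the set.\<close>

lemma free_umodule_induct [consumes 1, case_names zero add smult act gen]:
  assumes "u \<in> carrier (free_umodule F A S)"
    and zero: "P \<zero>\<^bsub>free_umodule F A S\<^esub>"
    and add: "\<And>u v. \<lbrakk>u \<in> carrier (free_umodule F A S); v \<in> carrier (free_umodule F A S); P u; P v\<rbrakk> \<Longrightarrow>
      P (u \<oplus>\<^bsub>free_umodule F A S\<^esub> v)"
    and smult: "\<And>k u. \<lbrakk>k \<in> carrier F; u \<in> carrier (free_umodule F A S); P u\<rbrakk> \<Longrightarrow>
      P (k \<odot>\<^bsub>free_umodule F A S\<^esub> u)"
    and act: "\<And>a u. \<lbrakk>a \<in> carrier A; u \<in> carrier (free_umodule F A S); P u\<rbrakk> \<Longrightarrow>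
      P (act (free_umodule F A S) a u)"
    and gen: "\<And>s. s \<in> S \<Longrightarrow> P (free_gen F A s)"
  shows "P u"
proof -
  let ?M = "free_umodule F A S"
  obtain T where T: "finite T" "T \<subseteq> S" "\<And>s. s \<notin> T \<Longrightarrow> u s = (\<zero>\<^bsub>F\<^esub>, \<zero>\<^bsub>A\<^esub>)"
    "\<And>s. fst (u s) \<in> carrier F" "\<And>s. snd (u s) \<in> carrier A"
    using free_umodule_carrierE[OF assms(1)] by metis
  from T show ?thesis
  proof (induction T arbitrary: u)
    case empty
    then have "u = \<zero>\<^bsub>?M\<^esub>" by (auto simp: free_umodule_simps)
    then show ?case using zero by simp
  next
    case (insert s T)
    let ?v = "u(s := (\<zero>\<^bsub>F\<^esub>, \<zero>\<^bsub>A\<^esub>))" and ?g = "free_gen F A s"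
    have v: "P ?v" by (rule insert.IH) (use insert.prems in auto)
    have v': "?v \<in> carrier ?M"
      by (rule free_umodule_carrierI[of _ T]) (use insert.prems insert.hyps in \<open>auto simp: mem_Times_iff\<close>)
    have s: "s \<in> S" using insert.prems by simp
    note us = insert.prems(3,4)[of s] and g = free_gen_closed[OF s] gen[OF s]
    \<comment> \<open>The erased coordinate is restored in two pieces, its scalar part by
      \<open>smult\<close> and its algebra part by \<open>act\<close>; neither operation alone
      reaches both.\<close>
    let ?w = "fst (u s) \<odot>\<^bsub>?M\<^esub> ?g" and ?x = "act ?M (snd (u s)) ?g"
    have "P (?w \<oplus>\<^bsub>?M\<^esub> ?x \<oplus>\<^bsub>?M\<^esub> ?v)"
      using us g v v' by (intro add smult act free_umodule_closed)
    moreover have "?w \<oplus>\<^bsub>?M\<^esub> ?x \<oplus>\<^bsub>?M\<^esub> ?v = u"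
      using insert.prems(3,4) by (auto simp: fun_eq_iff free_umodule_simps free_gen_def prod_eq_iff)
    ultimately show ?case by simp
  qed
qed

lemma free_umodule_lift:
  fixes N :: "('f, 'a, 'n) umodule"
  assumes "algebra_module F A N" and \<delta>: "\<And>s. s \<in> S \<Longrightarrow> \<delta> s \<in> carrier N"
  shows "\<exists>h\<in>umodule_hom F A (free_umodule F A S) N. \<forall>s\<in>S. h (free_gen F A s) = \<delta> s"
proof -
  interpret N: algebra_module F A N by fact
  let ?M = "free_umodule F A S"
  interpret M: algebra_module F A ?M by (rule algebra_module_free_umodule)
  \<comment> \<open>The value forced at one coordinate: the scalar part times
    \<open>\<delta> s\<close> plus the algebra part acting on \<open>\<delta> s\<close>.\<close>
  define t where "t u s = fst (u s) \<odot>\<^bsub>N\<^esub> \<delta> s \<oplus>\<^bsub>N\<^esub> act N (snd (u s)) (\<delta> s)" for u s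
  define h where "h = (\<lambda>u\<in>carrier ?M. \<Oplus>\<^bsub>N\<^esub>s\<in>{s. u s \<noteq> (\<zero>\<^bsub>F\<^esub>, \<zero>\<^bsub>A\<^esub>)}. t u s)"
  have in_FA: "fst (u s) \<in> carrier F" "snd (u s) \<in> carrier A" if "u \<in> carrier ?M" for u s
    using that by (auto elim: free_umodule_carrierE)
  have t_closed: "t u s \<in> carrier N" if "u \<in> carrier ?M" "s \<in> S" for u s
    using in_FA[OF that(1)] that \<delta> by (simp add: t_def N.act_closed)
  have t_add: "t (u \<oplus>\<^bsub>?M\<^esub> v) s = t u s \<oplus>\<^bsub>N\<^esub> t v s"
    if "u \<in> carrier ?M" "v \<in> carrier ?M" "s \<in> S" for u v s
    using in_FA[OF that(1), of s] in_FA[OF that(2), of s] \<delta>[OF that(3)]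
    by (simp add: t_def free_umodule_simps(3) N.smult_l_distr N.act_add_left N.act_closed N.M.a_ac)
  have t_smult: "t (k \<odot>\<^bsub>?M\<^esub> u) s = k \<odot>\<^bsub>N\<^esub> t u s"
    if "k \<in> carrier F" "u \<in> carrier ?M" "s \<in> S" for k u s
    using in_FA[OF that(2), of s] \<delta>[OF that(3)] that(1)
    by (simp add: t_def free_umodule_simps(4) N.smult_assoc1 N.act_smult_left N.smult_r_distr
        N.act_closed)
  have t_act: "t (act ?M a u) s = act N a (t u s)"
    if "a \<in> carrier A" "u \<in> carrier ?M" "s \<in> S" for a u s
    using in_FA[OF that(2), of s] \<delta>[OF that(3)] that(1)
    by (simp add: t_def free_umodule_simps(5) N.act_add_left N.act_mult N.act_smult_left
        N.act_smult_right N.act_add_right N.act_closed A.mult_closed)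
  \<comment> \<open>Supports can shrink under the operations. Summing over any finite superset
    inside \<open>S\<close>, where the extra terms vanish, puts both sides of each identity over the
    same index set.\<close>
  have h_eq: "h u = (\<Oplus>\<^bsub>N\<^esub>s\<in>T. t u s)"
    if u: "u \<in> carrier ?M" and T: "finite T" "T \<subseteq> S" "\<And>s. s \<notin> T \<Longrightarrow> u s = (\<zero>\<^bsub>F\<^esub>, \<zero>\<^bsub>A\<^esub>)" for u T
  proof -
    have "(\<Oplus>\<^bsub>N\<^esub>s\<in>{s. u s \<noteq> (\<zero>\<^bsub>F\<^esub>, \<zero>\<^bsub>A\<^esub>)}. t u s) = (\<Oplus>\<^bsub>N\<^esub>s\<in>T. t u s)"
      using T u t_closed \<delta> by (intro N.M.add.finprod_mono_neutral_cong_left) (auto simp: t_def)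
    then show ?thesis using u by (simp add: h_def)
  qed
  have supp: "\<exists>T. finite T \<and> T \<subseteq> S \<and> (\<forall>s. s \<notin> T \<longrightarrow> u s = (\<zero>\<^bsub>F\<^esub>, \<zero>\<^bsub>A\<^esub>))" if "u \<in> carrier ?M" for u
    using free_umodule_carrierE[OF that] by metis
  have h_closed: "h u \<in> carrier N" if u: "u \<in> carrier ?M" for u
  proof -
    obtain T where "finite T" "T \<subseteq> S" "\<And>s. s \<notin> T \<Longrightarrow> u s = (\<zero>\<^bsub>F\<^esub>, \<zero>\<^bsub>A\<^esub>)" using supp[OF u] by blast
    then show ?thesis using h_eq[OF u] t_closed[OF u] by (auto intro!: N.M.finsum_closed)
  qed
  have h_add: "h (u \<oplus>\<^bsub>?M\<^esub> v) = h u \<oplus>\<^bsub>N\<^esub> h v" if uv: "u \<in> carrier ?M" "v \<in> carrier ?M" for u v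
  proof -
    obtain T T' where T: "finite T" "T \<subseteq> S" "\<And>s. s \<notin> T \<Longrightarrow> u s = (\<zero>\<^bsub>F\<^esub>, \<zero>\<^bsub>A\<^esub>)"
      "finite T'" "T' \<subseteq> S" "\<And>s. s \<notin> T' \<Longrightarrow> v s = (\<zero>\<^bsub>F\<^esub>, \<zero>\<^bsub>A\<^esub>)"
      using supp[OF uv(1)] supp[OF uv(2)] by blast
    let ?T = "T \<union> T'"
    have "h (u \<oplus>\<^bsub>?M\<^esub> v) = (\<Oplus>\<^bsub>N\<^esub>s\<in>?T. t (u \<oplus>\<^bsub>?M\<^esub> v) s)"
      using T M.M.a_closed[OF uv] by (intro h_eq) (auto simp: free_umodule_simps(3))
    also have "\<dots> = (\<Oplus>\<^bsub>N\<^esub>s\<in>?T. t u s \<oplus>\<^bsub>N\<^esub> t v s)"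
      using T uv t_closed by (intro N.M.finsum_cong' HOL.refl t_add) auto
    also have "\<dots> = (\<Oplus>\<^bsub>N\<^esub>s\<in>?T. t u s) \<oplus>\<^bsub>N\<^esub> (\<Oplus>\<^bsub>N\<^esub>s\<in>?T. t v s)"
      using T uv t_closed by (intro N.M.finsum_addf) auto
    also have "(\<Oplus>\<^bsub>N\<^esub>s\<in>?T. t u s) = h u"
      using T uv by (intro h_eq[symmetric]) auto
    also have "(\<Oplus>\<^bsub>N\<^esub>s\<in>?T. t v s) = h v"
      using T uv by (intro h_eq[symmetric]) auto
    finally show ?thesis .
  qed
  have h_smult: "h (k \<odot>\<^bsub>?M\<^esub> u) = k \<odot>\<^bsub>N\<^esub> h u" if k: "k \<in> carrier F" and u: "u \<in> carrier ?M" for k u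
  proof -
    obtain T where T: "finite T" "T \<subseteq> S" "\<And>s. s \<notin> T \<Longrightarrow> u s = (\<zero>\<^bsub>F\<^esub>, \<zero>\<^bsub>A\<^esub>)"
      using supp[OF u] by blast
    have "h (k \<odot>\<^bsub>?M\<^esub> u) = (\<Oplus>\<^bsub>N\<^esub>s\<in>T. t (k \<odot>\<^bsub>?M\<^esub> u) s)"
      using T k M.smult_closed[OF k u] by (intro h_eq) (auto simp: free_umodule_simps(4))
    also have "\<dots> = (\<Oplus>\<^bsub>N\<^esub>s\<in>T. k \<odot>\<^bsub>N\<^esub> t u s)"
      using T k u t_closed by (intro N.M.finsum_cong' HOL.refl t_smult) auto
    also have "\<dots> = k \<odot>\<^bsub>N\<^esub> (\<Oplus>\<^bsub>N\<^esub>s\<in>T. t u s)"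
      using T k u t_closed by (intro N.finsum_smult_ldistr[symmetric]) auto
    also have "(\<Oplus>\<^bsub>N\<^esub>s\<in>T. t u s) = h u" using T u by (intro h_eq[symmetric]) auto
    finally show ?thesis .
  qed
  have h_act: "h (act ?M a u) = act N a (h u)" if a: "a \<in> carrier A" and u: "u \<in> carrier ?M" for a u
  proof -
    obtain T where T: "finite T" "T \<subseteq> S" "\<And>s. s \<notin> T \<Longrightarrow> u s = (\<zero>\<^bsub>F\<^esub>, \<zero>\<^bsub>A\<^esub>)"
      using supp[OF u] by blast
    have "h (act ?M a u) = (\<Oplus>\<^bsub>N\<^esub>s\<in>T. t (act ?M a u) s)"
      using T a M.act_closed[OF a u] by (intro h_eq) (auto simp: free_umodule_simps(5))
    also have "\<dots> = (\<Oplus>\<^bsub>N\<^esub>s\<in>T. act N a (t u s))"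
      using T a u t_closed by (intro N.M.finsum_cong' HOL.refl t_act) (auto intro!: N.act_closed)
    also have "\<dots> = act N a (\<Oplus>\<^bsub>N\<^esub>s\<in>T. t u s)"
      using T a u t_closed by (intro N.act_finsum[symmetric]) auto
    also have "(\<Oplus>\<^bsub>N\<^esub>s\<in>T. t u s) = h u" using T u by (intro h_eq[symmetric]) auto
    finally show ?thesis .
  qed
  have "h (free_gen F A s) = \<delta> s" if s: "s \<in> S" for s
  proof -
    have "h (free_gen F A s) = (\<Oplus>\<^bsub>N\<^esub>r\<in>{s}. t (free_gen F A s) r)"
      using s free_gen_closed[OF s] by (intro h_eq) (auto simp: free_gen_def)
    also have "\<dots> = \<delta> s"
      using s \<delta> by (simp add: t_def free_gen_def)
    finally show ?thesis .
  qed
  moreover have "h \<in> umodule_hom F A ?M N"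
    unfolding umodule_hom_def PiE_def
    using h_closed h_add h_smult h_act by (auto simp: h_def)
  ultimately show ?thesis by blast
qed

end

section \<open>Derivations compatible with divided powers\<close>

text \<open>The clauses copy the defining relations of \<open>Omega_U\<close> and
  \<open>Omega1\<close>, hence the combined linearity clause and the bound \<open>n >= 2\<close>,
  which keeps \<open>n - 1\<close> a genuine exponent.\<close>

definition dp_derivation ::
  "('f, 'r) ring_scheme \<Rightarrow> ('f, 'a) dpalg \<Rightarrow> ('f, 'a, 'm) umodule \<Rightarrow> ('a \<Rightarrow> 'm) \<Rightarrow> bool" where
  "dp_derivation F A M \<delta> \<longleftrightarrow>
    (\<forall>a\<in>carrier A. \<delta> a \<in> carrier M) \<and>
    (\<forall>a\<in>carrier A. \<forall>k\<in>carrier F. \<forall>b\<in>carrier A.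
      \<delta> (a \<oplus>\<^bsub>A\<^esub> k \<odot>\<^bsub>A\<^esub> b) = \<delta> a \<oplus>\<^bsub>M\<^esub> k \<odot>\<^bsub>M\<^esub> \<delta> b) \<and>
    (\<forall>a\<in>carrier A. \<forall>b\<in>carrier A. \<delta> (a \<otimes>\<^bsub>A\<^esub> b) = act M a (\<delta> b) \<oplus>\<^bsub>M\<^esub> act M b (\<delta> a)) \<and>
    (\<forall>n\<ge>2. \<forall>a\<in>carrier A. \<delta> (dpow A n a) = act M (dpow A (n - 1) a) (\<delta> a))"

lemma dp_derivation_umodule_hom:
  assumes A: "divided_power_algebra F A" and M: "algebra_module F A M" and "algebra_module F A N"
    and h: "h \<in> umodule_hom F A M N" and \<delta>: "dp_derivation F A M \<delta>"
  shows "dp_derivation F A N (\<lambda>a. h (\<delta> a))"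
proof -
  interpret A: divided_power_algebra F A by (rule A)
  interpret M: algebra_module F A M by (rule M)
  note hom = umodule_homD[OF M assms(3) h]
  show ?thesis
    using \<delta> unfolding dp_derivation_def
    by (simp add: hom M.act_closed A.dpow_closed)
qed

context
  fixes F :: "('f, 'r) ring_scheme" and A :: "('f, 'a) dpalg"
  assumes dpa_A: "divided_power_algebra F A"
begin

interpretation A: divided_power_algebra F A by (rule dpa_A)

lemmas free_module = algebra_module_free_umodule[OF A.field_axioms A.nonunital_comm_algebra_axioms]
lemmas free_gen_in = free_gen_closed[OF A.field_axioms A.nonunital_comm_algebra_axioms]
lemmas free_lift = free_umodule_lift[OF A.field_axioms A.nonunital_comm_algebra_axioms]
lemmas free_induct [consumes 1, case_names zero add smult act gen] =
  free_umodule_induct[OF A.field_axioms A.nonunital_comm_algebra_axioms]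

abbreviation "Omega_free \<equiv> free_umodule F A (carrier A)"

interpretation free: algebra_module F A Omega_free by (rule free_module)

lemma Omega_U_rels_carrier: "Omega_U_rels F A \<subseteq> carrier Omega_free"
  by (auto simp: Omega_U_rels_def Let_def free_gen_in A.mult_closed
      intro!: free.M.minus_closed free.act_closed free.M.a_closed free.smult_closed)

lemma usubmodule_Omega_U: "usubmodule F A Omega_free (Omega_U_submodule F A)"
  unfolding Omega_U_submodule_def by (rule usubmodule_span[OF free_module Omega_U_rels_carrier])

lemma algebra_module_Omega_U: "algebra_module F A (Omega_U F A)"
  unfolding Omega_U_def by (rule algebra_module_quot_umodule[OF free_module usubmodule_Omega_U])

lemmas quot_simps_U = quot_umodule_simps[OF free_module usubmodule_Omega_U, folded Omega_U_def]

interpretation U: algebra_module F A "Omega_U F A" by (rule algebra_module_Omega_U)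

lemma d_U_closed: "a \<in> carrier A \<Longrightarrow> d_U F A a \<in> carrier (Omega_U F A)"
  by (simp add: d_U_def quot_simps_U free_gen_in)

lemma d_U_eqI:
  assumes "x \<in> carrier Omega_free" "y \<in> carrier Omega_free" "x \<ominus>\<^bsub>Omega_free\<^esub> y \<in> Omega_U_rels F A"
  shows "Omega_U_submodule F A +>\<^bsub>Omega_free\<^esub> x = Omega_U_submodule F A +>\<^bsub>Omega_free\<^esub> y"
  using coset_eq_iff[OF free_module usubmodule_Omega_U assms(1,2)] assms(3)
    umodule_span_superset[OF free_module, of "Omega_U_rels F A"]
  by (auto simp: Omega_U_submodule_def)

lemma d_U_linear:
  assumes "a \<in> carrier A" "k \<in> carrier F" "b \<in> carrier A"
  shows "d_U F A (a \<oplus>\<^bsub>A\<^esub> k \<odot>\<^bsub>A\<^esub> b) = d_U F A a \<oplus>\<^bsub>Omega_U F A\<^esub> k \<odot>\<^bsub>Omega_U F A\<^esub> d_U F A b"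
proof -
  let ?\<delta> = "free_gen F A"
  have "?\<delta> (a \<oplus>\<^bsub>A\<^esub> k \<odot>\<^bsub>A\<^esub> b) \<ominus>\<^bsub>Omega_free\<^esub> (?\<delta> a \<oplus>\<^bsub>Omega_free\<^esub> k \<odot>\<^bsub>Omega_free\<^esub> ?\<delta> b) \<in> Omega_U_rels F A"
    using assms unfolding Omega_U_rels_def Let_def by blast
  then have "d_U F A (a \<oplus>\<^bsub>A\<^esub> k \<odot>\<^bsub>A\<^esub> b) =
      Omega_U_submodule F A +>\<^bsub>Omega_free\<^esub> (?\<delta> a \<oplus>\<^bsub>Omega_free\<^esub> k \<odot>\<^bsub>Omega_free\<^esub> ?\<delta> b)"
    unfolding d_U_def using assms by (intro d_U_eqI) (auto simp: free_gen_in)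
  also have "\<dots> = d_U F A a \<oplus>\<^bsub>Omega_U F A\<^esub> k \<odot>\<^bsub>Omega_U F A\<^esub> d_U F A b"
    using assms by (simp add: d_U_def quot_simps_U free_gen_in)
  finally show ?thesis .
qed

lemma d_U_mult:
  assumes "a \<in> carrier A" "b \<in> carrier A"
  shows "d_U F A (a \<otimes>\<^bsub>A\<^esub> b) =
    act (Omega_U F A) a (d_U F A b) \<oplus>\<^bsub>Omega_U F A\<^esub> act (Omega_U F A) b (d_U F A a)"
proof -
  let ?\<delta> = "free_gen F A"
  have "?\<delta> (a \<otimes>\<^bsub>A\<^esub> b) \<ominus>\<^bsub>Omega_free\<^esub> (act Omega_free a (?\<delta> b) \<oplus>\<^bsub>Omega_free\<^esub> act Omega_free b (?\<delta> a)) \<in> Omega_U_rels F A"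
    using assms unfolding Omega_U_rels_def Let_def by blast
  then have "d_U F A (a \<otimes>\<^bsub>A\<^esub> b) =
      Omega_U_submodule F A +>\<^bsub>Omega_free\<^esub> (act Omega_free a (?\<delta> b) \<oplus>\<^bsub>Omega_free\<^esub> act Omega_free b (?\<delta> a))"
    unfolding d_U_def using assms
    by (intro d_U_eqI) (auto simp: free_gen_in A.mult_closed free.act_closed)
  also have "\<dots> = act (Omega_U F A) a (d_U F A b) \<oplus>\<^bsub>Omega_U F A\<^esub> act (Omega_U F A) b (d_U F A a)"
    using assms by (simp add: d_U_def quot_simps_U free_gen_in free.act_closed)
  finally show ?thesis .
qed

abbreviation "Omega1_rels \<equiv>
  {d_U F A (dpow A n a) \<ominus>\<^bsub>Omega_U F A\<^esub> act (Omega_U F A) (dpow A (n - 1) a) (d_U F A a) |n a.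
    n \<ge> 2 \<and> a \<in> carrier A}"

lemma Omega1_rels_carrier: "Omega1_rels \<subseteq> carrier (Omega_U F A)"
  by (auto intro!: U.M.minus_closed U.act_closed d_U_closed A.dpow_closed)

lemma usubmodule_Omega1: "usubmodule F A (Omega_U F A) (Omega1_submodule F A)"
  unfolding Omega1_submodule_def
  by (rule usubmodule_span[OF algebra_module_Omega_U Omega1_rels_carrier])

lemma algebra_module_Omega1: "algebra_module F A (Omega1 F A)"
  unfolding Omega1_def by (rule algebra_module_quot_umodule[OF algebra_module_Omega_U usubmodule_Omega1])

lemmas quot_simps_1 = quot_umodule_simps[OF algebra_module_Omega_U usubmodule_Omega1, folded Omega1_def]

lemma d_Omega1_dpow:
  assumes "n \<ge> 2" "a \<in> carrier A"
  shows "d_Omega1 F A (dpow A n a) = act (Omega1 F A) (dpow A (n - 1) a) (d_Omega1 F A a)"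
proof -
  let ?x = "d_U F A (dpow A n a)" and ?y = "act (Omega_U F A) (dpow A (n - 1) a) (d_U F A a)"
  have closed: "dpow A (n - 1) a \<in> carrier A" "dpow A n a \<in> carrier A"
    using assms by (auto intro: A.dpow_closed)
  then have xy: "?x \<in> carrier (Omega_U F A)" "?y \<in> carrier (Omega_U F A)"
    using assms by (auto intro!: U.act_closed d_U_closed)
  have "?x \<ominus>\<^bsub>Omega_U F A\<^esub> ?y \<in> Omega1_submodule F A"
    using umodule_span_superset[OF algebra_module_Omega_U, of Omega1_rels] assms
    unfolding Omega1_submodule_def by blast
  then have "d_Omega1 F A (dpow A n a) = Omega1_submodule F A +>\<^bsub>Omega_U F A\<^esub> ?y"
    using coset_eq_iff[OF algebra_module_Omega_U usubmodule_Omega1 xy] by (simp add: d_Omega1_def)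
  then show ?thesis using closed assms by (simp add: d_Omega1_def quot_simps_1 d_U_closed)
qed

text \<open>Linearity and the Leibniz rule hold in \<open>Omega_U\<close> and descend to its
  quotient; compatibility with divided powers is what the second quotient imposes.\<close>

lemma dp_derivation_Omega1: "dp_derivation F A (Omega1 F A) (d_Omega1 F A)"
  unfolding dp_derivation_def
  by (auto simp: d_Omega1_dpow)
    (auto simp: d_Omega1_def quot_simps_1 d_U_linear d_U_mult d_U_closed U.act_closed)

lemma Omega_U_induct:
  assumes "X \<in> carrier (Omega_U F A)"
    and zero: "P \<zero>\<^bsub>Omega_U F A\<^esub>"
    and add: "\<And>X Y. \<lbrakk>X \<in> carrier (Omega_U F A); Y \<in> carrier (Omega_U F A); P X; P Y\<rbrakk> \<Longrightarrow>
      P (X \<oplus>\<^bsub>Omega_U F A\<^esub> Y)"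
    and smult: "\<And>k X. \<lbrakk>k \<in> carrier F; X \<in> carrier (Omega_U F A); P X\<rbrakk> \<Longrightarrow> P (k \<odot>\<^bsub>Omega_U F A\<^esub> X)"
    and act: "\<And>a X. \<lbrakk>a \<in> carrier A; X \<in> carrier (Omega_U F A); P X\<rbrakk> \<Longrightarrow> P (act (Omega_U F A) a X)"
    and gen: "\<And>a. a \<in> carrier A \<Longrightarrow> P (d_U F A a)"
  shows "P X"
proof -
  obtain u where u: "u \<in> carrier Omega_free" "X = Omega_U_submodule F A +>\<^bsub>Omega_free\<^esub> u"
    using assms(1) by (auto simp: quot_simps_U)
  have "P (Omega_U_submodule F A +>\<^bsub>Omega_free\<^esub> u)"
    using u(1)
  proof (induction u rule: free_induct)
    case zero
    then show ?case using assms(2) by (simp add: quot_simps_U)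
  next
    case (add u v)
    then show ?case using assms(3)[OF _ _ add(3,4)] by (simp add: quot_simps_U)
  next
    case (smult k u)
    then show ?case using assms(4)[OF _ _ smult(3)] by (simp add: quot_simps_U)
  next
    case (act a u)
    then show ?case using assms(5)[OF _ _ act(3)] by (simp add: quot_simps_U)
  next
    case (gen a)
    then show ?case using assms(6) by (simp add: d_U_def)
  qed
  with u show ?thesis by simp
qed

text \<open>The differentials generate the module: induction on the free module is carried through
  both quotients. This gives the uniqueness of maps out of \<open>Omega1\<close>.\<close>

lemma Omega1_induct [consumes 1, case_names zero add smult act gen]:
  assumes "X \<in> carrier (Omega1 F A)"
    and zero: "P \<zero>\<^bsub>Omega1 F A\<^esub>"
    and add: "\<And>X Y. \<lbrakk>X \<in> carrier (Omega1 F A); Y \<in> carrier (Omega1 F A); P X; P Y\<rbrakk> \<Longrightarrow>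
      P (X \<oplus>\<^bsub>Omega1 F A\<^esub> Y)"
    and smult: "\<And>k X. \<lbrakk>k \<in> carrier F; X \<in> carrier (Omega1 F A); P X\<rbrakk> \<Longrightarrow> P (k \<odot>\<^bsub>Omega1 F A\<^esub> X)"
    and act: "\<And>a X. \<lbrakk>a \<in> carrier A; X \<in> carrier (Omega1 F A); P X\<rbrakk> \<Longrightarrow> P (act (Omega1 F A) a X)"
    and gen: "\<And>a. a \<in> carrier A \<Longrightarrow> P (d_Omega1 F A a)"
  shows "P X"
proof -
  obtain Y where Y: "Y \<in> carrier (Omega_U F A)" "X = Omega1_submodule F A +>\<^bsub>Omega_U F A\<^esub> Y"
    using assms(1) by (auto simp: quot_simps_1)
  have "P (Omega1_submodule F A +>\<^bsub>Omega_U F A\<^esub> Y)"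
  proof (rule Omega_U_induct[OF Y(1)])
    show "P (Omega1_submodule F A +>\<^bsub>Omega_U F A\<^esub> \<zero>\<^bsub>Omega_U F A\<^esub>)"
      using zero by (simp add: quot_simps_1)
  next
    fix X Y assume "X \<in> carrier (Omega_U F A)" "Y \<in> carrier (Omega_U F A)"
      and P: "P (Omega1_submodule F A +>\<^bsub>Omega_U F A\<^esub> X)" "P (Omega1_submodule F A +>\<^bsub>Omega_U F A\<^esub> Y)"
    then show "P (Omega1_submodule F A +>\<^bsub>Omega_U F A\<^esub> (X \<oplus>\<^bsub>Omega_U F A\<^esub> Y))"
      using add[OF _ _ P] by (simp add: quot_simps_1)
  next
    fix k X assume "k \<in> carrier F" "X \<in> carrier (Omega_U F A)"
      and P: "P (Omega1_submodule F A +>\<^bsub>Omega_U F A\<^esub> X)"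
    then show "P (Omega1_submodule F A +>\<^bsub>Omega_U F A\<^esub> (k \<odot>\<^bsub>Omega_U F A\<^esub> X))"
      using smult[OF _ _ P] by (simp add: quot_simps_1)
  next
    fix a X assume "a \<in> carrier A" "X \<in> carrier (Omega_U F A)"
      and P: "P (Omega1_submodule F A +>\<^bsub>Omega_U F A\<^esub> X)"
    then show "P (Omega1_submodule F A +>\<^bsub>Omega_U F A\<^esub> act (Omega_U F A) a X)"
      using act[OF _ _ P] by (simp add: quot_simps_1)
  next
    fix a assume "a \<in> carrier A"
    then show "P (Omega1_submodule F A +>\<^bsub>Omega_U F A\<^esub> d_U F A a)"
      using gen by (simp add: d_Omega1_def)
  qed
  with Y show ?thesis by simp
qed

text \<open>The clauses of \<open>dp_derivation\<close> say that the defining relations are killed,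
  so the map given on free generators passes through the two quotients in turn.\<close>

lemma Omega1_lift:
  fixes N :: "('f, 'a, 'n) umodule"
  assumes N: "algebra_module F A N" and \<delta>: "dp_derivation F A N \<delta>"
  shows "\<exists>h\<in>umodule_hom F A (Omega1 F A) N. \<forall>a\<in>carrier A. h (d_Omega1 F A a) = \<delta> a"
proof -
  interpret N: algebra_module F A N by (rule N)
  note \<delta>' = \<delta>[unfolded dp_derivation_def]
  have minus_self: "y \<ominus>\<^bsub>N\<^esub> y = \<zero>\<^bsub>N\<^esub>" if "y \<in> carrier N" for y
    using that by (simp add: a_minus_def N.M.r_neg)
  have "\<exists>h0\<in>umodule_hom F A Omega_free N. \<forall>a\<in>carrier A. h0 (free_gen F A a) = \<delta> a"
    using \<delta>' by (intro free_lift[OF N]) blast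
  then obtain h0 where h0: "h0 \<in> umodule_hom F A Omega_free N"
    "\<And>a. a \<in> carrier A \<Longrightarrow> h0 (free_gen F A a) = \<delta> a" by blast
  note hom0 = umodule_homD[OF free_module N h0(1)]
  have "h0 x = \<zero>\<^bsub>N\<^esub>" if "x \<in> Omega_U_rels F A" for x
    using that \<delta>'
    by (auto simp: Omega_U_rels_def Let_def hom0 h0(2) free_gen_in free.act_closed A.mult_closed
        minus_self N.act_closed)
  then have "h0 x = \<zero>\<^bsub>N\<^esub>" if "x \<in> Omega_U_submodule F A" for x
    using umodule_span_subset_kernel[OF free_module N h0(1) Omega_U_rels_carrier] that
    by (simp add: Omega_U_submodule_def)
  then obtain h1 where h1: "h1 \<in> umodule_hom F A (Omega_U F A) N"
    "\<And>x. x \<in> carrier Omega_free \<Longrightarrow> h1 (Omega_U_submodule F A +>\<^bsub>Omega_free\<^esub> x) = h0 x"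
    using quot_umodule_lift[OF free_module N h0(1) usubmodule_Omega_U] by (auto simp: Omega_U_def)
  note hom1 = umodule_homD[OF algebra_module_Omega_U N h1(1)]
  have d1: "h1 (d_U F A a) = \<delta> a" if "a \<in> carrier A" for a
    using that by (simp add: d_U_def h1(2) free_gen_in h0(2))
  have "h1 x = \<zero>\<^bsub>N\<^esub>" if x: "x \<in> Omega1_rels" for x
  proof -
    obtain n a where na: "x = d_U F A (dpow A n a) \<ominus>\<^bsub>Omega_U F A\<^esub>
        act (Omega_U F A) (dpow A (n - 1) a) (d_U F A a)" "n \<ge> 2" "a \<in> carrier A"
      using x by blast
    then have "dpow A n a \<in> carrier A" "dpow A (n - 1) a \<in> carrier A"
      by (auto intro: A.dpow_closed)
    then show ?thesis
      using na \<delta>'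
      by (simp add: hom1 d1 d_U_closed U.act_closed minus_self N.act_closed)
  qed
  then have "h1 x = \<zero>\<^bsub>N\<^esub>" if "x \<in> Omega1_submodule F A" for x
    using umodule_span_subset_kernel[OF algebra_module_Omega_U N h1(1) Omega1_rels_carrier] that
    unfolding Omega1_submodule_def by blast
  then obtain h where "h \<in> umodule_hom F A (Omega1 F A) N"
    "\<And>x. x \<in> carrier (Omega_U F A) \<Longrightarrow> h (Omega1_submodule F A +>\<^bsub>Omega_U F A\<^esub> x) = h1 x"
    using quot_umodule_lift[OF algebra_module_Omega_U N h1(1) usubmodule_Omega1] by (auto simp: Omega1_def)
  then show ?thesis using d1 d_U_closed by (intro bexI[of _ h]) (auto simp: d_Omega1_def)
qed

lemma Omega1_hom_unique:
  fixes N :: "('f, 'a, 'n) umodule"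
  assumes N: "algebra_module F A N"
    and h: "h \<in> umodule_hom F A (Omega1 F A) N" and g: "g \<in> umodule_hom F A (Omega1 F A) N"
    and eq: "\<And>a. a \<in> carrier A \<Longrightarrow> h (d_Omega1 F A a) = g (d_Omega1 F A a)"
    and "x \<in> carrier (Omega1 F A)"
  shows "h x = g x"
  using \<open>x \<in> carrier (Omega1 F A)\<close>
proof (induction x rule: Omega1_induct)
qed (simp_all add: eq umodule_homD[OF algebra_module_Omega1 N h] umodule_homD[OF algebra_module_Omega1 N g])

end

section \<open>The category of divided power algebras\<close>

lemma Gamma_homD:
  assumes "f \<in> Gamma_hom F A B"
  shows "a \<in> carrier A \<Longrightarrow> f a \<in> carrier B"
    and "\<lbrakk>a \<in> carrier A; b \<in> carrier A\<rbrakk> \<Longrightarrow> f (a \<oplus>\<^bsub>A\<^esub> b) = f a \<oplus>\<^bsub>B\<^esub> f b"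
    and "\<lbrakk>k \<in> carrier F; a \<in> carrier A\<rbrakk> \<Longrightarrow> f (k \<odot>\<^bsub>A\<^esub> a) = k \<odot>\<^bsub>B\<^esub> f a"
    and "\<lbrakk>a \<in> carrier A; b \<in> carrier A\<rbrakk> \<Longrightarrow> f (a \<otimes>\<^bsub>A\<^esub> b) = f a \<otimes>\<^bsub>B\<^esub> f b"
    and "\<lbrakk>n \<ge> 1; a \<in> carrier A\<rbrakk> \<Longrightarrow> f (dpow A n a) = dpow B n (f a)"
    and "f \<in> extensional (carrier A)"
  using assms by (auto simp: Gamma_hom_def PiE_def)

lemma Gamma_homI:
  assumes "f \<in> extensional (carrier A)" "\<And>a. a \<in> carrier A \<Longrightarrow> f a \<in> carrier B"
    "\<And>a b. \<lbrakk>a \<in> carrier A; b \<in> carrier A\<rbrakk> \<Longrightarrow> f (a \<oplus>\<^bsub>A\<^esub> b) = f a \<oplus>\<^bsub>B\<^esub> f b"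
    "\<And>k a. \<lbrakk>k \<in> carrier F; a \<in> carrier A\<rbrakk> \<Longrightarrow> f (k \<odot>\<^bsub>A\<^esub> a) = k \<odot>\<^bsub>B\<^esub> f a"
    "\<And>a b. \<lbrakk>a \<in> carrier A; b \<in> carrier A\<rbrakk> \<Longrightarrow> f (a \<otimes>\<^bsub>A\<^esub> b) = f a \<otimes>\<^bsub>B\<^esub> f b"
    "\<And>n a. \<lbrakk>n \<ge> 1; a \<in> carrier A\<rbrakk> \<Longrightarrow> f (dpow A n a) = dpow B n (f a)"
  shows "f \<in> Gamma_hom F A B"
  using assms by (auto simp: Gamma_hom_def PiE_def)

lemma Gamma_hom_id:
  assumes "divided_power_algebra F A"
  shows "(\<lambda>a\<in>carrier A. a) \<in> Gamma_hom F A A"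
proof -
  interpret divided_power_algebra F A by fact
  show ?thesis by (rule Gamma_homI) (auto simp: mult_closed dpow_closed)
qed

lemma Gamma_hom_compose:
  assumes "divided_power_algebra F A" and f: "f \<in> Gamma_hom F A B" and g: "g \<in> Gamma_hom F B C"
  shows "compose (carrier A) g f \<in> Gamma_hom F A C"
proof -
  interpret divided_power_algebra F A by fact
  show ?thesis
    by (rule Gamma_homI)
      (simp_all add: compose_eq Gamma_homD[OF f] Gamma_homD[OF g] mult_closed dpow_closed)
qed

section \<open>The functor T on morphisms, and morphisms into T(B)\<close>

text \<open>In characteristic \<open>p\<close> this is \<open>T_obj F p A\<close> by
  \<open>T_dpow_eq_T_powers\<close>, but it makes sense over every field, and the adjunction is
  proved in this form.\<close>

abbreviation T_alg :: "('f, 'a) dpalg \<Rightarrow> ('f, 'a \<times> 'a) dpalg" where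
  "T_alg A \<equiv> with_dpow (T_module A) (T_powers A)"

lemma T_map_apply: "\<lbrakk>a \<in> carrier A; b \<in> carrier A\<rbrakk> \<Longrightarrow> T_map A f (a, b) = (f a, f b)"
  by (simp add: T_map_def)

lemma T_map_id: "T_map A (\<lambda>x\<in>carrier A. x) = (\<lambda>x\<in>carrier (T_alg A). x)"
  by (auto simp: T_map_def T_module_simps restrict_def fun_eq_iff)

lemma T_map_compose:
  assumes "\<And>a. a \<in> carrier A \<Longrightarrow> f a \<in> carrier B"
  shows "T_map A (compose (carrier A) g f) = compose (carrier (T_alg A)) (T_map B g) (T_map A f)"
  using assms by (auto simp: T_map_def T_module_simps restrict_def fun_eq_iff compose_def)

text \<open>A morphism commutes with \<open>dact\<close>, so the explicit formula gives
  compatibility with all divided powers at once.\<close>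

lemma T_map_hom:
  fixes A :: "('f, 'a) dpalg" and B :: "('f, 'b) dpalg"
  assumes "divided_power_algebra F A" and f: "f \<in> Gamma_hom F A B"
  shows "T_map A f \<in> Gamma_hom F (T_alg A) (T_alg B)"
proof -
  interpret A: divided_power_algebra F A by fact
  note f = Gamma_homD[OF f]
  have dact: "f (dact A n a b) = dact B n (f a) (f b)" if "a \<in> carrier A" "b \<in> carrier A" for n a b
    using that by (simp add: dact_def f A.dpow_closed)
  show ?thesis
    by (rule Gamma_homI)
      (auto simp: T_module_simps T_map_apply f A.mult_closed A.dpow_closed T_powers_apply dact,
        auto simp: T_map_def)
qed

lemma algebra_module_restrict_umodule:
  fixes A :: "('f, 'a) dpalg" and B :: "('f, 'b) dpalg"
  assumes "divided_power_algebra F A" "divided_power_algebra F B" and f: "f \<in> Gamma_hom F A B"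
  shows "algebra_module F A (restrict_umodule B f)"
proof -
  interpret A: divided_power_algebra F A by fact
  interpret B: divided_power_algebra F B by fact
  note f = Gamma_homD[OF f]
  have "abelian_group (restrict_umodule B f)"
    by (rule abelian_groupI)
      (auto simp: restrict_umodule_def B.M.a_ac intro: B.M.l_neg exI[of _ "\<ominus>\<^bsub>B\<^esub> _"])
  then have "module F (restrict_umodule B f)"
    by (intro moduleI A.is_cring)
      (auto simp: restrict_umodule_def B.smult_l_distr B.smult_r_distr B.smult_assoc1)
  then show ?thesis
    by (intro algebra_module.intro algebra_module_axioms.intro A.nonunital_comm_algebra_axioms)
      (auto simp: restrict_umodule_def f B.mult_closed B.add_mult B.mult_add B.smult_mult
        B.mult_smult B.mult_assoc)
qed

text \<open>Compare coordinates: the first ones say that \<open>f\<close> is a morphism; in the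
  second ones the twisted product is the Leibniz rule along \<open>f\<close>, and the powers give
  \<open>\<delta>(a[n]) = f(a)[n-1] \<delta>(a)\<close>.\<close>

lemma Gamma_hom_T_alg_iff:
  fixes A :: "('f, 'a) dpalg" and B :: "('f, 'b) dpalg"
  assumes "divided_power_algebra F A" "divided_power_algebra F B"
    and f: "f \<in> extensional (carrier A)"
  shows "(\<lambda>a\<in>carrier A. (f a, \<delta> a)) \<in> Gamma_hom F A (T_alg B) \<longleftrightarrow>
    f \<in> Gamma_hom F A B \<and> dp_derivation F A (restrict_umodule B f) \<delta>"
    (is "?u \<in> _ \<longleftrightarrow> _")
proof
  interpret A: divided_power_algebra F A by fact
  interpret B: divided_power_algebra F B by fact
  {
    assume u: "?u \<in> Gamma_hom F A (T_alg B)"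
    note u' = Gamma_homD[OF u]
    have closed: "f a \<in> carrier B" "\<delta> a \<in> carrier B" if "a \<in> carrier A" for a
      using u'(1)[OF that] that by (auto simp: T_module_simps)
    have add: "f (a \<oplus>\<^bsub>A\<^esub> b) = f a \<oplus>\<^bsub>B\<^esub> f b" "\<delta> (a \<oplus>\<^bsub>A\<^esub> b) = \<delta> a \<oplus>\<^bsub>B\<^esub> \<delta> b"
      if "a \<in> carrier A" "b \<in> carrier A" for a b
      using u'(2)[OF that] that by (auto simp: T_module_simps)
    have smult: "f (k \<odot>\<^bsub>A\<^esub> a) = k \<odot>\<^bsub>B\<^esub> f a" "\<delta> (k \<odot>\<^bsub>A\<^esub> a) = k \<odot>\<^bsub>B\<^esub> \<delta> a"
      if "k \<in> carrier F" "a \<in> carrier A" for k a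
      using u'(3)[OF that] that by (auto simp: T_module_simps)
    have mult: "f (a \<otimes>\<^bsub>A\<^esub> b) = f a \<otimes>\<^bsub>B\<^esub> f b"
      "\<delta> (a \<otimes>\<^bsub>A\<^esub> b) = f a \<otimes>\<^bsub>B\<^esub> \<delta> b \<oplus>\<^bsub>B\<^esub> f b \<otimes>\<^bsub>B\<^esub> \<delta> a"
      if "a \<in> carrier A" "b \<in> carrier A" for a b
      using u'(4)[OF that] that by (auto simp: T_module_simps A.mult_closed)
    have dpow: "f (dpow A n a) = dpow B n (f a)" "\<delta> (dpow A n a) = dact B (n - 1) (f a) (\<delta> a)"
      if "n \<ge> 1" "a \<in> carrier A" for n a
      using u'(5)[OF that] that closed by (auto simp: T_powers_apply A.dpow_closed)
    have "f \<in> Gamma_hom F A B"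
      using f closed add smult mult dpow by (intro Gamma_homI) auto
    moreover have "dp_derivation F A (restrict_umodule B f) \<delta>"
      unfolding dp_derivation_def
      by (auto simp: restrict_umodule_def closed add smult mult dpow dact_def)
    ultimately show "f \<in> Gamma_hom F A B \<and> dp_derivation F A (restrict_umodule B f) \<delta>" ..
  }
  assume *: "f \<in> Gamma_hom F A B \<and> dp_derivation F A (restrict_umodule B f) \<delta>"
  then have "f \<in> Gamma_hom F A B" ..
  note f = Gamma_homD[OF this]
  have \<delta>: "\<delta> a \<in> carrier B" if "a \<in> carrier A" for a
    using * that by (simp add: dp_derivation_def restrict_umodule_def)
  have linear: "\<delta> (a \<oplus>\<^bsub>A\<^esub> k \<odot>\<^bsub>A\<^esub> b) = \<delta> a \<oplus>\<^bsub>B\<^esub> k \<odot>\<^bsub>B\<^esub> \<delta> b"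
    if "a \<in> carrier A" "k \<in> carrier F" "b \<in> carrier A" for a k b
    using * that by (simp add: dp_derivation_def restrict_umodule_def)
  have mult: "\<delta> (a \<otimes>\<^bsub>A\<^esub> b) = f a \<otimes>\<^bsub>B\<^esub> \<delta> b \<oplus>\<^bsub>B\<^esub> f b \<otimes>\<^bsub>B\<^esub> \<delta> a"
    if "a \<in> carrier A" "b \<in> carrier A" for a b
    using * that by (simp add: dp_derivation_def restrict_umodule_def)
  \<comment> \<open>At \<open>n = 1\<close>, outside the range of \<open>dp_derivation\<close>, both
    sides are \<open>\<delta> a\<close>.\<close>
  have dpow: "\<delta> (dpow A n a) = dact B (n - 1) (f a) (\<delta> a)" if n: "n \<ge> 1" and a: "a \<in> carrier A" for n a
  proof (cases "n = 1")
    case True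
    then show ?thesis using A.dpow_one[OF a] by (simp add: dact_def)
  next
    case False
    then have "n \<ge> 2" "n - 1 \<ge> 1" using n by auto
    then show ?thesis
      using * a f(5)[of "n - 1" a] by (simp add: dp_derivation_def restrict_umodule_def dact_def)
  qed
  \<comment> \<open>The Leibniz rule at \<open>0 = 0 * 0\<close> gives this. It is what extracts
    homogeneity from the combined linearity clause, by putting the first summand to zero.\<close>
  have zero: "\<delta> \<zero>\<^bsub>A\<^esub> = \<zero>\<^bsub>B\<^esub>"
    using mult[of "\<zero>\<^bsub>A\<^esub>" "\<zero>\<^bsub>A\<^esub>"] \<delta>[of "\<zero>\<^bsub>A\<^esub>"] f(3)[of "\<zero>\<^bsub>F\<^esub>" "\<zero>\<^bsub>A\<^esub>"] f(1)[of "\<zero>\<^bsub>A\<^esub>"] by simp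
  show "?u \<in> Gamma_hom F A (T_alg B)"
  proof (rule Gamma_homI)
    fix a b assume "a \<in> carrier A" "b \<in> carrier A"
    then show "?u (a \<oplus>\<^bsub>A\<^esub> b) = ?u a \<oplus>\<^bsub>T_alg B\<^esub> ?u b"
      using linear[of a "\<one>\<^bsub>F\<^esub>" b] by (simp add: T_module_simps f \<delta>)
  next
    fix k a assume "k \<in> carrier F" "a \<in> carrier A"
    then show "?u (k \<odot>\<^bsub>A\<^esub> a) = k \<odot>\<^bsub>T_alg B\<^esub> ?u a"
      using linear[of "\<zero>\<^bsub>A\<^esub>" k a] by (simp add: T_module_simps f \<delta> zero)
  qed (auto simp: T_module_simps f \<delta> mult dpow T_powers_apply A.mult_closed A.dpow_closed)
qed

section \<open>The adjunction\<close>

context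
  fixes F :: "('f, 'r) ring_scheme" and A :: "('f, 'a) dpalg"
  assumes dpa_A: "divided_power_algebra F A"
begin

interpretation A: divided_power_algebra F A by (rule dpa_A)
interpretation \<Omega>: algebra_module F A "Omega1 F A" by (rule algebra_module_Omega1[OF dpa_A])
interpretation G: Gamma_plus_setup F A "Omega1 F A" by unfold_locales

lemma divided_power_algebra_T_circ: "divided_power_algebra F (T_circ F A)"
  unfolding T_circ_def by (rule G.Gamma_plus_divided_power_algebra)

interpretation T: divided_power_algebra F "T_circ F A" by (rule divided_power_algebra_T_circ)

lemma T_circ_alg_hom: "T_circ_alg F A \<in> Gamma_hom F A (T_circ F A)"
  unfolding T_circ_def T_circ_alg_def by (rule G.Gamma_plus_alg_hom)

text \<open>The universal derivation into \<open>Omega1\<close>, pushed forward along the module map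
  that includes the generators.\<close>

lemma T_circ_d_derivation:
  "dp_derivation F A (restrict_umodule (T_circ F A) (T_circ_alg F A)) (T_circ_d F A)"
  unfolding T_circ_d_def[abs_def]
  by (rule dp_derivation_umodule_hom[OF dpa_A algebra_module_Omega1[OF dpa_A]
      algebra_module_restrict_umodule[OF dpa_A divided_power_algebra_T_circ T_circ_alg_hom]
      _ dp_derivation_Omega1[OF dpa_A]])
    (use G.Gamma_plus_gen_hom in \<open>simp add: T_circ_def T_circ_alg_def\<close>)

lemma T_circ_closed:
  assumes "a \<in> carrier A"
  shows "T_circ_alg F A a \<in> carrier (T_circ F A)" "T_circ_d F A a \<in> carrier (T_circ F A)"
  using Gamma_homD(1)[OF T_circ_alg_hom assms] T_circ_d_derivation assms
  by (auto simp: dp_derivation_def restrict_umodule_def)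

text \<open>Existence composes the two universal properties. For uniqueness,
  \<open>Gamma_plus_universal\<close> asks for agreement on all of \<open>Omega1\<close>, whereas
  here it is known only on differentials; the fact \<open>gen\<close> bridges this.\<close>

lemma T_circ_universal:
  fixes B :: "('f, 'b) dpalg"
  assumes B: "divided_power_algebra F B" and f: "f \<in> Gamma_hom F A B"
    and \<delta>: "dp_derivation F A (restrict_umodule B f) \<delta>"
  shows "\<exists>!h. h \<in> Gamma_hom F (T_circ F A) B \<and>
    (\<forall>a\<in>carrier A. h (T_circ_alg F A a) = f a \<and> h (T_circ_d F A a) = \<delta> a)"
proof -
  let ?G = "T_circ F A" and ?i = "T_circ_alg F A" and ?M = "Omega1 F A"
  let ?j = "Gamma_plus_gen F A ?M"
  interpret B: divided_power_algebra F B by (rule B)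
  note N = algebra_module_restrict_umodule[OF dpa_A B f]
  obtain g where g: "g \<in> umodule_hom F A ?M (restrict_umodule B f)"
    "\<And>a. a \<in> carrier A \<Longrightarrow> g (d_Omega1 F A a) = \<delta> a"
    using Omega1_lift[OF dpa_A N \<delta>] by blast
  have d_in: "d_Omega1 F A a \<in> carrier ?M" if "a \<in> carrier A" for a
    using dp_derivation_Omega1[OF dpa_A] that by (simp add: dp_derivation_def)
  have ex1: "\<exists>!h. h \<in> Gamma_hom F ?G B \<and> (\<forall>a\<in>carrier A. h (?i a) = f a) \<and>
      (\<forall>x\<in>carrier ?M. h (?j x) = g x)"
    using G.Gamma_plus_universal[OF B f g(1)] by (simp add: T_circ_def T_circ_alg_def)
  \<comment> \<open>Following the inclusion of generators by \<open>h\<close> gives a module map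
    into \<open>B\<close> along \<open>f\<close>, and such maps are determined by their values on
    differentials.\<close>
  have gen: "h (?j x) = g x"
    if h: "h \<in> Gamma_hom F ?G B" "\<And>a. a \<in> carrier A \<Longrightarrow> h (?i a) = f a"
      "\<And>a. a \<in> carrier A \<Longrightarrow> h (T_circ_d F A a) = \<delta> a" and x: "x \<in> carrier ?M" for h x
  proof -
    let ?k = "\<lambda>x\<in>carrier ?M. h (?j x)"
    note h' = Gamma_homD[OF h(1)]
    have j: "?j \<in> umodule_hom F A ?M (restrict_umodule ?G ?i)"
      unfolding T_circ_def T_circ_alg_def by (rule G.Gamma_plus_gen_hom)
    note j' = umodule_homD[OF algebra_module_Omega1[OF dpa_A]
        algebra_module_restrict_umodule[OF dpa_A divided_power_algebra_T_circ T_circ_alg_hom] j,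
        unfolded restrict_umodule_def, simplified]
    have "?k \<in> umodule_hom F A ?M (restrict_umodule B f)"
      unfolding umodule_hom_def PiE_def
      by (auto simp: restrict_umodule_def j' h' h(2) T_circ_closed \<Omega>.act_closed)
    then have "?k x = g x"
      by (rule Omega1_hom_unique[OF dpa_A N _ g(1) _ x]) (use h(3) g(2) d_in in \<open>simp add: T_circ_d_def\<close>)
    then show ?thesis using x by simp
  qed
  from ex1 obtain h where h: "h \<in> Gamma_hom F ?G B" "\<forall>a\<in>carrier A. h (?i a) = f a"
    "\<forall>x\<in>carrier ?M. h (?j x) = g x" by blast
  show ?thesis
  proof (rule ex1I[of _ h])
    show "h \<in> Gamma_hom F ?G B \<and> (\<forall>a\<in>carrier A. h (?i a) = f a \<and> h (T_circ_d F A a) = \<delta> a)"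
      using h g(2) d_in by (simp add: T_circ_d_def)
  next
    fix h' assume "h' \<in> Gamma_hom F ?G B \<and> (\<forall>a\<in>carrier A. h' (?i a) = f a \<and> h' (T_circ_d F A a) = \<delta> a)"
    then have "h' \<in> Gamma_hom F ?G B \<and> (\<forall>a\<in>carrier A. h' (?i a) = f a) \<and>
        (\<forall>x\<in>carrier ?M. h' (?j x) = g x)"
      using gen[of h'] by simp
    with ex1 h show "h' = h" by blast
  qed
qed

section \<open>The transposition bijection\<close>

text \<open>The unit of the adjunction is \<open>a\<close> mapped to \<open>(a, da)\<close>, a
  morphism because \<open>d\<close> is a derivation compatible with divided powers; the transpose of
  \<open>h\<close> is the unit followed by \<open>T_map\<close> of \<open>h\<close>.\<close>

lemma T_transpose_in:
  fixes B :: "('f, 'b) dpalg"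
  assumes B: "divided_power_algebra F B" and h: "h \<in> Gamma_hom F (T_circ F A) B"
  shows "T_transpose F A h \<in> Gamma_hom F A (T_alg B)"
proof -
  have id: "(\<lambda>a\<in>carrier A. (T_circ_alg F A a, T_circ_d F A a)) \<in> Gamma_hom F A (T_alg (T_circ F A))"
    using Gamma_hom_T_alg_iff[OF dpa_A divided_power_algebra_T_circ] Gamma_homD(6)[OF T_circ_alg_hom]
      T_circ_alg_hom T_circ_d_derivation by blast
  have "compose (carrier A) (T_map (T_circ F A) h) (\<lambda>a\<in>carrier A. (T_circ_alg F A a, T_circ_d F A a))
      \<in> Gamma_hom F A (T_alg B)"
    by (rule Gamma_hom_compose[OF dpa_A id T_map_hom[OF divided_power_algebra_T_circ h]])
  also have "compose (carrier A) (T_map (T_circ F A) h)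
      (\<lambda>a\<in>carrier A. (T_circ_alg F A a, T_circ_d F A a)) = T_transpose F A h"
    by (auto simp: compose_def T_transpose_def T_map_apply T_circ_closed)
  finally show ?thesis .
qed

lemma T_transpose_ex1:
  fixes B :: "('f, 'b) dpalg"
  assumes B: "divided_power_algebra F B" and u: "u \<in> Gamma_hom F A (T_alg B)"
  shows "\<exists>!h. h \<in> Gamma_hom F (T_circ F A) B \<and> T_transpose F A h = u"
proof -
  \<comment> \<open>The first coordinate must be a morphism, hence extensional; the second is only
    ever evaluated on the carrier.\<close>
  let ?f = "\<lambda>a\<in>carrier A. fst (u a)" and ?\<delta> = "\<lambda>a. snd (u a)"
  have u_eq: "u = (\<lambda>a\<in>carrier A. (?f a, ?\<delta> a))"
    using Gamma_homD(6)[OF u] by (auto simp: extensional_def)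
  then have f: "?f \<in> Gamma_hom F A B" "dp_derivation F A (restrict_umodule B ?f) ?\<delta>"
    using Gamma_hom_T_alg_iff[OF dpa_A B, of ?f ?\<delta>] u by auto
  have "T_transpose F A h = u \<longleftrightarrow>
      (\<forall>a\<in>carrier A. h (T_circ_alg F A a) = ?f a \<and> h (T_circ_d F A a) = ?\<delta> a)" for h
    by (subst u_eq) (auto simp: T_transpose_def fun_eq_iff restrict_def prod_eq_iff)
  then show ?thesis using T_circ_universal[OF B f] by simp
qed

lemma bij_betw_T_transpose:
  fixes B :: "('f, 'b) dpalg"
  assumes "divided_power_algebra F B"
  shows "bij_betw (T_transpose F A) (Gamma_hom F (T_circ F A) B) (Gamma_hom F A (T_alg B))"
proof (rule bij_betwI')
  show "T_transpose F A h = T_transpose F A h' \<longleftrightarrow> h = h'"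
    if "h \<in> Gamma_hom F (T_circ F A) B" "h' \<in> Gamma_hom F (T_circ F A) B" for h h'
    using T_transpose_ex1[OF assms T_transpose_in[OF assms that(1)]] that by metis
qed (use T_transpose_in[OF assms] T_transpose_ex1[OF assms] in blast)+

end

text \<open>The image of \<open>f\<close> is the transpose of \<open>f\<close> followed by the unit of the adjunction, so no
  separate construction is needed.\<close>

lemma T_circ_map_ex1:
  fixes A :: "('f, 'a) dpalg" and B :: "('f, 'b) dpalg"
  assumes A: "divided_power_algebra F A" and B: "divided_power_algebra F B"
    and f: "f \<in> Gamma_hom F A B"
  shows "\<exists>!g. g \<in> Gamma_hom F (T_circ F A) (T_circ F B) \<and>
    (\<forall>a\<in>carrier A. g (T_circ_alg F A a) = T_circ_alg F B (f a) \<and>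
      g (T_circ_d F A a) = T_circ_d F B (f a))"
proof -
  let ?id = "\<lambda>x\<in>carrier (T_circ F B). x"
  let ?u = "compose (carrier A) (T_transpose F B ?id) f"
  note T = divided_power_algebra_T_circ[OF B]
  have "?u \<in> Gamma_hom F A (T_alg (T_circ F B))"
    by (rule Gamma_hom_compose[OF A f T_transpose_in[OF B T Gamma_hom_id[OF T]]])
  note ex1 = T_transpose_ex1[OF A T this]
  have "T_transpose F A g = ?u \<longleftrightarrow> (\<forall>a\<in>carrier A. g (T_circ_alg F A a) = T_circ_alg F B (f a) \<and>
      g (T_circ_d F A a) = T_circ_d F B (f a))" for g
    using Gamma_homD(1)[OF f]
    by (auto simp: T_transpose_def compose_def restrict_def fun_eq_iff T_circ_closed[OF B])
  with ex1 show ?thesis by simp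
qed

lemma T_circ_map:
  fixes A :: "('f, 'a) dpalg" and B :: "('f, 'b) dpalg"
  assumes "divided_power_algebra F A" "divided_power_algebra F B" "f \<in> Gamma_hom F A B"
  shows "T_circ_map F A B f \<in> Gamma_hom F (T_circ F A) (T_circ F B)"
    and "a \<in> carrier A \<Longrightarrow> T_circ_map F A B f (T_circ_alg F A a) = T_circ_alg F B (f a)"
    and "a \<in> carrier A \<Longrightarrow> T_circ_map F A B f (T_circ_d F A a) = T_circ_d F B (f a)"
  using theI'[OF T_circ_map_ex1[OF assms]] unfolding T_circ_map_def by blast+

text \<open>Yields both functor laws: identities and composites of the induced morphisms have the
  required values on \<open>a\<close> and \<open>da\<close>.\<close>

lemma T_circ_map_eqI:
  fixes A :: "('f, 'a) dpalg" and B :: "('f, 'b) dpalg"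
  assumes "divided_power_algebra F A" "divided_power_algebra F B" "f \<in> Gamma_hom F A B"
    and "g \<in> Gamma_hom F (T_circ F A) (T_circ F B)"
    and "\<And>a. a \<in> carrier A \<Longrightarrow> g (T_circ_alg F A a) = T_circ_alg F B (f a)"
    and "\<And>a. a \<in> carrier A \<Longrightarrow> g (T_circ_d F A a) = T_circ_d F B (f a)"
  shows "T_circ_map F A B f = g"
  unfolding T_circ_map_def
  by (rule the1_equality[OF T_circ_map_ex1[OF assms(1-3)]]) (use assms(4-6) in blast)

lemma T_circ_map_id:
  fixes A :: "('f, 'a) dpalg"
  assumes A: "divided_power_algebra F A"
  shows "T_circ_map F A A (\<lambda>x\<in>carrier A. x) = (\<lambda>x\<in>carrier (T_circ F A). x)"
  by (rule T_circ_map_eqI[OF A A Gamma_hom_id[OF A] Gamma_hom_id[OF divided_power_algebra_T_circ[OF A]]])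
    (simp_all add: T_circ_closed[OF A])

lemma T_circ_map_compose:
  fixes A :: "('f, 'a) dpalg" and B :: "('f, 'b) dpalg" and C :: "('f, 'c) dpalg"
  assumes A: "divided_power_algebra F A" and B: "divided_power_algebra F B"
    and C: "divided_power_algebra F C" and f: "f \<in> Gamma_hom F A B" and g: "g \<in> Gamma_hom F B C"
  shows "T_circ_map F A C (compose (carrier A) g f) =
    compose (carrier (T_circ F A)) (T_circ_map F B C g) (T_circ_map F A B f)"
  by (rule T_circ_map_eqI[OF A C Gamma_hom_compose[OF A f g]
      Gamma_hom_compose[OF divided_power_algebra_T_circ[OF A] T_circ_map(1)[OF A B f] T_circ_map(1)[OF B C g]]])
    (simp_all add: compose_eq T_circ_closed[OF A] T_circ_map[OF A B f] T_circ_map[OF B C g] Gamma_homD(1)[OF f])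

section \<open>Naturality and the adjunction theorem\<close>

text \<open>At \<open>a\<close> in the carrier, both sides are the pair of images under
  \<open>h\<close> and then \<open>g\<close> of the generators \<open>f a\<close> and
  \<open>d(f a)\<close>; elsewhere both are undefined by extensionality.\<close>

lemma T_transpose_natural:
  fixes A :: "('f, 'a) dpalg" and A' :: "('f, 'a1) dpalg" and B :: "('f, 'b) dpalg"
  assumes A: "divided_power_algebra F A" and A': "divided_power_algebra F A'"
    and f: "f \<in> Gamma_hom F A A'" and h: "h \<in> Gamma_hom F (T_circ F A') B"
  shows "T_transpose F A (compose (carrier (T_circ F A)) g
      (compose (carrier (T_circ F A)) h (T_circ_map F A A' f))) =
    compose (carrier A) (T_map B g) (compose (carrier A) (T_transpose F A' h) f)"
proof
  fix a
  show "T_transpose F A (compose (carrier (T_circ F A)) g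
      (compose (carrier (T_circ F A)) h (T_circ_map F A A' f))) a =
    compose (carrier A) (T_map B g) (compose (carrier A) (T_transpose F A' h) f) a"
  proof (cases "a \<in> carrier A")
    case True
    then show ?thesis
      by (simp add: T_transpose_def compose_eq T_circ_closed[OF A] T_circ_map[OF A A' f]
          Gamma_homD(1)[OF f] T_map_apply Gamma_homD(1)[OF h] T_circ_closed[OF A'])
  qed (simp add: T_transpose_def compose_def)
qed

text \<open>One equation expresses naturality in both variables: taking \<open>g\<close> or
  \<open>f\<close> to be an identity gives the two separate squares. The algebras live on separate
  types, so that the statement ranges over arbitrary carriers.\<close>

theorem proposition3p2:
  fixes F :: "'f ring" and p :: nat
    and A :: "('f, 'a) dpalg" and A' :: "('f, 'a1) dpalg" and A'' :: "('f, 'a2) dpalg"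
    and B :: "('f, 'b) dpalg" and B' :: "('f, 'b1) dpalg" and B'' :: "('f, 'b2) dpalg"
  assumes "field F" and "ring_char F = p" and "p > 0"
    and "A \<in> Gamma_alg F" "A' \<in> Gamma_alg F" "A'' \<in> Gamma_alg F"
    and "B \<in> Gamma_alg F" "B' \<in> Gamma_alg F" "B'' \<in> Gamma_alg F"
  shows "T_circ F A \<in> Gamma_alg F
    \<and> (\<forall>f\<in>Gamma_hom F A A'. T_circ_map F A A' f \<in> Gamma_hom F (T_circ F A) (T_circ F A'))
    \<and> T_circ_map F A A (\<lambda>x\<in>carrier A. x) = (\<lambda>x\<in>carrier (T_circ F A). x)
    \<and> (\<forall>f\<in>Gamma_hom F A A'. \<forall>f'\<in>Gamma_hom F A' A''.
        T_circ_map F A A'' (compose (carrier A) f' f) =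
        compose (carrier (T_circ F A)) (T_circ_map F A' A'' f') (T_circ_map F A A' f))
    \<and> T_obj F p B \<in> Gamma_alg F
    \<and> (\<forall>g\<in>Gamma_hom F B B'. T_map B g \<in> Gamma_hom F (T_obj F p B) (T_obj F p B'))
    \<and> T_map B (\<lambda>x\<in>carrier B. x) = (\<lambda>x\<in>carrier (T_obj F p B). x)
    \<and> (\<forall>g\<in>Gamma_hom F B B'. \<forall>g'\<in>Gamma_hom F B' B''.
        T_map B (compose (carrier B) g' g) =
        compose (carrier (T_obj F p B)) (T_map B' g') (T_map B g))
    \<and> bij_betw (T_transpose F A) (Gamma_hom F (T_circ F A) B) (Gamma_hom F A (T_obj F p B))
    \<and> (\<forall>f\<in>Gamma_hom F A A'. \<forall>h\<in>Gamma_hom F (T_circ F A') B. \<forall>g\<in>Gamma_hom F B B'.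
        T_transpose F A
          (compose (carrier (T_circ F A)) g
            (compose (carrier (T_circ F A)) h (T_circ_map F A A' f))) =
        compose (carrier A) (T_map B g)
          (compose (carrier A) (T_transpose F A' h) f))"
proof -
  have A: "divided_power_algebra F A" "divided_power_algebra F A'" "divided_power_algebra F A''"
    and B: "divided_power_algebra F B" "divided_power_algebra F B'"
    using assms by (simp_all add: Gamma_alg_def)
  \<comment> \<open>This replaces the definite description by the explicit powers, and is the one
    place where the characteristic enters.\<close>
  have T_obj: "T_obj F p B = T_alg B" "T_obj F p B' = T_alg B'"
    using B[THEN T_dpow_eq_T_powers, OF assms(2,3)] by (simp_all add: T_obj_def)
  show ?thesis
    unfolding T_obj
  proof (intro conjI ballI)
    show "T_circ F A \<in> Gamma_alg F"
      using divided_power_algebra_T_circ[OF A(1)] by (simp add: Gamma_alg_def)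
    show "T_circ_map F A A' f \<in> Gamma_hom F (T_circ F A) (T_circ F A')"
      if "f \<in> Gamma_hom F A A'" for f
      using T_circ_map(1)[OF A(1,2) that] .
    show "T_circ_map F A A (\<lambda>x\<in>carrier A. x) = (\<lambda>x\<in>carrier (T_circ F A). x)"
      by (rule T_circ_map_id[OF A(1)])
    show "T_circ_map F A A'' (compose (carrier A) f' f) =
        compose (carrier (T_circ F A)) (T_circ_map F A' A'' f') (T_circ_map F A A' f)"
      if "f \<in> Gamma_hom F A A'" "f' \<in> Gamma_hom F A' A''" for f f'
      by (rule T_circ_map_compose[OF A that])
    show "T_alg B \<in> Gamma_alg F"
      using divided_power_algebra_T_powers[OF B(1)] by (simp add: Gamma_alg_def)
    show "T_map B g \<in> Gamma_hom F (T_alg B) (T_alg B')" if "g \<in> Gamma_hom F B B'" for g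
      by (rule T_map_hom[OF B(1) that])
    show "T_map B (\<lambda>x\<in>carrier B. x) = (\<lambda>x\<in>carrier (T_alg B). x)"
      by (rule T_map_id)
    show "T_map B (compose (carrier B) g' g) = compose (carrier (T_alg B)) (T_map B' g') (T_map B g)"
      if "g \<in> Gamma_hom F B B'" for g and g' :: "'b1 \<Rightarrow> 'b2"
      by (rule T_map_compose) (rule Gamma_homD(1)[OF that])
    show "bij_betw (T_transpose F A) (Gamma_hom F (T_circ F A) B) (Gamma_hom F A (T_alg B))"
      by (rule bij_betw_T_transpose[OF A(1) B(1)])
    show "T_transpose F A (compose (carrier (T_circ F A)) g
          (compose (carrier (T_circ F A)) h (T_circ_map F A A' f))) =
        compose (carrier A) (T_map B g) (compose (carrier A) (T_transpose F A' h) f)"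
      if "f \<in> Gamma_hom F A A'" "h \<in> Gamma_hom F (T_circ F A') B" for f h and g :: "'b \<Rightarrow> 'b1"
      by (rule T_transpose_natural[OF A(1,2) that])
  qed
qed

end
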